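(* Let $n\ge 2$. If a domain $U$ in $\mathbb{R}^n$ is strictly convex, then it is uniquely determined in the class of all domains in $\mathbb{R}^n$ by the condition of local isometry of (Hausdorff) boundaries in the relative metrics.
   Context: A domain is an open connected set. A domain $U$ is strictly convex if it is convex and, for any two distinct points of its closure, the open segment joining them is contained in $U$. Hausdorff boundary and relative metric: for a domain $U\subset\mathbb{R}^n$, the intrinsic metric $\rho_U(x,y)$ ($x,y\in U$) is the infimum of the lengths of curves joining $x$ and $y$ within $U$. Let $(U_H,\rho_{U_H})$ be the metric completion of $(U,\rho_U)$. Identify the points of $U$ with the corresponding points of the completion and remove them; the remaining set $\partial_H U=U_H\setminus U$ is the Hausdorff boundary of $U$, and the restriction $\rho_{\partial_H U,U}$ of $\rho_{U_H}$ to $\partial_H U$ is the relative metric on it. Local isometry: the Hausdorff boundaries of domains $U$ and $V$ are locally isometric in the relative metrics if there is a bijection $f:\partial_H U\to\partial_H V$ such that for every $y\in\partial_H U$ there is $\varepsilon>0$ with $\rho_{\partial_H U,U}(a,b)=\rho_{\partial_H V,V}(f(a),f(b))$ for all $a,b\in\{z\in\partial_H U:\rho_{\partial_H U,U}(z,y)<\varepsilon\}$. Unique determination: a domain $U$ in a class $\mathcal{M}$ of domains in $\mathbb{R}^n$ is uniquely determined in $\mathcal{M}$ by the condition of local isometry of boundaries in the relative metrics if every $V\in\mathcal{M}$ whose Hausdorff boundary is locally isometric to that of $U$ in the relative metrics is isometric to $U$ with respect to the Euclidean metric (i.e. there is a Euclidean isometry $J:\mathbb{R}^n\to\mathbb{R}^n$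 with $J(U)=V$). *)

theory Defs
  imports "HOL-Analysis.Analysis"
begin

(* Nonemptiness is part of the usual notion of a domain. Without it the empty set and the whole
   space would be two "domains" with the same (empty) Hausdorff boundary. *)
definition is_domain :: "'a::topological_space set \<Rightarrow> bool" where
  "is_domain U \<longleftrightarrow> open U \<and> connected U \<and> U \<noteq> {}"

definition strictly_convex_domain :: "'a::real_normed_vector set \<Rightarrow> bool" where
  "strictly_convex_domain U \<longleftrightarrow> is_domain U \<and> convex U \<and>
     (\<forall>x\<in>closure U. \<forall>y\<in>closure U. x \<noteq> y \<longrightarrow> open_segment x y \<subseteq> U)"

(* Supremum of the lengths of inscribed polygons; each sorted list of parameters is a partition. *)
definition curve_length :: "(real \<Rightarrow> 'a::metric_space) \<Rightarrow> ennreal" where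
  "curve_length g =
     (SUP ts\<in>{ts. sorted ts \<and> set ts \<subseteq> {0..1}}.
        \<Sum>i<length ts - 1. ennreal (dist (g (ts ! i)) (g (ts ! Suc i))))"

definition curves_within :: "'a::topological_space set \<Rightarrow> 'a \<Rightarrow> 'a \<Rightarrow> (real \<Rightarrow> 'a) set" where
  "curves_within U x y = {g. path g \<and> path_image g \<subseteq> U \<and> pathstart g = x \<and> pathfinish g = y}"

(* The infimum is finite for points of a domain, so the conversion to real (which sends
   infinity to 0) loses nothing there. *)
definition intrinsic_dist :: "'a::metric_space set \<Rightarrow> 'a \<Rightarrow> 'a \<Rightarrow> real" where
  "intrinsic_dist U x y = enn2real (INF g\<in>curves_within U x y. curve_length g)"

(* Metric completion of (M, d): Cauchy sequences modulo vanishing distance. *)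
definition cauchy_equiv ::
    "'a set \<Rightarrow> ('a \<Rightarrow> 'a \<Rightarrow> real) \<Rightarrow> ((nat \<Rightarrow> 'a) \<times> (nat \<Rightarrow> 'a)) set" where
  "cauchy_equiv M d = {(s, t). Metric_space.MCauchy M d s \<and> Metric_space.MCauchy M d t \<and>
     (\<lambda>n. d (s n) (t n)) \<longlonglongrightarrow> 0}"

definition completion_points :: "'a set \<Rightarrow> ('a \<Rightarrow> 'a \<Rightarrow> real) \<Rightarrow> (nat \<Rightarrow> 'a) set set" where
  "completion_points M d = {s. Metric_space.MCauchy M d s} // cauchy_equiv M d"

(* The limit exists and does not depend on the representatives when (M, d) is a metric space
   and X, Y are points of its completion. *)
definition completion_dist ::
    "('a \<Rightarrow> 'a \<Rightarrow> real) \<Rightarrow> (nat \<Rightarrow> 'a) set \<Rightarrow> (nat \<Rightarrow> 'a) set \<Rightarrow> real" where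
  "completion_dist d X Y = (THE r. \<forall>s\<in>X. \<forall>t\<in>Y. (\<lambda>n. d (s n) (t n)) \<longlonglongrightarrow> r)"

definition completion_embed ::
    "'a set \<Rightarrow> ('a \<Rightarrow> 'a \<Rightarrow> real) \<Rightarrow> 'a \<Rightarrow> (nat \<Rightarrow> 'a) set" where
  "completion_embed M d x = cauchy_equiv M d `` {\<lambda>_. x}"

definition hausdorff_boundary :: "'a::metric_space set \<Rightarrow> (nat \<Rightarrow> 'a) set set" where
  "hausdorff_boundary U =
     completion_points U (intrinsic_dist U) - completion_embed U (intrinsic_dist U) ` U"

definition relative_dist :: "'a::metric_space set \<Rightarrow> (nat \<Rightarrow> 'a) set \<Rightarrow> (nat \<Rightarrow> 'a) set \<Rightarrow> real" where
  "relative_dist U = completion_dist (intrinsic_dist U)"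

definition locally_isometric_boundaries :: "'a::metric_space set \<Rightarrow> 'a set \<Rightarrow> bool" where
  "locally_isometric_boundaries U V \<longleftrightarrow>
     (\<exists>f. bij_betw f (hausdorff_boundary U) (hausdorff_boundary V) \<and>
        (\<forall>y\<in>hausdorff_boundary U. \<exists>\<epsilon>>0.
           \<forall>a\<in>{z\<in>hausdorff_boundary U. relative_dist U z y < \<epsilon>}.
           \<forall>b\<in>{z\<in>hausdorff_boundary U. relative_dist U z y < \<epsilon>}.
             relative_dist U a b = relative_dist V (f a) (f b)))"

definition euclidean_isometric :: "'a::metric_space set \<Rightarrow> 'a set \<Rightarrow> bool" where
  "euclidean_isometric U V \<longleftrightarrow> (\<exists>J. (\<forall>x y. dist (J x) (J y) = dist x y) \<and> J ` U = V)"

definition uniquely_determined_in :: "'a::metric_space set set \<Rightarrow> 'a set \<Rightarrow> bool" where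
  "uniquely_determined_in \<M> U \<longleftrightarrow>
     U \<in> \<M> \<and> (\<forall>V\<in>\<M>. locally_isometric_boundaries U V \<longrightarrow> euclidean_isometric U V)"

end

theory Submission
  imports Defs
begin

text \<open>
  Let \<open>U\<close> be strictly convex and let \<open>V\<close> be a domain whose Hausdorff boundary \<open>H\<close> is locally
  isometric to that of \<open>U\<close>. The intrinsic metric of a convex set is the Euclidean one, so the given
  bijection amounts to a bijection \<open>F\<close> from the boundary \<open>\<Omega>\<close> of \<open>U\<close> onto \<open>H\<close> such that, near every
  point of \<open>\<Omega>\<close>, the distance of \<open>F a\<close> and \<open>F b\<close> in the completion of \<open>V\<close> is the Euclidean distance
  of \<open>a\<close> and \<open>b\<close>.

  The basic idea: an almost shortest connection of \<open>F a\<close> and \<open>F b\<close> inside \<open>V\<close> cannot come close to the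
  boundary of \<open>V\<close> far from its ends. It would come close to some \<open>F c\<close>, where \<open>c\<close> lies between \<open>a\<close>
  and \<open>b\<close>; but \<open>c\<close> belongs to \<open>\<Omega>\<close> and strict convexity puts the points between \<open>a\<close> and \<open>b\<close> into
  \<open>U\<close>. Hence \<open>F a\<close> and \<open>F b\<close> are joined by a straight segment inside \<open>V\<close> (lemma
  \<open>straight_chords\<close>). Consequently \<open>F\<close> is locally the restriction of a rigid motion \<open>J\<close>, and as short
  chords fill a neighbourhood of every boundary point of \<open>U\<close>, this motion carries a piece of \<open>U\<close>
  into \<open>V\<close>. Such a piece is called a chart (lemma \<open>good_imp_chart\<close>). The boundary \<open>\<Omega>\<close> is connected,
  so there is one motion \<open>J\<close> for all charts, and then \<open>J ` U = V\<close>.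

  There is one serious obstacle. The inverse of \<open>F\<close> need not be continuous a priori: if \<open>U\<close> is
  unbounded, then \<open>F c\<^sub>k\<close> could converge to \<open>F z\<close> although \<open>c\<^sub>k\<close> tends to infinity. The argument
  above works at a point \<open>z\<close> where this does not happen, a good point. That all points are good
  (lemma \<open>all_points_good\<close>) is proved as follows. By Baire's argument, some bad point \<open>z\<close> has the
  property that all bad points \<open>y\<close> with \<open>F y\<close> near \<open>F z\<close> lie in a bounded set. So in a sequence
  \<open>c\<^sub>k\<close> as above, all points of \<open>\<Omega>\<close> near \<open>c\<^sub>k\<close> that are reached along short curves in \<open>\<Omega>\<close> are good,
  with the same bound on the length for all large \<open>k\<close>. Therefore each \<open>c\<^sub>k\<close> produces a wall of fixed
  size in the boundary of \<open>V\<close>: a congruent copy of a piece of \<open>\<Omega>\<close>, with \<open>V\<close> on its inner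
  side. All these walls pass near one point, they are close to each other in the sense of the
  intrinsic metric, and by compactness two of them have almost the same normal. This is impossible, because \<open>V\<close>
  cannot cross a wall (lemma \<open>no_two_walls\<close>).

  Since \<open>U\<close> may be very thin at infinity, the part of the outside of \<open>U\<close> that is adjacent to the wall
  has to be chosen with care. It is the connected component of the outside of \<open>U\<close> in a small ball
  around \<open>c\<^sub>k\<close>, and lemma \<open>D_F_pr_Ext\<close> shows that \<open>F\<close> maps its nearest point projection to
  \<open>\<Omega>\<close> into a neighbourhood of \<open>F c\<^sub>k\<close> of comparable size.
\<close>

section \<open>Length of curves and the intrinsic metric\<close>

fun polygon_length :: "(real \<Rightarrow> 'a::metric_space) \<Rightarrow> real list \<Rightarrow> real" where
  "polygon_length g (s # t # ts) = dist (g s) (g t) + polygon_length g (t # ts)"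
| "polygon_length g _ = 0"

lemma polygon_length_nonneg: "0 \<le> polygon_length g ts"
  by (induction g ts rule: polygon_length.induct) auto

lemma polygon_length_eq_sum:
  "(\<Sum>i<length ts - 1. ennreal (dist (g (ts ! i)) (g (ts ! Suc i)))) = ennreal (polygon_length g ts)"
proof (induction g ts rule: polygon_length.induct)
  case (1 g s t ts)
  have "(\<Sum>i<length (s # t # ts) - 1. ennreal (dist (g ((s # t # ts) ! i)) (g ((s # t # ts) ! Suc i))))
     = (\<Sum>i<Suc (length (t # ts) - 1). ennreal (dist (g ((s # t # ts) ! i)) (g ((s # t # ts) ! Suc i))))"
    by simp
  also have "\<dots> = ennreal (dist (g s) (g t))
     + (\<Sum>i<length (t # ts) - 1. ennreal (dist (g ((t # ts) ! i)) (g ((t # ts) ! Suc i))))"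
    by (subst sum.lessThan_Suc_shift) simp
  finally show ?case
    using 1 by (simp add: polygon_length_nonneg ennreal_plus)
qed auto

lemma curve_length_altdef:
  "curve_length g = (SUP ts\<in>{ts. sorted ts \<and> set ts \<subseteq> {0..1}}. ennreal (polygon_length g ts))"
  unfolding curve_length_def polygon_length_eq_sum ..

lemma polygon_length_append:
  "polygon_length g (xs @ m # ys) = polygon_length g (xs @ [m]) + polygon_length g (m # ys)"
  by (induction g xs rule: polygon_length.induct) auto

text \<open>An extra vertex does not shorten a polygon; this is how a partition is split at the parameter where
  two curves are joined.\<close>
lemma polygon_length_insert:
  "polygon_length g (xs @ ys) \<le> polygon_length g (xs @ [m]) + polygon_length g (m # ys)"
proof (induction g xs rule: polygon_length.induct)
  case (1 g s t ts)
  then show ?case by simp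
next
  case ("2_1" g)
  then show ?case by (cases ys) auto
next
  case ("2_2" g v)
  then show ?case
    by (cases ys) (auto simp: dist_triangle)
qed

lemma polygon_length_map: "polygon_length g (map h ts) = polygon_length (g \<circ> h) ts"
  by (induction "g \<circ> h" ts rule: polygon_length.induct) auto

lemma polygon_length_cong:
  "(\<And>t. t \<in> set ts \<Longrightarrow> g t = h t) \<Longrightarrow> polygon_length g ts = polygon_length h ts"
  by (induction g ts rule: polygon_length.induct) auto

lemma polygon_length_snoc:
  "polygon_length g (xs @ [s, t]) = polygon_length g (xs @ [s]) + dist (g s) (g t)"
  using polygon_length_append[of g xs s "[t]"] by simp

lemma polygon_length_rev: "polygon_length g (rev ts) = polygon_length g ts"
proof (induction g ts rule: polygon_length.induct)
  case (1 g s t ts)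
  have "polygon_length g (rev (s # t # ts)) = polygon_length g (rev ts @ [t, s])" by simp
  also have "\<dots> = polygon_length g (rev (t # ts)) + dist (g t) (g s)"
    by (simp add: polygon_length_snoc)
  finally show ?case using 1 by (simp add: dist_commute)
qed auto

lemma polygon_length_le_curve_length:
  "sorted ts \<Longrightarrow> set ts \<subseteq> {0..1} \<Longrightarrow> ennreal (polygon_length g ts) \<le> curve_length g"
  unfolding curve_length_altdef by (rule SUP_upper) auto

lemma curve_length_le:
  "(\<And>ts. sorted ts \<Longrightarrow> set ts \<subseteq> {0..1} \<Longrightarrow> ennreal (polygon_length g ts) \<le> L) \<Longrightarrow> curve_length g \<le> L"
  unfolding curve_length_altdef by (rule SUP_least) auto

lemma dist_le_curve_length:
  "g \<in> curves_within U x y \<Longrightarrow> ennreal (dist x y) \<le> curve_length g"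
  using polygon_length_le_curve_length[of "[0,1]" g]
  by (auto simp: curves_within_def pathstart_def pathfinish_def)

lemma curve_length_linepath: 
  fixes x y :: "'a::real_normed_vector"
  shows "curve_length (linepath x y) \<le> ennreal (dist x y)"
proof (rule curve_length_le)
  fix ts :: "real list"
  assume ts: "sorted ts" "set ts \<subseteq> {0..1}"
  have d: "dist (linepath x y s) (linepath x y t) = \<bar>t - s\<bar> * dist x y" for s t
  proof -
    have "linepath x y s - linepath x y t = (t - s) *\<^sub>R (x - y)"
      by (simp add: linepath_def algebra_simps)
    then show ?thesis by (simp add: dist_norm)
  qed
  have "polygon_length (linepath x y) ts \<le> (1 - hd ts) * dist x y" if "ts \<noteq> []"
    using ts that
  proof (induction ts rule: induct_list012)
    case (3 s t ts)
    then show ?case by (auto simp: d algebra_simps)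
  next
    case (2 s)
    then show ?case by auto
  qed auto
  also have "(1 - hd ts) * dist x y \<le> 1 * dist x y" if "ts \<noteq> []"
    using that ts by (intro mult_right_mono) (auto simp: hd_in_set subset_iff)
  finally show "ennreal (polygon_length (linepath x y) ts) \<le> ennreal (dist x y)"
    by (cases "ts = []") (auto intro!: ennreal_leI)
qed

lemma curve_length_reversepath: "curve_length (reversepath g) \<le> curve_length g"
proof (rule curve_length_le)
  fix ts :: "real list"
  assume ts: "sorted ts" "set ts \<subseteq> {0..1}"
  have "polygon_length (reversepath g) ts = polygon_length g (rev (map (\<lambda>t. 1 - t) ts))"
    by (simp only: polygon_length_rev polygon_length_map) (simp add: reversepath_def comp_def)
  moreover have "sorted (rev (map (\<lambda>t. 1 - t) ts))"
    using ts(1) by (simp add: sorted_wrt_rev sorted_wrt_map)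
  moreover have "set (rev (map (\<lambda>t. 1 - t) ts)) \<subseteq> {0..1}"
    using ts(2) by auto
  ultimately show "ennreal (polygon_length (reversepath g) ts) \<le> curve_length g"
    using polygon_length_le_curve_length by metis
qed

lemma curve_length_joinpaths:
  assumes "pathfinish g = pathstart h"
  shows "curve_length (g +++ h) \<le> curve_length g + curve_length h"
proof (rule curve_length_le)
  fix ts :: "real list"
  assume ts: "sorted ts" "set ts \<subseteq> {0..1}"
  define xs where "xs = takeWhile (\<lambda>t. t \<le> 1/2) ts"
  define ys where "ys = dropWhile (\<lambda>t. t \<le> 1/2) ts"
  have ts_eq: "ts = xs @ ys" by (simp add: xs_def ys_def)
  have sxy: "sorted xs" "sorted ys" using ts(1) ts_eq sorted_append by metis+
  have xs: "t \<le> 1/2" if "t \<in> set xs" for t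
    using that set_takeWhileD unfolding xs_def by fastforce
  have ys: "t > 1/2" if "t \<in> set ys" for t
  proof -
    have "ys \<noteq> []" using that by auto
    then have "hd ys > 1/2" using hd_dropWhile[of "\<lambda>t. t \<le> 1/2" ts] unfolding ys_def by auto
    moreover have "hd ys \<le> t" using sxy(2) that by (cases ys) auto
    ultimately show ?thesis by simp
  qed
  have A: "polygon_length (g +++ h) (xs @ [1/2]) = polygon_length g (map (\<lambda>t. 2 * t) (xs @ [1/2]))"
    unfolding polygon_length_map
    by (rule polygon_length_cong) (use xs in \<open>auto simp: joinpaths_def\<close>)
  have B: "polygon_length (g +++ h) (1/2 # ys) = polygon_length h (map (\<lambda>t. 2 * t - 1) (1/2 # ys))"
    unfolding polygon_length_map
    by (rule polygon_length_cong)
       (use ys assms in \<open>auto simp: joinpaths_def pathfinish_def pathstart_def mult.commute dest!: ys\<close>)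
  have "ennreal (polygon_length (g +++ h) (xs @ [1/2])) \<le> curve_length g"
    unfolding A by (rule polygon_length_le_curve_length)
      (use sxy ts(2) xs in \<open>force simp: ts_eq sorted_wrt_map sorted_append\<close>)+
  moreover have "ennreal (polygon_length (g +++ h) (1/2 # ys)) \<le> curve_length h"
    unfolding B by (rule polygon_length_le_curve_length)
      (use sxy ts(2) ys in \<open>force simp: ts_eq sorted_wrt_map\<close>)+
  moreover have "polygon_length (g +++ h) ts
     \<le> polygon_length (g +++ h) (xs @ [1/2]) + polygon_length (g +++ h) (1/2 # ys)"
    unfolding ts_eq by (rule polygon_length_insert)
  ultimately show "ennreal (polygon_length (g +++ h) ts) \<le> curve_length g + curve_length h"
    by (smt (verit, best) add_mono ennreal_leI ennreal_plus order_trans polygon_length_nonneg)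
qed

lemma curve_length_split:
  assumes "0 \<le> t" "t \<le> 1"
  shows "curve_length (subpath 0 t g) + curve_length (subpath t 1 g) \<le> curve_length g"
proof -
  let ?S = "{ts. sorted ts \<and> set ts \<subseteq> {0..1::real}}"
  have ne: "?S \<noteq> {}" by (auto intro!: exI[of _ "[]"])
  have *: "ennreal (polygon_length (subpath 0 t g) xs) + ennreal (polygon_length (subpath t 1 g) ys)
     \<le> curve_length g" if xs: "xs \<in> ?S" and ys: "ys \<in> ?S" for xs ys
  proof -
    define xs' where "xs' = map (\<lambda>s. t * s) xs"
    define ys' where "ys' = map (\<lambda>s. t + (1 - t) * s) ys"
    have xs'1: "s \<le> t" "0 \<le> s" if "s \<in> set xs'" for s
      using that xs assms by (auto simp: xs'_def mult_left_le subset_iff)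
    have ys'1: "t \<le> s" "s \<le> 1" if "s \<in> set ys'" for s
    proof -
      from that obtain u where u: "u \<in> {0..1}" "s = t + (1 - t) * u" using ys by (auto simp: ys'_def)
      then show "t \<le> s" "s \<le> 1" using assms mult_left_le[of u "1 - t"] by auto
    qed
    have "sorted xs'" "sorted ys'"
      using xs ys assms by (auto simp: xs'_def ys'_def sorted_wrt_map mult_left_mono
          elim!: sorted_wrt_mono_rel[rotated])
    then have s: "sorted (xs' @ t # ys')" "set (xs' @ t # ys') \<subseteq> {0..1}"
      using xs'1 ys'1 assms by (force simp: sorted_append)+
    have "polygon_length (subpath 0 t g) xs = polygon_length g xs'"
      unfolding xs'_def polygon_length_map by (rule polygon_length_cong) (simp add: subpath_def)
    also have "\<dots> \<le> polygon_length g (xs' @ [t])"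
      using polygon_length_append[of g _ _ "[t]"] 
      by (cases xs' rule: rev_cases) (auto simp: polygon_length_snoc)
    finally have 1: "polygon_length (subpath 0 t g) xs \<le> polygon_length g (xs' @ [t])" .
    have "polygon_length (subpath t 1 g) ys = polygon_length g ys'"
      unfolding ys'_def polygon_length_map
      by (rule polygon_length_cong) (simp add: subpath_def add.commute)
    also have "\<dots> \<le> polygon_length g (t # ys')"
      by (cases ys') auto
    finally have 2: "polygon_length (subpath t 1 g) ys \<le> polygon_length g (t # ys')" .
    have "polygon_length (subpath 0 t g) xs + polygon_length (subpath t 1 g) ys
      \<le> polygon_length g (xs' @ t # ys')"
      using 1 2 polygon_length_append[of g xs' t ys'] by linarith
    then show ?thesis
      using polygon_length_le_curve_length[OF s]
      by (smt (verit, best) ennreal_leI ennreal_plus order_trans polygon_length_nonneg)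
  qed
  have "curve_length (subpath 0 t g) + ennreal (polygon_length (subpath t 1 g) ys) \<le> curve_length g"
    if "ys \<in> ?S" for ys
    unfolding curve_length_altdef[of "subpath 0 t g"] 
    by (subst ennreal_SUP_add_left[symmetric, OF ne]) (use * that in \<open>auto intro!: SUP_least\<close>)
  then show ?thesis
    unfolding curve_length_altdef[of "subpath t 1 g"] 
    by (subst ennreal_SUP_add_right[OF ne]) (auto intro!: SUP_least)
qed

text \<open>The intrinsic distance as an extended number. The triangle inequality is needed before it is known
  that points of a domain have finite distance, because finiteness is derived from it.\<close>
definition intrinsic_inf :: "'a::metric_space set \<Rightarrow> 'a \<Rightarrow> 'a \<Rightarrow> ennreal" where
  "intrinsic_inf U x y = (INF g\<in>curves_within U x y. curve_length g)"

lemma intrinsic_inf_le: "g \<in> curves_within U x y \<Longrightarrow> intrinsic_inf U x y \<le> curve_length g"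
  unfolding intrinsic_inf_def by (rule INF_lower)

lemma dist_le_intrinsic_inf: "ennreal (dist x y) \<le> intrinsic_inf U x y"
  unfolding intrinsic_inf_def by (rule INF_greatest) (rule dist_le_curve_length)

lemma intrinsic_inf_segment:
  fixes x y :: "'a::real_normed_vector"
  assumes "closed_segment x y \<subseteq> U"
  shows "intrinsic_inf U x y = ennreal (dist x y)"
proof (rule antisym[OF _ dist_le_intrinsic_inf])
  have "linepath x y \<in> curves_within U x y" using assms by (simp add: curves_within_def)
  then show "intrinsic_inf U x y \<le> ennreal (dist x y)"
    using intrinsic_inf_le curve_length_linepath order_trans by blast
qed

lemma intrinsic_inf_commute: "intrinsic_inf U x y = intrinsic_inf U y x"
proof -
  have "intrinsic_inf U x y \<le> intrinsic_inf U y x" for x y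
  proof -
    have "intrinsic_inf U x y \<le> curve_length g" if "g \<in> curves_within U y x" for g
    proof -
      have "reversepath g \<in> curves_within U x y" using that by (simp add: curves_within_def)
      then show ?thesis using intrinsic_inf_le curve_length_reversepath order_trans by blast
    qed
    then show ?thesis unfolding intrinsic_inf_def[of U y x] by (rule INF_greatest)
  qed
  then show ?thesis by (simp add: antisym)
qed

lemma intrinsic_inf_triangle: "intrinsic_inf U x z \<le> intrinsic_inf U x y + intrinsic_inf U y z"
proof (rule ennreal_le_epsilon)
  fix e :: real
  assume fin: "intrinsic_inf U x y + intrinsic_inf U y z < top" and e: "0 < e"
  have e2: "0 < e / 2" using e by simp
  obtain g where g: "g \<in> curves_within U x y" "curve_length g < intrinsic_inf U x y + ennreal (e / 2)"
    using INF_approx_ennreal[OF e2 intrinsic_inf_def[of U x y]] fin by (auto simp: less_top)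
  obtain h where h: "h \<in> curves_within U y z" "curve_length h < intrinsic_inf U y z + ennreal (e / 2)"
    using INF_approx_ennreal[OF e2 intrinsic_inf_def[of U y z]] fin by (auto simp: less_top)
  have "g +++ h \<in> curves_within U x z"
    using g(1) h(1) by (auto simp: curves_within_def path_image_join)
  moreover have "pathfinish g = pathstart h" using g(1) h(1) by (simp add: curves_within_def)
  ultimately have "intrinsic_inf U x z \<le> curve_length g + curve_length h"
    using intrinsic_inf_le curve_length_joinpaths order_trans by metis
  also have "\<dots> \<le> (intrinsic_inf U x y + ennreal (e / 2)) + (intrinsic_inf U y z + ennreal (e / 2))"
    using g h by (intro add_mono) auto
  also have "\<dots> = intrinsic_inf U x y + intrinsic_inf U y z + (ennreal (e / 2) + ennreal (e / 2))"
    by (simp add: ac_simps)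
  also have "ennreal (e / 2) + ennreal (e / 2) = ennreal e"
    using e by (subst ennreal_plus[symmetric]) auto
  finally show "intrinsic_inf U x z \<le> intrinsic_inf U x y + intrinsic_inf U y z + ennreal e" .
qed

text \<open>Having finite distance is an equivalence relation with open classes, and a domain is connected.\<close>
lemma intrinsic_inf_finite:
  fixes U :: "'a::real_normed_vector set"
  assumes "is_domain U" "x \<in> U" "y \<in> U"
  shows "intrinsic_inf U x y < \<infinity>"
proof -
  have U: "open U" "connected U" using assms by (auto simp: is_domain_def)
  have "(\<lambda>x y. intrinsic_inf U x y < \<infinity>) x y"
  proof (rule connected_equivalence_relation[OF U(2) assms(2,3)])
    show "intrinsic_inf U y x < \<infinity>" if "intrinsic_inf U x y < \<infinity>" for x y
      using that intrinsic_inf_commute by metis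
    show "intrinsic_inf U x z < \<infinity>" if "intrinsic_inf U x y < \<infinity>" "intrinsic_inf U y z < \<infinity>" for x y z
      using that intrinsic_inf_triangle[of U x z y]
      by (metis add_top ennreal_add_less_top infinity_ennreal_def order_le_less_trans)
    fix a assume "a \<in> U"
    then obtain r where r: "r > 0" "ball a r \<subseteq> U" using U(1) openE by blast
    have "intrinsic_inf U a x < \<infinity>" if "x \<in> ball a r" for x
    proof -
      have "closed_segment a x \<subseteq> U"
        using r that by (meson centre_in_ball convex_ball convex_contains_segment order_trans)
      then show ?thesis by (simp add: intrinsic_inf_segment)
    qed
    then show "\<exists>T. openin (top_of_set U) T \<and> a \<in> T \<and> (\<forall>x\<in>T. intrinsic_inf U a x < \<infinity>)"
      using r U(1) by (intro exI[of _ "ball a r"]) (auto simp: openin_open_eq)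
  qed
  then show ?thesis .
qed

lemma intrinsic_dist_eq:
  fixes U :: "'a::real_normed_vector set"
  assumes "is_domain U" "x \<in> U" "y \<in> U"
  shows "ennreal (intrinsic_dist U x y) = intrinsic_inf U x y"
  using intrinsic_inf_finite[OF assms]
  unfolding intrinsic_dist_def intrinsic_inf_def by (simp add: less_top)

lemma intrinsic_dist_nonneg: "0 \<le> intrinsic_dist U x y"
  by (simp add: intrinsic_dist_def)

lemma dist_le_intrinsic_dist:
  fixes U :: "'a::real_normed_vector set"
  assumes "is_domain U" "x \<in> U" "y \<in> U"
  shows "dist x y \<le> intrinsic_dist U x y"
  using dist_le_intrinsic_inf[of x y U]
  by (simp add: ennreal_le_iff intrinsic_dist_nonneg flip: intrinsic_dist_eq[OF assms])

lemma intrinsic_dist_segment: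
  fixes x y :: "'a::real_normed_vector"
  assumes "closed_segment x y \<subseteq> U"
  shows "intrinsic_dist U x y = dist x y"
  using intrinsic_inf_segment[OF assms] unfolding intrinsic_dist_def intrinsic_inf_def by simp

lemma Metric_space_intrinsic_dist:
  fixes U :: "'a::real_normed_vector set"
  assumes "is_domain U"
  shows "Metric_space U (intrinsic_dist U)"
proof
  show "0 \<le> intrinsic_dist U x y" for x y by (rule intrinsic_dist_nonneg)
  show "intrinsic_dist U x y = intrinsic_dist U y x" for x y
    using intrinsic_inf_commute[of U x y] by (simp add: intrinsic_dist_def intrinsic_inf_def)
  show "(intrinsic_dist U x y = 0) = (x = y)" if "x \<in> U" "y \<in> U" for x y
    using dist_le_intrinsic_dist[OF assms that] intrinsic_dist_segment[of x x U] that
    by (auto simp: dist_le_zero_iff)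
  show "intrinsic_dist U x z \<le> intrinsic_dist U x y + intrinsic_dist U y z"
    if "x \<in> U" "y \<in> U" "z \<in> U" for x y z
    using intrinsic_inf_triangle[of U x z y] that
    by (simp add: intrinsic_dist_nonneg ennreal_le_iff flip: intrinsic_dist_eq[OF assms] ennreal_plus)
qed

text \<open>The length of a curve bounds the sum of the distances of any of its points from the two ends. This
  is all that the later arguments need to know about lengths.\<close>
lemma near_minimal_path:
  fixes U :: "'a::real_normed_vector set"
  assumes "is_domain U" "x \<in> U" "y \<in> U" "e > 0"
  obtains g where "path g" "path_image g \<subseteq> U" "pathstart g = x" "pathfinish g = y"
    "\<And>t. t \<in> {0..1} \<Longrightarrow> intrinsic_dist U x (g t) + intrinsic_dist U (g t) y < intrinsic_dist U x y + e"
proof -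
  have "intrinsic_inf U x y < ennreal (intrinsic_dist U x y + e)"
    using assms(4) intrinsic_dist_nonneg[of U x y]
    by (simp flip: intrinsic_dist_eq[OF assms(1-3)] add: ennreal_lessI)
  then obtain g where g: "g \<in> curves_within U x y" "curve_length g < ennreal (intrinsic_dist U x y + e)"
    unfolding intrinsic_inf_def by (auto simp: INF_less_iff)
  have "intrinsic_dist U x (g t) + intrinsic_dist U (g t) y < intrinsic_dist U x y + e"
    if t: "t \<in> {0..1}" for t
  proof -
    have gt: "g t \<in> U" using g(1) t by (auto simp: curves_within_def path_image_def)
    have im: "path_image (subpath u v g) \<subseteq> U" if "u \<in> {0..1}" "v \<in> {0..1}" for u v
      using path_image_subpath_subset[OF that] g(1)
      by (auto simp: curves_within_def)
    have "subpath 0 t g \<in> curves_within U x (g t)"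
      using g(1) t im[of 0 t] by (simp add: curves_within_def path_subpath) (simp add: pathstart_def)
    moreover have "subpath t 1 g \<in> curves_within U (g t) y"
      using g(1) t im[of t 1] by (simp add: curves_within_def path_subpath) (simp add: pathfinish_def)
    ultimately
    have "intrinsic_inf U x (g t) + intrinsic_inf U (g t) y
        \<le> curve_length (subpath 0 t g) + curve_length (subpath t 1 g)"
      by (intro add_mono intrinsic_inf_le)
    also have "\<dots> \<le> curve_length g" using t by (intro curve_length_split) auto
    also note g(2)
    finally have "ennreal (intrinsic_dist U x (g t) + intrinsic_dist U (g t) y)
       < ennreal (intrinsic_dist U x y + e)"
      using assms gt by (simp add: intrinsic_dist_eq intrinsic_dist_nonneg ennreal_plus)
    then show ?thesis using ennreal_less_iff intrinsic_dist_nonneg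
      by (metis add_nonneg_nonneg)
  qed
  then show ?thesis using that g(1) by (auto simp: curves_within_def)
qed

section \<open>The completion of a metric space by classes of Cauchy sequences\<close>

context Metric_space
begin

abbreviation (input) "cpoints \<equiv> completion_points M d"
abbreviation (input) "cdist \<equiv> completion_dist d"
abbreviation (input) "cembed \<equiv> completion_embed M d"

lemma MCauchy_in_M: "MCauchy s \<Longrightarrow> s n \<in> M"
  by (auto simp: MCauchy_def)

lemma dist_convergent_if_MCauchy:
  assumes "MCauchy s" "MCauchy t"
  shows "\<exists>L. (\<lambda>n. d (s n) (t n)) \<longlonglongrightarrow> L"
proof -
  have M: "s n \<in> M" "t n \<in> M" for n using assms MCauchy_in_M by blast+
  have q: "\<bar>d (s m) (t m) - d (s n) (t n)\<bar> \<le> d (s m) (s n) + d (t m) (t n)" for m n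
    using triangle[OF M(1)[of m] M(1)[of n] M(2)[of m]] triangle[OF M(1)[of n] M(1)[of m] M(2)[of n]]
      triangle[OF M(1)[of n] M(2)[of n] M(2)[of m]] triangle[OF M(1)[of m] M(2)[of m] M(2)[of n]]
      commute[of "s m" "s n"] commute[of "t m" "t n"]
    by linarith
  have "Cauchy (\<lambda>n. d (s n) (t n))"
  proof (rule CauchyI)
    fix e :: real assume "0 < e"
    then obtain N1 N2 where "\<And>m n. N1 \<le> m \<Longrightarrow> N1 \<le> n \<Longrightarrow> d (s m) (s n) < e / 2"
      "\<And>m n. N2 \<le> m \<Longrightarrow> N2 \<le> n \<Longrightarrow> d (t m) (t n) < e / 2"
      using assms unfolding MCauchy_def by (metis half_gt_zero)
    then have "norm (d (s m) (t m) - d (s n) (t n)) < e" if "max N1 N2 \<le> m" "max N1 N2 \<le> n" for m n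
      using q[of m n] that by (smt (verit, best) field_sum_of_halves max.bounded_iff real_norm_def)
    then show "\<exists>M. \<forall>m\<ge>M. \<forall>n\<ge>M. norm (d (s m) (t m) - d (s n) (t n)) < e" by blast
  qed
  then show ?thesis by (auto simp: Cauchy_convergent_iff convergent_def)
qed

lemma equiv_cauchy_equiv: "equiv {s. MCauchy s} (cauchy_equiv M d)"
proof (rule equivI)
  show "refl_on {s. MCauchy s} (cauchy_equiv M d)"
  proof (rule refl_onI)
    fix s assume "s \<in> {s. MCauchy s}"
    then have s: "MCauchy s" by simp
    have "d (s n) (s n) = 0" for n using zero MCauchy_in_M[OF s] by blast
    then show "(s, s) \<in> cauchy_equiv M d" using s by (simp add: cauchy_equiv_def)
  qed
  show "cauchy_equiv M d \<subseteq> {s. MCauchy s} \<times> {s. MCauchy s}"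
    unfolding cauchy_equiv_def by blast
  show "sym (cauchy_equiv M d)"
  proof (rule symI)
    fix s t assume st: "(s, t) \<in> cauchy_equiv M d"
    have "(\<lambda>n. d (t n) (s n)) = (\<lambda>n. d (s n) (t n))" using commute by blast
    then show "(t, s) \<in> cauchy_equiv M d" using st unfolding cauchy_equiv_def by simp
  qed
  show "trans (cauchy_equiv M d)"
  proof (rule transI)
    fix s t u assume st: "(s, t) \<in> cauchy_equiv M d" and tu: "(t, u) \<in> cauchy_equiv M d"
    have C: "MCauchy s" "MCauchy t" "MCauchy u"
      "(\<lambda>n. d (s n) (t n)) \<longlonglongrightarrow> 0" "(\<lambda>n. d (t n) (u n)) \<longlonglongrightarrow> 0"
      using st tu unfolding cauchy_equiv_def by blast+
    have l: "(\<lambda>n. d (s n) (t n) + d (t n) (u n)) \<longlonglongrightarrow> 0"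
      using tendsto_add[OF C(4,5)] by simp
    have "norm (d (s n) (u n)) \<le> d (s n) (t n) + d (t n) (u n)" for n
      using triangle[OF MCauchy_in_M[OF C(1)] MCauchy_in_M[OF C(2)] MCauchy_in_M[OF C(3)]] nonneg
      by (metis abs_of_nonneg real_norm_def)
    then have "(\<lambda>n. d (s n) (u n)) \<longlonglongrightarrow> 0"
      by (intro Lim_null_comparison[OF always_eventually l]) blast
    then show "(s, u) \<in> cauchy_equiv M d" using C unfolding cauchy_equiv_def by blast
  qed
qed

lemma cpoints_MCauchy: "X \<in> cpoints \<Longrightarrow> s \<in> X \<Longrightarrow> MCauchy s"
  using in_quotient_imp_subset[OF equiv_cauchy_equiv] by (auto simp: completion_points_def)

lemma cpoints_nonempty: "X \<in> cpoints \<Longrightarrow> \<exists>s. s \<in> X"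
  using in_quotient_imp_non_empty[OF equiv_cauchy_equiv] by (fastforce simp: completion_points_def)

lemma cpoints_equivalent:
  "X \<in> cpoints \<Longrightarrow> s \<in> X \<Longrightarrow> t \<in> X \<Longrightarrow> (\<lambda>n. d (s n) (t n)) \<longlonglongrightarrow> 0"
  using quotient_eq_iff[OF equiv_cauchy_equiv, of X X s t]
  by (auto simp: completion_points_def cauchy_equiv_def)

lemma cdist_tendsto:
  assumes X: "X \<in> cpoints" and Y: "Y \<in> cpoints" and s: "s \<in> X" and t: "t \<in> Y"
  shows "(\<lambda>n. d (s n) (t n)) \<longlonglongrightarrow> cdist X Y"
proof -
  obtain L where L: "(\<lambda>n. d (s n) (t n)) \<longlonglongrightarrow> L"
    using dist_convergent_if_MCauchy[OF cpoints_MCauchy[OF X s] cpoints_MCauchy[OF Y t]] by (elim exE)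
  have "(\<lambda>n. d (s' n) (t' n)) \<longlonglongrightarrow> L" if s': "s' \<in> X" and t': "t' \<in> Y" for s' t'
  proof -
    have M: "s n \<in> M" "s' n \<in> M" "t n \<in> M" "t' n \<in> M" for n
      by (rule MCauchy_in_M[OF cpoints_MCauchy], rule X, rule s, rule MCauchy_in_M[OF cpoints_MCauchy], rule X, rule s',
          rule MCauchy_in_M[OF cpoints_MCauchy], rule Y, rule t, rule MCauchy_in_M[OF cpoints_MCauchy], rule Y, rule t')
    have q: "\<bar>d (s' n) (t' n) - d (s n) (t n)\<bar> \<le> d (s n) (s' n) + d (t n) (t' n)" for n
      using triangle[OF M(1)[of n] M(2)[of n] M(3)[of n]] triangle[OF M(2)[of n] M(1)[of n] M(4)[of n]]
        triangle[OF M(2)[of n] M(4)[of n] M(3)[of n]] triangle[OF M(1)[of n] M(3)[of n] M(4)[of n]]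
        commute[of "s n" "s' n"] commute[of "t n" "t' n"]
      by linarith
    have "(\<lambda>n. d (s n) (s' n) + d (t n) (t' n)) \<longlonglongrightarrow> 0 + 0"
      using cpoints_equivalent[OF X s s'] cpoints_equivalent[OF Y t t'] by (intro tendsto_add)
    then have l: "(\<lambda>n. d (s n) (s' n) + d (t n) (t' n)) \<longlonglongrightarrow> 0" by simp
    have "(\<lambda>n. d (s' n) (t' n) - d (s n) (t n)) \<longlonglongrightarrow> 0"
      by (rule Lim_null_comparison[OF always_eventually l]) (use q in simp)
    then have "(\<lambda>n. (d (s' n) (t' n) - d (s n) (t n)) + d (s n) (t n)) \<longlonglongrightarrow> 0 + L"
      using L by (rule tendsto_add)
    then show ?thesis by (simp only: diff_add_cancel add_0)
  qed
  then have all: "\<forall>s\<in>X. \<forall>t\<in>Y. (\<lambda>n. d (s n) (t n)) \<longlonglongrightarrow> L" by blast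
  have "cdist X Y = L"
    unfolding completion_dist_def
  proof (rule the_equality, rule all)
    fix r assume "\<forall>s\<in>X. \<forall>t\<in>Y. (\<lambda>n. d (s n) (t n)) \<longlonglongrightarrow> r"
    then have "(\<lambda>n. d (s n) (t n)) \<longlonglongrightarrow> r" using s t by blast
    then show "r = L" using LIMSEQ_unique[OF _ L] by blast
  qed
  then show ?thesis using L by simp
qed

lemma cpoints_in_M: "X \<in> cpoints \<Longrightarrow> s \<in> X \<Longrightarrow> s n \<in> M"
  using cpoints_MCauchy MCauchy_in_M by blast

lemma cdist_nonneg: "X \<in> cpoints \<Longrightarrow> Y \<in> cpoints \<Longrightarrow> 0 \<le> cdist X Y"
  using LIMSEQ_le_const[OF cdist_tendsto, of X Y _ _ 0] cpoints_nonempty[of X] cpoints_nonempty[of Y]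
  by fastforce

lemma cdist_commute: "X \<in> cpoints \<Longrightarrow> Y \<in> cpoints \<Longrightarrow> cdist X Y = cdist Y X"
proof -
  assume XY: "X \<in> cpoints" "Y \<in> cpoints"
  obtain s t where st: "s \<in> X" "t \<in> Y" 
    using cpoints_nonempty[OF XY(1)] cpoints_nonempty[OF XY(2)] by blast
  have "(\<lambda>n. d (s n) (t n)) = (\<lambda>n. d (t n) (s n))" using commute by blast
  then show ?thesis
    using LIMSEQ_unique[OF cdist_tendsto[OF XY st]] cdist_tendsto[OF XY(2,1) st(2,1)] by simp
qed

lemma cdist_triangle:
  assumes XYZ: "X \<in> cpoints" "Y \<in> cpoints" "Z \<in> cpoints"
  shows "cdist X Z \<le> cdist X Y + cdist Y Z"
proof -
  obtain s t u where st: "s \<in> X" "t \<in> Y" "u \<in> Z" 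
    using cpoints_nonempty[OF XYZ(1)] cpoints_nonempty[OF XYZ(2)] cpoints_nonempty[OF XYZ(3)] by blast
  show ?thesis
  proof (rule LIMSEQ_le)
    show "(\<lambda>n. d (s n) (u n)) \<longlonglongrightarrow> cdist X Z" by (rule cdist_tendsto[OF XYZ(1,3) st(1,3)])
    show "(\<lambda>n. d (s n) (t n) + d (t n) (u n)) \<longlonglongrightarrow> cdist X Y + cdist Y Z"
      by (rule tendsto_add[OF cdist_tendsto[OF XYZ(1,2) st(1,2)] cdist_tendsto[OF XYZ(2,3) st(2,3)]])
    show "\<exists>N. \<forall>n\<ge>N. d (s n) (u n) \<le> d (s n) (t n) + d (t n) (u n)"
      using triangle[OF cpoints_in_M[OF XYZ(1) st(1)] cpoints_in_M[OF XYZ(2) st(2)]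
          cpoints_in_M[OF XYZ(3) st(3)]] by blast
  qed
qed

lemma cdist_zero:
  assumes XY: "X \<in> cpoints" "Y \<in> cpoints"
  shows "cdist X Y = 0 \<longleftrightarrow> X = Y"
proof -
  obtain s t where st: "s \<in> X" "t \<in> Y" 
    using cpoints_nonempty[OF XY(1)] cpoints_nonempty[OF XY(2)] by blast
  note L = cdist_tendsto[OF XY st]
  have "cdist X Y = 0 \<longleftrightarrow> (\<lambda>n. d (s n) (t n)) \<longlonglongrightarrow> 0"
  proof
    assume "cdist X Y = 0" then show "(\<lambda>n. d (s n) (t n)) \<longlonglongrightarrow> 0" using L by simp
  next
    assume "(\<lambda>n. d (s n) (t n)) \<longlonglongrightarrow> 0" then show "cdist X Y = 0" by (rule LIMSEQ_unique[OF L])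
  qed
  also have "\<dots> \<longleftrightarrow> (s, t) \<in> cauchy_equiv M d"
    using cpoints_MCauchy XY st by (auto simp: cauchy_equiv_def)
  also have "\<dots> \<longleftrightarrow> X = Y"
    using quotient_eq_iff[OF equiv_cauchy_equiv XY[unfolded completion_points_def] st] by simp
  finally show ?thesis .
qed

lemma const_in_cembed:
  assumes "x \<in> M"
  shows "cembed x \<in> cpoints" "(\<lambda>_. x) \<in> cembed x"
proof -
  have m: "MCauchy (\<lambda>_. x)" using assms by (auto simp: MCauchy_def)
  then show "cembed x \<in> cpoints"
    by (simp add: completion_embed_def completion_points_def quotientI)
  show "(\<lambda>_. x) \<in> cembed x"
    using m assms by (auto simp: completion_embed_def cauchy_equiv_def)
qed

lemma cdist_cembed: "x \<in> M \<Longrightarrow> y \<in> M \<Longrightarrow> cdist (cembed x) (cembed y) = d x y"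
  using cdist_tendsto[OF const_in_cembed(1) const_in_cembed(1) const_in_cembed(2) const_in_cembed(2), of x y]
  by (simp add: LIMSEQ_const_iff)

lemma rep_converges:
  assumes X: "X \<in> cpoints" and s: "s \<in> X"
  shows "(\<lambda>n. cdist (cembed (s n)) X) \<longlonglongrightarrow> 0"
proof (rule LIMSEQ_I)
  fix e :: real assume e: "0 < e"
  then obtain N where N: "\<And>m n. N \<le> m \<Longrightarrow> N \<le> n \<Longrightarrow> d (s m) (s n) < e / 2"
    using cpoints_MCauchy[OF X s] unfolding MCauchy_def by (meson half_gt_zero)
  have "norm (cdist (cembed (s n)) X - 0) < e" if n: "N \<le> n" for n
  proof -
    have sn: "s n \<in> M" using cpoints_in_M[OF X s] .
    have "(\<lambda>m. d (s n) (s m)) \<longlonglongrightarrow> cdist (cembed (s n)) X"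
      using cdist_tendsto[OF const_in_cembed(1)[OF sn] X const_in_cembed(2)[OF sn] s] .
    then have "cdist (cembed (s n)) X \<le> e / 2"
      by (rule LIMSEQ_le_const2) (use N n less_imp_le in blast)
    then show ?thesis using cdist_nonneg[OF const_in_cembed(1)[OF sn] X] e by simp
  qed
  then show "\<exists>N. \<forall>n\<ge>N. norm (cdist (cembed (s n)) X - 0) < e" by blast
qed

lemma cembed_dense:
  assumes X: "X \<in> cpoints" and e: "0 < e"
  obtains x where "x \<in> M" "cdist (cembed x) X < e"
proof -
  obtain s where s: "s \<in> X" using cpoints_nonempty[OF X] by blast
  obtain n where "cdist (cembed (s n)) X < e"
    using order_tendstoD(2)[OF rep_converges[OF X s] e] eventually_happens'[OF sequentially_bot] by blast
  then show ?thesis using that cpoints_in_M[OF X s] by blast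
qed

lemma MCauchy_class:
  assumes "MCauchy s"
  obtains X where "X \<in> cpoints" "s \<in> X"
proof
  show "cauchy_equiv M d `` {s} \<in> cpoints" using assms by (simp add: completion_points_def quotientI)
  show "s \<in> cauchy_equiv M d `` {s}"
    using equiv_class_self[OF equiv_cauchy_equiv] assms by simp
qed

text \<open>Replace each point of the given sequence by a nearby point of the space itself; these points form a
  Cauchy sequence, and its class is the limit.\<close>
lemma completion_complete:
  assumes X: "\<And>n. X n \<in> cpoints"
    and C: "\<And>e. e > 0 \<Longrightarrow> \<exists>N. \<forall>m\<ge>N. \<forall>n\<ge>N. cdist (X m) (X n) < e"
  obtains L where "L \<in> cpoints" "(\<lambda>n. cdist (X n) L) \<longlonglongrightarrow> 0"
proof -
  have "\<exists>x. x \<in> M \<and> cdist (cembed x) (X n) < inverse (real (Suc n))" for n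
    using cembed_dense[OF X[of n], of "inverse (real (Suc n))"] by auto
  then obtain s where s: "\<And>n. s n \<in> M" "\<And>n. cdist (cembed (s n)) (X n) < inverse (real (Suc n))" by metis
  have E: "cembed (s n) \<in> cpoints" for n using const_in_cembed s by blast
  have lim: "\<exists>N. \<forall>n\<ge>N. cdist (cembed (s n)) (X n) < e" if e: "e > 0" for e
  proof -
    obtain N where N: "inverse (real (Suc N)) < e" using reals_Archimedean[OF e] by blast
    have "cdist (cembed (s n)) (X n) < e" if "n \<ge> N" for n
    proof -
      have "inverse (real (Suc n)) \<le> inverse (real (Suc N))" using that by (intro le_imp_inverse_le) auto
      then show ?thesis using s(2)[of n] N by linarith
    qed
    then show ?thesis by blast
  qed
  have "MCauchy s"
    unfolding MCauchy_def
  proof (intro conjI allI impI)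
    fix e :: real assume e: "0 < e"
    obtain N1 where N1: "\<forall>m\<ge>N1. \<forall>n\<ge>N1. cdist (X m) (X n) < e / 3" using C[of "e/3"] e by auto
    obtain N2 where N2: "\<forall>n\<ge>N2. cdist (cembed (s n)) (X n) < e / 3" using lim[of "e/3"] e by auto
    have "d (s m) (s n) < e" if "max N1 N2 \<le> m" "max N1 N2 \<le> n" for m n
    proof -
      have "d (s m) (s n) = cdist (cembed (s m)) (cembed (s n))" by (simp only: cdist_cembed s(1))
      moreover have "cdist (cembed (s m)) (cembed (s n)) \<le> cdist (cembed (s m)) (X m) + cdist (X m) (cembed (s n))"
        by (rule cdist_triangle[OF E X E])
      moreover have "cdist (X m) (cembed (s n)) \<le> cdist (X m) (X n) + cdist (X n) (cembed (s n))"
        by (rule cdist_triangle[OF X X E])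
      moreover have "cdist (X n) (cembed (s n)) = cdist (cembed (s n)) (X n)" by (rule cdist_commute[OF X E])
      moreover have "cdist (X m) (X n) < e / 3" "cdist (cembed (s n)) (X n) < e / 3" "cdist (cembed (s m)) (X m) < e / 3"
        using N1 N2 that by simp_all
      ultimately show ?thesis by linarith
    qed
    then show "\<exists>N. \<forall>n n'. N \<le> n \<longrightarrow> N \<le> n' \<longrightarrow> d (s n) (s n') < e" by blast
  qed (use s in auto)
  then obtain L where L: "L \<in> cpoints" "s \<in> L" by (rule MCauchy_class)
  have "(\<lambda>n. cdist (X n) L) \<longlonglongrightarrow> 0"
  proof (rule Lim_null_comparison)
    have "cdist (X n) L \<le> inverse (real (Suc n)) + cdist (cembed (s n)) L" for n
      using cdist_triangle[OF X[of n] E[of n] L(1)] cdist_commute[OF X[of n] E[of n]] s(2)[of n] by linarith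
    then show "\<forall>\<^sub>F n in sequentially. norm (cdist (X n) L) \<le> inverse (real (Suc n)) + cdist (cembed (s n)) L"
      using cdist_nonneg[OF X L(1)] by (intro always_eventually allI) simp
    show "(\<lambda>n. inverse (real (Suc n)) + cdist (cembed (s n)) L) \<longlonglongrightarrow> 0"
      using tendsto_add[OF LIMSEQ_inverse_real_of_nat rep_converges[OF L]] by simp
  qed
  with L(1) show ?thesis by (rule that)
qed

end

section \<open>The completion of a domain and its Hausdorff boundary\<close>

text \<open>The natural projection of the completion of a domain to its Euclidean closure. It is not injective
  in general, since a point of the Euclidean boundary may be approached from different sides.\<close>
definition foot :: "(nat \<Rightarrow> 'a::metric_space) set \<Rightarrow> 'a" where
  "foot X = (THE l. \<forall>s\<in>X. s \<longlonglongrightarrow> l)"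

locale domain =
  fixes V :: "'a::euclidean_space set"
  assumes domain: "is_domain V"
begin

sublocale I: Metric_space V "intrinsic_dist V"
  by (rule Metric_space_intrinsic_dist[OF domain])

abbreviation "C \<equiv> completion_points V (intrinsic_dist V)"
abbreviation "D \<equiv> relative_dist V"
abbreviation "H \<equiv> hausdorff_boundary V"
abbreviation "emb \<equiv> completion_embed V (intrinsic_dist V)"

lemma open_V: "open V" and connected_V: "connected V" and nonempty_V: "V \<noteq> {}"
  using domain by (auto simp: is_domain_def)

lemmas D_nonneg = I.cdist_nonneg[folded relative_dist_def]
lemmas D_commute = I.cdist_commute[folded relative_dist_def]
lemmas D_triangle = I.cdist_triangle[folded relative_dist_def]
lemmas D_zero = I.cdist_zero[folded relative_dist_def]
lemmas D_emb = I.cdist_cembed[folded relative_dist_def]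
lemmas emb_C = I.const_in_cembed(1)
lemmas emb_dense = I.cembed_dense[folded relative_dist_def]
lemmas D_complete = I.completion_complete[folded relative_dist_def]

lemma H_C: "X \<in> H \<Longrightarrow> X \<in> C"
  by (simp add: hausdorff_boundary_def)

lemma rep_tendsto_foot:
  assumes X: "X \<in> C" and s: "s \<in> X"
  shows "s \<longlonglongrightarrow> foot X"
proof -
  have V: "t n \<in> V" if "t \<in> X" for t n using I.cpoints_in_M[OF X that] .
  have "Cauchy s"
  proof (rule metric_CauchyI)
    fix e :: real assume "e > 0"
    then obtain N where "\<And>m n. N \<le> m \<Longrightarrow> N \<le> n \<Longrightarrow> intrinsic_dist V (s m) (s n) < e"
      using I.cpoints_MCauchy[OF X s] unfolding I.MCauchy_def by meson
    then show "\<exists>M. \<forall>m\<ge>M. \<forall>n\<ge>M. dist (s m) (s n) < e"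
      using dist_le_intrinsic_dist[OF domain V[OF s] V[OF s]] by (meson le_less_trans)
  qed
  then obtain l where l: "s \<longlonglongrightarrow> l" using Cauchy_convergent_iff convergent_def by blast
  have "t \<longlonglongrightarrow> l" if t: "t \<in> X" for t
  proof -
    have "(\<lambda>n. dist (s n) (t n)) \<longlonglongrightarrow> 0"
      by (rule Lim_null_comparison[OF _ I.cpoints_equivalent[OF X s t]])
        (use dist_le_intrinsic_dist[OF domain V[OF s] V[OF t]] in \<open>auto intro: always_eventually\<close>)
    then have "(\<lambda>n. t n - s n) \<longlonglongrightarrow> 0"
      by (intro tendsto_norm_zero_cancel[of "\<lambda>n. t n - s n"]) (simp add: dist_norm norm_minus_commute)
    from tendsto_add[OF this l] show ?thesis by simp
  qed
  then have all: "\<forall>s\<in>X. s \<longlonglongrightarrow> l" by blast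
  have "foot X = l" unfolding foot_def
  proof (rule the_equality, rule all)
    fix r assume "\<forall>s\<in>X. s \<longlonglongrightarrow> r"
    then have "s \<longlonglongrightarrow> r" using s by blast
    then show "r = l" using LIMSEQ_unique[OF _ l] by blast
  qed
  then show ?thesis using l by simp
qed

lemma dist_foot_le: "X \<in> C \<Longrightarrow> Y \<in> C \<Longrightarrow> dist (foot X) (foot Y) \<le> D X Y"
proof -
  assume XY: "X \<in> C" "Y \<in> C"
  obtain s t where st: "s \<in> X" "t \<in> Y" 
    using I.cpoints_nonempty[OF XY(1)] I.cpoints_nonempty[OF XY(2)] by blast
  show ?thesis
  proof (rule LIMSEQ_le)
    show "(\<lambda>n. dist (s n) (t n)) \<longlonglongrightarrow> dist (foot X) (foot Y)"
      by (rule tendsto_dist[OF rep_tendsto_foot[OF XY(1) st(1)] rep_tendsto_foot[OF XY(2) st(2)]])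
    show "(\<lambda>n. intrinsic_dist V (s n) (t n)) \<longlonglongrightarrow> D X Y"
      using I.cdist_tendsto[OF XY st] unfolding relative_dist_def .
    show "\<exists>N. \<forall>n\<ge>N. dist (s n) (t n) \<le> intrinsic_dist V (s n) (t n)"
      using dist_le_intrinsic_dist[OF domain I.cpoints_in_M[OF XY(1) st(1)] I.cpoints_in_M[OF XY(2) st(2)]]
      by blast
  qed
qed

lemma foot_emb [simp]: "x \<in> V \<Longrightarrow> foot (emb x) = x"
  using rep_tendsto_foot[OF emb_C I.const_in_cembed(2), of x] by (simp add: LIMSEQ_const_iff)

lemma foot_closure: "X \<in> C \<Longrightarrow> foot X \<in> closure V"
proof -
  assume X: "X \<in> C"
  obtain s where s: "s \<in> X" using I.cpoints_nonempty[OF X] by blast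
  show ?thesis
    unfolding closure_sequential using I.cpoints_in_M[OF X s] rep_tendsto_foot[OF X s] by blast
qed

lemma D_emb_segment:
  assumes "closed_segment x y \<subseteq> V"
  shows "D (emb x) (emb y) = dist x y"
  using assms intrinsic_dist_segment[OF assms] D_emb[of x y] by auto

lemma D_emb_ball:
  assumes "ball x r \<subseteq> V" "y \<in> ball x r" "z \<in> ball x r"
  shows "D (emb y) (emb z) = dist y z"
  using assms by (intro D_emb_segment) (meson convex_ball convex_contains_segment order_trans)

text \<open>Around a point of \<open>V\<close> the intrinsic distance is the Euclidean one, so a sequence with Euclidean limit
  in \<open>V\<close> also converges to it intrinsically.\<close>
lemma emb_foot: 
  assumes X: "X \<in> C" and V: "foot X \<in> V"
  shows "emb (foot X) = X"
proof -
  obtain s where s: "s \<in> X" using I.cpoints_nonempty[OF X] by blast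
  obtain r where r: "r > 0" "ball (foot X) r \<subseteq> V" using open_V V openE by blast
  have "(\<lambda>n. D (emb (foot X)) (emb (s n))) \<longlonglongrightarrow> 0"
  proof (rule Lim_transform_eventually)
    show "(\<lambda>n. dist (foot X) (s n)) \<longlonglongrightarrow> 0"
      using tendsto_dist[OF tendsto_const[of "foot X"] rep_tendsto_foot[OF X s]] by simp
    have "\<forall>\<^sub>F n in sequentially. s n \<in> ball (foot X) r"
      using rep_tendsto_foot[OF X s] r by (intro topological_tendstoD) auto
    then show "\<forall>\<^sub>F n in sequentially. dist (foot X) (s n) = D (emb (foot X)) (emb (s n))"
      by eventually_elim (use D_emb_ball r in auto)
  qed
  moreover have "(\<lambda>n. D (emb (foot X)) (emb (s n))) \<longlonglongrightarrow> D (emb (foot X)) X"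
    using I.cdist_tendsto[OF emb_C[OF V] X I.const_in_cembed(2)[OF V] s] D_emb[OF V I.cpoints_in_M[OF X s]]
    unfolding relative_dist_def by simp
  ultimately have "D (emb (foot X)) X = 0" by (rule LIMSEQ_unique[rotated])
  then show ?thesis using D_zero[OF emb_C[OF V] X] by simp
qed

lemma H_eq: "H = {X \<in> C. foot X \<notin> V}"
  using emb_foot foot_emb by (force simp: hausdorff_boundary_def)

text \<open>The points of the segment before the last one contain a Cauchy sequence for the intrinsic metric, which
  is the Euclidean one along the segment.\<close>
lemma exit_point:
  assumes u: "norm u = 1" and L: "L > 0" and V: "\<And>s. 0 \<le> s \<Longrightarrow> s < L \<Longrightarrow> x + s *\<^sub>R u \<in> V"
  obtains X where "X \<in> C" "foot X = x + L *\<^sub>R u"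
    "\<And>s. 0 \<le> s \<Longrightarrow> s < L \<Longrightarrow> D (emb (x + s *\<^sub>R u)) X = L - s"
proof -
  define q where "q n = L - L / real (Suc n)" for n
  define w where "w n = x + q n *\<^sub>R u" for n
  have q: "0 \<le> q n" "q n < L" for n using L by (auto simp: q_def field_simps)
  have ql: "q \<longlonglongrightarrow> L"
    unfolding q_def using tendsto_diff[OF tendsto_const LIMSEQ_Suc[OF lim_const_over_n]] by fastforce
  have dd: "intrinsic_dist V (x + s *\<^sub>R u) (x + t *\<^sub>R u) = \<bar>s - t\<bar>"
    if "0 \<le> s" "s < L" "0 \<le> t" "t < L" for s t
  proof -
    have "closed_segment (x + s *\<^sub>R u) (x + t *\<^sub>R u) \<subseteq> V"
    proof
      fix y assume "y \<in> closed_segment (x + s *\<^sub>R u) (x + t *\<^sub>R u)"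
      then obtain a where a: "0 \<le> a" "a \<le> 1" "y = (1 - a) *\<^sub>R (x + s *\<^sub>R u) + a *\<^sub>R (x + t *\<^sub>R u)"
        by (auto simp: in_segment)
      then have y: "y = x + ((1 - a) * s + a * t) *\<^sub>R u" by (simp add: algebra_simps)
      have "(1 - a) * s + a * t < L" using a that by (intro convex_bound_lt) auto
      then show "y \<in> V" unfolding y using a that by (intro V) auto
    qed
    then have "intrinsic_dist V (x + s *\<^sub>R u) (x + t *\<^sub>R u) = dist (x + s *\<^sub>R u) (x + t *\<^sub>R u)"
      by (rule intrinsic_dist_segment)
    also have "\<dots> = \<bar>s - t\<bar>" using u by (simp add: dist_norm flip: scaleR_diff_left)
    finally show ?thesis .
  qed
  have "I.MCauchy w"
    unfolding I.MCauchy_def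
  proof (intro conjI allI impI)
    show "range w \<subseteq> V" using V q by (auto simp: w_def)
    fix e :: real assume "0 < e"
    then obtain N where "\<forall>m\<ge>N. \<forall>n\<ge>N. dist (q m) (q n) < e"
      using LIMSEQ_imp_Cauchy[OF ql] metric_CauchyD by meson
    then show "\<exists>N. \<forall>n n'. N \<le> n \<longrightarrow> N \<le> n' \<longrightarrow> intrinsic_dist V (w n) (w n') < e"
      using dd q by (auto simp: w_def dist_real_def)
  qed
  then obtain X where X: "X \<in> C" "w \<in> X" by (rule I.MCauchy_class)
  show ?thesis
  proof (rule that[OF X(1)])
    have "w \<longlonglongrightarrow> x + L *\<^sub>R u" unfolding w_def by (intro tendsto_intros ql)
    then show "foot X = x + L *\<^sub>R u" by (rule LIMSEQ_unique[OF rep_tendsto_foot[OF X]])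
    fix s assume s: "0 \<le> s" "s < L"
    have xs: "x + s *\<^sub>R u \<in> V" using V s by blast
    have "(\<lambda>n. intrinsic_dist V (x + s *\<^sub>R u) (w n)) \<longlonglongrightarrow> D (emb (x + s *\<^sub>R u)) X"
      using I.cdist_tendsto[OF emb_C[OF xs] X(1) I.const_in_cembed(2)[OF xs] X(2)]
      unfolding relative_dist_def .
    moreover have "(\<lambda>n. intrinsic_dist V (x + s *\<^sub>R u) (w n)) \<longlonglongrightarrow> \<bar>s - L\<bar>"
    proof -
      have eq: "intrinsic_dist V (x + s *\<^sub>R u) (w n) = \<bar>s - q n\<bar>" for n
        unfolding w_def by (rule dd[OF s q])
      show ?thesis unfolding eq by (intro tendsto_intros ql)
    qed
    ultimately have "D (emb (x + s *\<^sub>R u)) X = \<bar>s - L\<bar>" by (rule LIMSEQ_unique)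
    then show "D (emb (x + s *\<^sub>R u)) X = L - s" using s by simp
  qed
qed

lemma first_exit:
  assumes x: "x \<in> V" and y: "y \<notin> V"
  obtains X where "X \<in> H" "foot X \<in> closed_segment x y"
proof -
  define l where "l = dist x y"
  have l: "l > 0" using x y by (auto simp: l_def)
  define e where "e = (1 / l) *\<^sub>R (y - x)"
  have e: "norm e = 1" using l by (simp add: e_def l_def dist_norm norm_minus_commute)
  have ye: "y = x + l *\<^sub>R e" using l by (simp add: e_def)
  define T where "T = {0..l} \<inter> (\<lambda>t. x + t *\<^sub>R e) -` (- V)"
  have clT: "closed T"
    unfolding T_def using open_V by (intro continuous_closed_preimage continuous_intros) auto
  have lT: "l \<in> T" using l y ye by (simp add: T_def)
  have bdd: "bdd_below T" by (rule bdd_belowI[of _ 0]) (simp add: T_def)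
  define t where "t = Inf T"
  have tT: "t \<in> T" unfolding t_def using closed_contains_Inf[OF _ bdd clT] lT by blast
  then have t: "0 \<le> t" "t \<le> l" "x + t *\<^sub>R e \<notin> V" by (auto simp: T_def)
  have t0: "0 < t" using t x by (cases "t = 0") auto
  have before: "x + a *\<^sub>R e \<in> V" if a: "0 \<le> a" "a < t" for a
  proof (rule ccontr)
    assume "x + a *\<^sub>R e \<notin> V"
    then have "a \<in> T" using a t(2) by (simp add: T_def)
    then have "t \<le> a" unfolding t_def by (rule cInf_lower[OF _ bdd])
    then show False using a(2) by simp
  qed
  obtain X where X: "X \<in> C" "foot X = x + t *\<^sub>R e" using exit_point[OF e t0 before] by blast
  show ?thesis
  proof (rule that)
    show "X \<in> H" using X t(3) by (simp add: H_eq)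
    have "foot X = (1 - t / l) *\<^sub>R x + (t / l) *\<^sub>R y" using l by (simp add: X(2) ye algebra_simps)
    then show "foot X \<in> closed_segment x y"
      unfolding in_segment using t l by (intro exI[of _ "t / l"]) auto
  qed
qed

text \<open>The segment to a nearest point of the complement runs inside the largest ball around \<open>x\<close> in \<open>V\<close>.\<close>
lemma nearest_boundary_point:
  assumes x: "x \<in> V" and V: "V \<noteq> UNIV"
  obtains X r where "X \<in> H" "r > 0" "ball x r \<subseteq> V" "D (emb x) X = r"
proof -
  obtain w where w: "w \<in> - V" "\<And>v. v \<in> - V \<Longrightarrow> dist x w \<le> dist x v"
    using distance_attains_inf[of "- V" x] open_V V by auto
  define r where "r = dist x w"
  have r: "r > 0" using w x by (auto simp: r_def)
  have b: "ball x r \<subseteq> V" using w(2) unfolding r_def by fastforce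
  define u where "u = (1 / r) *\<^sub>R (w - x)"
  have u: "norm u = 1" "x + r *\<^sub>R u = w" using r by (auto simp: u_def r_def dist_norm norm_minus_commute)
  obtain X where X: "X \<in> C" "foot X = x + r *\<^sub>R u"
    "\<And>s. 0 \<le> s \<Longrightarrow> s < r \<Longrightarrow> D (emb (x + s *\<^sub>R u)) X = r - s"
  proof (rule exit_point[OF u(1) r, of x])
    fix s assume "0 \<le> s" "s < r"
    then have "x + s *\<^sub>R u \<in> ball x r" using u by (simp add: dist_norm)
    then show "x + s *\<^sub>R u \<in> V" using b by blast
  qed blast
  then show ?thesis using that[of X r] r b u w X(3)[of 0] by (simp add: H_eq)
qed

lemma near_minimal_path_emb:
  assumes "x \<in> V" "y \<in> V" "e > 0"
  obtains g where "path g" "path_image g \<subseteq> V" "pathstart g = x" "pathfinish g = y"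
    "\<And>t. t \<in> {0..1} \<Longrightarrow> D (emb x) (emb (g t)) + D (emb (g t)) (emb y) < D (emb x) (emb y) + e"
proof -
  obtain g where g: "path g" "path_image g \<subseteq> V" "pathstart g = x" "pathfinish g = y"
    "\<And>t. t \<in> {0..1} \<Longrightarrow> intrinsic_dist V x (g t) + intrinsic_dist V (g t) y < intrinsic_dist V x y + e"
    by (rule near_minimal_path[OF domain assms]) blast
  have gV: "g t \<in> V" if "t \<in> {0..1}" for t using that g(2) by (auto simp: path_image_def)
  show ?thesis
  proof (rule that[OF g(1-4)])
    fix t :: real assume t: "t \<in> {0..1}"
    show "D (emb x) (emb (g t)) + D (emb (g t)) (emb y) < D (emb x) (emb y) + e"
      using g(5)[OF t] by (simp only: D_emb[OF assms(1) gV[OF t]] D_emb[OF gV[OF t] assms(2)] D_emb[OF assms(1,2)])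
  qed
qed

end

section \<open>Following a shortest connection until it meets the boundary\<close>

lemma unit_vectors_eq_if_norm_add_ge_2:
  fixes u v :: "'a::real_inner"
  assumes "norm u = 1" "norm v = 1" "2 \<le> norm (u + v)"
  shows "u = v"
proof -
  have "(norm (u + v))\<^sup>2 + (norm (u - v))\<^sup>2 = 4"
  proof -
    have "u \<bullet> u = 1" "v \<bullet> v = 1" using assms(1,2) by (simp_all add: norm_eq_1)
    then show ?thesis by (simp add: power2_norm_eq_inner inner_add inner_diff inner_commute)
  qed
  moreover have "4 \<le> (norm (u + v))\<^sup>2"
    using power_mono[OF assms(3), of 2] by simp
  ultimately have "(norm (u - v))\<^sup>2 \<le> 0" by linarith
  then have "norm (u - v) = 0" by simp
  then show ?thesis by simp
qed

lemma continuous_on_if_locally_nonexpansive: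
  fixes f :: "'a::metric_space \<Rightarrow> real"
  assumes "\<And>x. x \<in> S \<Longrightarrow> \<exists>r>0. \<forall>y\<in>S \<inter> ball x r. \<bar>f y - f x\<bar> \<le> dist y x"
  shows "continuous_on S f"
  unfolding continuous_on_iff
proof (intro ballI allI impI)
  fix x e assume x: "x \<in> S" and e: "(0::real) < e"
  obtain r where r: "r > 0" "\<forall>y\<in>S \<inter> ball x r. \<bar>f y - f x\<bar> \<le> dist y x" using assms[OF x] by blast
  have "dist (f y) (f x) < e" if "y \<in> S" "dist y x < min r e" for y
    using r(2) that by (force simp: dist_real_def dist_commute)
  then show "\<exists>d>0. \<forall>y\<in>S. dist y x < d \<longrightarrow> dist (f y) (f x) < e"
    using r(1) e by (intro exI[of _ "min r e"]) auto
qed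

context domain
begin

lemma D_refl: "X \<in> C \<Longrightarrow> D X X = 0"
  using D_zero[of X X] by simp

lemma D_diff_le:
  assumes "X \<in> C" "Y \<in> C" "Z \<in> C"
  shows "\<bar>D X Z - D Y Z\<bar> \<le> D X Y"
  using D_triangle[OF assms(1,2,3)] D_triangle[OF assms(2,1,3)] D_commute[OF assms(1,2)] by linarith

lemma continuous_on_D: assumes Z: "Z \<in> C" shows "continuous_on V (\<lambda>x. D (emb x) Z)"
proof (rule continuous_on_if_locally_nonexpansive)
  fix x assume x: "x \<in> V"
  obtain r where r: "r > 0" "ball x r \<subseteq> V" using open_V x openE by blast
  have "\<bar>D (emb y) Z - D (emb x) Z\<bar> \<le> dist y x" if y: "y \<in> V \<inter> ball x r" for y
    using D_diff_le[OF emb_C[of y] emb_C[OF x] Z] D_emb_ball[OF r(2), of y x] y r(1) by simp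
  then show "\<exists>r>0. \<forall>y\<in>V \<inter> ball x r. \<bar>D (emb y) Z - D (emb x) Z\<bar> \<le> dist y x" using r(1) by blast
qed

text \<open>Curves from \<open>x\<close> that almost realize the distance to \<open>Y\<close> cross the sphere of radius \<open>s\<close> in points
  that almost lie between \<open>x\<close> and \<open>Y\<close>. The sphere is compact, so some point of it lies between them.\<close>
lemma first_step:
  assumes b: "ball x r \<subseteq> V" and Y: "Y \<in> C" and s: "0 < s" "s < r" "s < D (emb x) Y"
  obtains u where "norm u = 1" "D (emb (x + s *\<^sub>R u)) Y = D (emb x) Y - s"
proof -
  define d where "d = D (emb x) Y"
  have xV: "x \<in> V" using b s by auto
  note xC = emb_C[OF xV]
  have SV: "y \<in> V" and Sball: "y \<in> ball x r" and Sd: "D (emb x) (emb y) = s" if "y \<in> sphere x s" for y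
  proof -
    show y: "y \<in> ball x r" using that s by simp
    then show "y \<in> V" using b by blast
    show "D (emb x) (emb y) = s" using D_emb_ball[OF b _ y, of x] that s by simp
  qed
  have cont: "continuous_on (sphere x s) (\<lambda>y. D (emb y) Y)"
    by (rule continuous_on_subset[OF continuous_on_D[OF Y]]) (use SV in blast)
  have ex: "\<exists>y\<in>sphere x s. D (emb y) Y \<le> d - s + e" if e: "0 < e" for e
  proof -
    define a where "a = min (e / 3) (d - s)"
    have a: "0 < a" "3 * a \<le> e" "a \<le> d - s" using e s(3) by (auto simp: a_def d_def min_def)
    obtain v where v: "v \<in> V" "D (emb v) Y < a" by (rule emb_dense[OF Y a(1)])
    note vC = emb_C[OF v(1)]
    obtain g where g: "path g" "path_image g \<subseteq> V" "pathstart g = x" "pathfinish g = v"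
      "\<And>t. t \<in> {0..1} \<Longrightarrow> D (emb x) (emb (g t)) + D (emb (g t)) (emb v) < D (emb x) (emb v) + a"
      by (rule near_minimal_path_emb[OF xV v(1) a(1)]) blast
    have far: "s \<le> dist x v"
    proof (rule ccontr)
      assume "\<not> s \<le> dist x v"
      then have "D (emb x) (emb v) < s" using D_emb_ball[OF b, of x v] s by simp
      then show False using D_triangle[OF xC vC Y] v(2) a(3) unfolding d_def by linarith
    qed
    have "\<exists>t\<ge>0. t \<le> 1 \<and> dist x (g t) = s"
    proof (rule IVT')
      show "dist x (g 0) \<le> s" using g(3) s by (simp add: pathstart_def)
      show "s \<le> dist x (g 1)" using g(4) far by (simp add: pathfinish_def)
      show "continuous_on {0..1} (\<lambda>t. dist x (g t))"
        using g(1) unfolding path_def by (intro continuous_intros)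
    qed simp
    then obtain t where t: "t \<in> {0..1}" "g t \<in> sphere x s" by auto
    note gC = emb_C[OF SV[OF t(2)]]
    have "D (emb (g t)) Y \<le> D (emb (g t)) (emb v) + D (emb v) Y" by (rule D_triangle[OF gC vC Y])
    moreover have "D (emb x) (emb v) \<le> D (emb x) Y + D Y (emb v)" by (rule D_triangle[OF xC Y vC])
    moreover have "D Y (emb v) = D (emb v) Y" by (rule D_commute[OF Y vC])
    ultimately have "D (emb (g t)) Y \<le> d - s + e"
      using g(5)[OF t(1)] Sd[OF t(2)] v(2) a(2) unfolding d_def by linarith
    then show ?thesis using t(2) by blast
  qed
  have ne: "sphere x s \<noteq> {}" using ex[of 1] by auto
  obtain y where y: "y \<in> sphere x s" "\<forall>y'\<in>sphere x s. D (emb y) Y \<le> D (emb y') Y"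
    using continuous_attains_inf[OF compact_sphere ne cont] by blast
  have "D (emb y) Y \<le> d - s"
  proof (rule field_le_epsilon)
    fix e :: real assume "0 < e"
    then obtain y' where "y' \<in> sphere x s" "D (emb y') Y \<le> d - s + e" using ex by blast
    then show "D (emb y) Y \<le> d - s + e" using y(2) by force
  qed
  then have eq: "D (emb y) Y = d - s"
    using D_triangle[OF xC emb_C[OF SV[OF y(1)]] Y] Sd[OF y(1)] unfolding d_def by linarith
  have n: "norm (y - x) = s" using y(1) by (simp add: dist_norm norm_minus_commute)
  show ?thesis
  proof (rule that[of "(1 / s) *\<^sub>R (y - x)"])
    show "norm ((1 / s) *\<^sub>R (y - x)) = 1" using n s by simp
    have "x + s *\<^sub>R (1 / s) *\<^sub>R (y - x) = y" using s by simp
    then show "D (emb (x + s *\<^sub>R (1 / s) *\<^sub>R (y - x))) Y = D (emb x) Y - s"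
      using eq by (simp add: d_def)
  qed
qed

definition ray_to :: "'a \<Rightarrow> (nat \<Rightarrow> 'a) set \<Rightarrow> 'a \<Rightarrow> real \<Rightarrow> bool" where
  "ray_to x Y u L \<longleftrightarrow> (\<forall>s. 0 \<le> s \<and> s < L \<longrightarrow> x + s *\<^sub>R u \<in> V \<and> D (emb (x + s *\<^sub>R u)) Y = D (emb x) Y - s)"

lemma ray_to_step:
  assumes b: "ball x r \<subseteq> V" and Y: "Y \<in> C" and u: "norm u = 1" and t: "0 < t" "t < r"
    and eq: "D (emb (x + t *\<^sub>R u)) Y = D (emb x) Y - t"
  shows "ray_to x Y u t"
  unfolding ray_to_def
proof (intro allI impI)
  fix s assume s: "0 \<le> s \<and> s < t"
  have x: "x \<in> ball x r" using t by simp
  have y: "x + s *\<^sub>R u \<in> ball x r" "x + t *\<^sub>R u \<in> ball x r" using s t u by (simp_all add: dist_norm)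
  then have V: "x \<in> V" "x + s *\<^sub>R u \<in> V" "x + t *\<^sub>R u \<in> V" using b x by blast+
  have "D (emb x) (emb (x + s *\<^sub>R u)) = s"
    using D_emb_ball[OF b x y(1)] s u by (simp add: dist_norm)
  moreover have "D (emb (x + s *\<^sub>R u)) (emb (x + t *\<^sub>R u)) = t - s"
    using D_emb_ball[OF b y] s u by (simp add: dist_norm flip: scaleR_diff_left)
  ultimately show "x + s *\<^sub>R u \<in> V \<and> D (emb (x + s *\<^sub>R u)) Y = D (emb x) Y - s"
    using V(2) eq D_triangle[OF emb_C[OF V(1)] emb_C[OF V(2)] Y]
      D_triangle[OF emb_C[OF V(2)] emb_C[OF V(3)] Y] by linarith
qed

lemma ray_to_limit:
  assumes r: "ray_to x Y u L" and L: "0 < L" and X: "X \<in> C" and Y: "Y \<in> C"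
    and lim: "\<And>s. 0 \<le> s \<Longrightarrow> s < L \<Longrightarrow> D (emb (x + s *\<^sub>R u)) X \<le> L - s"
  shows "D X Y = D (emb x) Y - L"
proof -
  have "\<bar>D X Y - (D (emb x) Y - L)\<bar> \<le> 0 + e" if e: "0 < e" for e
  proof -
    define s where "s = max 0 (L - e / 2)"
    have s: "0 \<le> s" "s < L" "L - s \<le> e / 2" using L e unfolding s_def by linarith+
    then have V: "x + s *\<^sub>R u \<in> V" and d: "D (emb (x + s *\<^sub>R u)) Y = D (emb x) Y - s"
      using r by (auto simp: ray_to_def)
    show ?thesis
      using D_diff_le[OF emb_C[OF V] X Y] lim[OF s(1,2)] d s by linarith
  qed
  then show ?thesis using field_le_epsilon[of "\<bar>D X Y - (D (emb x) Y - L)\<bar>" 0] by simp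
qed

text \<open>A completed domain need not contain shortest curves, since it need not be locally compact. One
  can still go straight towards a point of the completion at unit speed, because the spheres
  inside the domain are compact, and only the boundary can stop this motion.\<close>
lemma shoot:
  assumes x: "x \<in> V" and Y: "Y \<in> C" and ne: "emb x \<noteq> Y"
  obtains u L X where "norm u = 1" "0 < L" "L \<le> D (emb x) Y" "ray_to x Y u L" "X \<in> C"
    "foot X = x + L *\<^sub>R u" "D (emb x) X = L" "D X Y = D (emb x) Y - L" "X = Y \<or> X \<in> H"
proof -
  note xC = emb_C[OF x]
  define d where "d = D (emb x) Y"
  have d: "d > 0"
    using D_nonneg[OF xC Y] D_zero[OF xC Y] ne unfolding d_def by linarith
  obtain r where r: "r > 0" "ball x r \<subseteq> V" using open_V x openE by blast
  define t where "t = min (r / 2) (d / 2)"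
  have t: "0 < t" "t < r" "t < d" using r d by (auto simp: t_def)
  obtain u where u: "norm u = 1" "D (emb (x + t *\<^sub>R u)) Y = D (emb x) Y - t"
    using first_step[OF r(2) Y t(1,2) t(3)[unfolded d_def]] by blast
  define T where "T = {L. 0 < L \<and> L \<le> d \<and> ray_to x Y u L}"
  have tT: "t \<in> T" using ray_to_step[OF r(2) Y u(1) t(1,2) u(2)] t by (simp add: T_def)
  have bdd: "bdd_above T" by (rule bdd_aboveI[of _ d]) (simp add: T_def)
  define L where "L = Sup T"
  have tL: "t \<le> L" unfolding L_def by (rule cSup_upper[OF tT bdd])
  have Ld: "L \<le> d" unfolding L_def using tT by (intro cSup_least) (auto simp: T_def)
  have L0: "0 < L" using t tL by simp
  have ray: "ray_to x Y u L"
    unfolding ray_to_def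
  proof (intro allI impI)
    fix s assume s: "0 \<le> s \<and> s < L"
    then obtain L' where "L' \<in> T" "s < L'"
      using less_cSup_iff[of T s] tT bdd unfolding L_def by blast
    then show "x + s *\<^sub>R u \<in> V \<and> D (emb (x + s *\<^sub>R u)) Y = D (emb x) Y - s"
      using s by (auto simp: T_def ray_to_def)
  qed
  have rayV: "x + s *\<^sub>R u \<in> V" if "0 \<le> s" "s < L" for s using ray that by (simp add: ray_to_def)
  obtain X where X: "X \<in> C" "foot X = x + L *\<^sub>R u"
    "\<And>s. 0 \<le> s \<Longrightarrow> s < L \<Longrightarrow> D (emb (x + s *\<^sub>R u)) X = L - s"
    using exit_point[OF u(1) L0 rayV] by blast
  have XY: "D X Y = d - L"
    unfolding d_def by (rule ray_to_limit[OF ray L0 X(1) Y]) (simp add: X(3))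
  \<comment> \<open>Inside \<open>V\<close> the motion can go on, and without a bend: a bend would give a shortcut.\<close>
  have stop: "x + L *\<^sub>R u \<notin> V" if less: "L < d"
  proof
    assume x': "x + L *\<^sub>R u \<in> V"
    define x' where "x' = x + L *\<^sub>R u"
    have X_eq: "X = emb x'" using emb_foot[OF X(1)] X(2) x' by (simp add: x'_def)
    obtain r' where r': "r' > 0" "ball x' r' \<subseteq> V" using open_V x' openE unfolding x'_def by blast
    define q where "q = min (min (r' / 2) ((d - L) / 2)) (L / 2)"
    have q: "0 < q" "q < r'" "q < d - L" "q < L" using r'(1) less L0 by (auto simp: q_def min_def)
    have dx': "D (emb x') Y = d - L" using XY X_eq by simp
    obtain v where v: "norm v = 1" "D (emb (x' + q *\<^sub>R v)) Y = D (emb x') Y - q"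
      using first_step[OF r'(2) Y q(1,2)] q(3) dx' by auto
    define z where "z = x + (L - q) *\<^sub>R u"
    have z: "z \<in> V" "D (emb z) Y = d - (L - q)"
      using ray q by (auto simp: ray_to_def z_def d_def)
    have zx: "z = x' - q *\<^sub>R u" by (simp add: z_def x'_def algebra_simps)
    have inb: "z \<in> ball x' r'" "x' + q *\<^sub>R v \<in> ball x' r'"
      using q u(1) v(1) by (simp_all add: zx dist_norm)
    then have vV: "x' + q *\<^sub>R v \<in> V" using r'(2) by blast
    have "2 * q \<le> D (emb z) (emb (x' + q *\<^sub>R v))"
      using D_triangle[OF emb_C[OF z(1)] emb_C[OF vV] Y] z(2) v(2) dx' by linarith
    also have "\<dots> = norm (q *\<^sub>R (u + v))"
      using D_emb_ball[OF r'(2) inb] by (simp add: zx dist_norm norm_minus_commute algebra_simps)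
    also have "\<dots> = q * norm (u + v)" using q by simp
    finally have "u = v" using q by (intro unit_vectors_eq_if_norm_add_ge_2[OF u(1) v(1)]) simp
    then have ray': "ray_to x' Y u q" using ray_to_step[OF r'(2) Y v(1) q(1,2) v(2)] by simp
    have "ray_to x Y u (L + q)"
      unfolding ray_to_def
    proof (intro allI impI)
      fix s assume s: "0 \<le> s \<and> s < L + q"
      show "x + s *\<^sub>R u \<in> V \<and> D (emb (x + s *\<^sub>R u)) Y = D (emb x) Y - s"
      proof (cases "s < L")
        case True then show ?thesis using ray s by (simp add: ray_to_def)
      next
        case False
        have "x' + (s - L) *\<^sub>R u \<in> V \<and> D (emb (x' + (s - L) *\<^sub>R u)) Y = D (emb x') Y - (s - L)"
          using ray' s False by (simp add: ray_to_def)
        moreover have "x' + (s - L) *\<^sub>R u = x + s *\<^sub>R u" by (simp add: x'_def algebra_simps)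
        ultimately show ?thesis using dx' by (simp add: d_def)
      qed
    qed
    then have "L + q \<in> T" using L0 q by (simp add: T_def)
    then have "L + q \<le> L" unfolding L_def by (rule cSup_upper[OF _ bdd])
    then show False using q by simp
  qed
  have "X = Y \<or> X \<in> H"
  proof (cases "L < d")
    case True then show ?thesis using stop X by (simp add: H_eq)
  next
    case False then show ?thesis using XY Ld D_zero[OF X(1) Y] by simp
  qed
  then show ?thesis
    using that[OF u(1) L0 _ ray X(1,2) _ _] Ld XY X(3)[of 0] L0 by (simp add: d_def)
qed

text \<open>The shortest ways from the midpoint to \<open>X\<close> and to \<open>Y\<close> are straight until they meet the boundary, and
  they do not form an angle at the midpoint, because a chord would cut it off.\<close>
lemma straight_connection:
  assumes X: "X \<in> C" and Y: "Y \<in> C" and x: "x \<in> V" and L: "0 < D X Y"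
    and m: "D (emb x) X = D X Y / 2" "D (emb x) Y = D X Y / 2"
    and free: "\<And>Q. Q \<in> H \<Longrightarrow> D X Q + D Q Y = D X Y \<Longrightarrow> Q = X \<or> Q = Y"
  obtains u where "norm u = 1" "foot X = x - (D X Y / 2) *\<^sub>R u" "foot Y = x + (D X Y / 2) *\<^sub>R u"
    "ray_to x Y u (D X Y / 2)" "ray_to x X (- u) (D X Y / 2)"
proof -
  define h where "h = D X Y / 2"
  have h: "h > 0" using L by (simp add: h_def)
  note xC = emb_C[OF x]
  \<comment> \<open>Moving from the midpoint to either end, a boundary point on the way would lie between the ends.\<close>
  have half: "\<exists>u. norm u = 1 \<and> ray_to x B u h \<and> foot B = x + h *\<^sub>R u"
    if AB: "A \<in> C" "B \<in> C" "D A B = 2 * h" "D (emb x) A = h" "D (emb x) B = h"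
      "\<And>Q. Q \<in> H \<Longrightarrow> D A Q + D Q B = D A B \<Longrightarrow> Q = A \<or> Q = B" for A B
  proof -
    have "emb x \<noteq> B" using D_refl[OF AB(2)] AB(5) h by auto
    then obtain u L Q where Q: "norm u = 1" "0 < L" "L \<le> D (emb x) B" "ray_to x B u L" "Q \<in> C"
      "foot Q = x + L *\<^sub>R u" "D (emb x) Q = L" "D Q B = D (emb x) B - L" "Q = B \<or> Q \<in> H"
      by (rule shoot[OF x AB(2)])
    have QB: "Q = B"
    proof (rule ccontr)
      assume QB: "Q \<noteq> B"
      have "D A Q \<le> h + L" using D_triangle[OF AB(1) xC Q(5)] D_commute[OF AB(1) xC] AB(4) Q(7) by linarith
      then have "D A Q + D Q B = D A B"
        using D_triangle[OF AB(1) Q(5) AB(2)] Q(8) AB(3,5) by linarith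
      then have "Q = A" using AB(6) Q(9) QB by blast
      then show False using Q(2,8) AB(3,5) h by simp
    qed
    then have "L = h" using Q(7) AB(5) by simp
    then show ?thesis using Q QB by blast
  qed
  obtain u where u: "norm u = 1" "ray_to x Y u h" "foot Y = x + h *\<^sub>R u"
    using half[OF X Y] m free by (auto simp: h_def)
  have YX: "D Y X = D X Y" by (rule D_commute[OF Y X])
  have free': "Q = Y \<or> Q = X" if Q: "Q \<in> H" "D Y Q + D Q X = D Y X" for Q
    using free[OF Q(1)] Q(2) D_commute[OF X H_C[OF Q(1)]] D_commute[OF Y H_C[OF Q(1)]] YX by auto
  obtain v where v: "norm v = 1" "ray_to x X v h" "foot X = x + h *\<^sub>R v"
    using half[OF Y X _ _ _ free'] m YX by (auto simp: h_def)
  obtain r where r: "r > 0" "ball x r \<subseteq> V" using open_V x openE by blast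
  define t where "t = min (r / 2) (h / 2)"
  have t: "0 < t" "t < r" "t < h" using r h by (auto simp: t_def)
  have p: "x + t *\<^sub>R u \<in> V" "D (emb (x + t *\<^sub>R u)) Y = h - t"
    "x + t *\<^sub>R v \<in> V" "D (emb (x + t *\<^sub>R v)) X = h - t"
    using u(2) v(2) t m by (auto simp: ray_to_def h_def)
  note pC = emb_C[OF p(1)] emb_C[OF p(3)]
  have inb: "x + t *\<^sub>R u \<in> ball x r" "x + t *\<^sub>R v \<in> ball x r" using t u v by (simp_all add: dist_norm)
  have "2 * h \<le> D X (emb (x + t *\<^sub>R v)) + D (emb (x + t *\<^sub>R v)) (emb (x + t *\<^sub>R u)) + D (emb (x + t *\<^sub>R u)) Y"
    using D_triangle[OF X pC(2) Y] D_triangle[OF pC(2,1) Y] by (simp add: h_def)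
  then have "2 * t \<le> D (emb (x + t *\<^sub>R v)) (emb (x + t *\<^sub>R u))"
    using p(2,4) D_commute[OF X pC(2)] by linarith
  also have "\<dots> = norm (t *\<^sub>R (u + (- v)))"
    using D_emb_ball[OF r(2) inb(2,1)] by (simp add: dist_norm norm_minus_commute algebra_simps)
  also have "\<dots> = t * norm (u + (- v))" using t by simp
  finally have "u = - v" using t v(1) by (intro unit_vectors_eq_if_norm_add_ge_2[OF u(1)]) auto
  then have "v = - u" by simp
  then show ?thesis using that[of u] u v by (simp add: h_def)
qed

end

section \<open>Rigid motions\<close>

definition rigid :: "('a::euclidean_space \<Rightarrow> 'a) \<Rightarrow> bool" where
  "rigid J \<longleftrightarrow> (\<exists>a A. orthogonal_transformation A \<and> J = (\<lambda>x. a + A x))"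

lemma rigidE:
  assumes "rigid J"
  obtains A where "orthogonal_transformation A" "linear A" "\<And>x y. J x = J y + A (x - y)"
proof -
  obtain a A where A: "orthogonal_transformation A" "J = (\<lambda>x. a + A x)"
    using assms unfolding rigid_def by blast
  note l = orthogonal_transformation_linear[OF A(1)]
  show ?thesis by (rule that[OF A(1) l]) (simp add: A(2) linear_diff[OF l])
qed

lemma rigid_dist: assumes "rigid J" shows "dist (J x) (J y) = dist x y"
proof -
  obtain A where A: "orthogonal_transformation A" "linear A" "\<And>x y. J x = J y + A (x - y)"
    using rigidE[OF assms] by blast
  show ?thesis using A(3)[of x y] orthogonal_transformation_norm[OF A(1), of "x - y"] by (simp add: dist_norm)
qed

lemma rigid_bij: assumes "rigid J" shows "bij J"
proof -
  obtain a A where A: "orthogonal_transformation A" "J = (\<lambda>x. a + A x)"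
    using assms unfolding rigid_def by blast
  have "bij ((+) a \<circ> A)"
    by (rule bij_comp[OF orthogonal_transformation_bij[OF A(1)]]) simp
  then show ?thesis using A(2) by (simp add: comp_def)
qed

lemma rigid_continuous: "rigid J \<Longrightarrow> continuous_on S J"
  by (intro continuous_onI) (metis rigid_dist less_imp_le)

lemma rigid_inv_dist: "rigid J \<Longrightarrow> dist (inv J x) (inv J y) = dist x y"
  using rigid_dist[of J "inv J x" "inv J y"] rigid_bij[of J] by (simp add: bij_is_surj surj_f_inv_f)

lemma rigid_inv_continuous: "rigid J \<Longrightarrow> continuous_on S (inv J)"
  by (intro continuous_onI) (metis rigid_inv_dist less_imp_le)

lemma rigid_inj_iff: "rigid J \<Longrightarrow> J x = J y \<longleftrightarrow> x = y"
  using rigid_dist[of J x y] by auto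

lemma rigid_in_image: "rigid J \<Longrightarrow> x \<in> J ` S \<longleftrightarrow> inv J x \<in> S"
  using rigid_bij[of J] by (metis bij_inv_eq_iff image_iff)

lemma rigid_in_image': "rigid J \<Longrightarrow> J x \<in> J ` S \<longleftrightarrow> x \<in> S"
  by (simp add: inj_image_mem_iff bij_is_inj[OF rigid_bij])

lemma rigid_segment:
  assumes "rigid J" shows "J ` closed_segment x y = closed_segment (J x) (J y)"
proof -
  obtain a A where A: "orthogonal_transformation A" "J = (\<lambda>x. a + A x)"
    using assms unfolding rigid_def by blast
  have "J ` closed_segment x y = (+) a ` (A ` closed_segment x y)" by (auto simp: A(2))
  also have "\<dots> = closed_segment (J x) (J y)"
    using closed_segment_linear_image[OF orthogonal_transformation_linear[OF A(1)]] A(2)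
      closed_segment_translation by metis
  finally show ?thesis .
qed

lemma affine_hull_UNIV_imp_span:
  fixes S :: "'a::euclidean_space set"
  assumes "c \<in> S" "affine hull S = UNIV"
  shows "span ((\<lambda>y. y - c) ` S) = UNIV"
proof -
  have "c \<in> affine hull S" by (rule hull_inc[OF assms(1)])
  then have "UNIV = (\<lambda>x. c + x) ` span ((\<lambda>y. y - c) ` S)"
    using affine_hull_span_gen[of c S] assms(2) by (simp add: algebra_simps)
  then have "v \<in> span ((\<lambda>y. y - c) ` S)" for v
    using UNIV_I[of "c + v"] by (metis (no_types, lifting) add_left_cancel imageE)
  then show ?thesis by auto
qed

lemma rigid_eqI:
  assumes J: "rigid J" "rigid J'" and c: "c \<in> S" and S: "affine hull S = UNIV"
    and eq: "\<And>y. y \<in> S \<Longrightarrow> J y = J' y"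
  shows "J = J'"
proof -
  obtain A where A: "orthogonal_transformation A" "linear A" "\<And>x y. J x = J y + A (x - y)"
    using rigidE[OF J(1)] by blast
  obtain B where B: "orthogonal_transformation B" "linear B" "\<And>x y. J' x = J' y + B (x - y)"
    using rigidE[OF J(2)] by blast
  have AB: "A (y - c) = B (y - c)" if y: "y \<in> S" for y
    using A(3)[of y c] B(3)[of y c] eq[OF y] eq[OF c] by simp
  have ABv: "A v = B v" for v
  proof (rule linear_eq_on[OF A(2) B(2)])
    show "v \<in> span ((\<lambda>y. y - c) ` S)" using affine_hull_UNIV_imp_span[OF c S] by simp
  qed (use AB in auto)
  show ?thesis
  proof
    show "J x = J' x" for x
      by (simp only: A(3)[of x c] B(3)[of x c] eq[OF c] ABv)
  qed
qed

text \<open>Distances determine the inner products of the differences, so a linear map that agrees with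
  the given one on a basis is orthogonal, and then it agrees with it on the whole set.\<close>
lemma rigid_extension:
  fixes g :: "'a::euclidean_space \<Rightarrow> 'a"
  assumes c: "c \<in> S" and S: "affine hull S = UNIV"
    and iso: "\<And>x y. x \<in> S \<Longrightarrow> y \<in> S \<Longrightarrow> dist (g x) (g y) = dist x y"
  obtains J where "rigid J" "\<And>y. y \<in> S \<Longrightarrow> J y = g y"
proof -
  define S0 where "S0 = (\<lambda>y. y - c) ` S"
  define f where "f v = g (v + c) - g c" for v
  have f: "f v \<bullet> f w = v \<bullet> w" if "v \<in> S0" "w \<in> S0" for v w
  proof -
    have vc: "v + c \<in> S" "w + c \<in> S" using that by (auto simp: S0_def)
    have "norm (f v) = norm v" "norm (f w) = norm w" "norm (f v - f w) = norm (v - w)"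
      using iso[OF vc(1) c] iso[OF vc(2) c] iso[OF vc] by (simp_all add: f_def dist_norm)
    then show ?thesis by (simp add: dot_norm_neg)
  qed
  obtain B where B: "B \<subseteq> S0" "independent B" "S0 \<subseteq> span B"
    using maximal_independent_subset by blast
  have spanB: "span B = UNIV"
    using affine_hull_UNIV_imp_span[OF c S] span_mono[OF B(3)] by (simp add: S0_def span_span top.extremum_unique)
  obtain A where A: "linear A" "\<forall>b\<in>B. A b = f b"
    using linear_independent_extend[OF B(2)] by blast
  note lin = linear_add[OF A(1)] linear_scale[OF A(1)] linear_0[OF A(1)]
  have 1: "A b \<bullet> A v = b \<bullet> v" if b: "b \<in> B" for b v
  proof -
    have "v \<in> span B" by (simp add: spanB)
    then show ?thesis
    proof (induction rule: span_induct)
      case base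
      show ?case by (rule subspaceI) (simp_all add: lin inner_add_right)
    next
      case (step w)
      then show ?case using b A(2) f B(1) by auto
    qed
  qed
  have 2: "A w \<bullet> A v = w \<bullet> v" for v w
  proof -
    have "w \<in> span B" by (simp add: spanB)
    then show ?thesis
    proof (induction rule: span_induct)
      case base
      show ?case by (rule subspaceI) (simp_all add: lin inner_add_left)
    next
      case (step w)
      then show ?case using 1 by auto
    qed
  qed
  have oA: "orthogonal_transformation A" using A(1) 2 by (simp add: orthogonal_transformation_def)
  have fA: "f v = A v" if v: "v \<in> S0" for v
  proof -
    have "(f v - A v) \<bullet> A w = 0" for w
    proof -
      have "w \<in> span B" by (simp add: spanB)
      then show ?thesis
      proof (induction rule: span_induct)
        case base
        show ?case by (rule subspaceI) (simp_all add: lin inner_add_right)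
      next
        case (step b)
        then have "A b = f b" "b \<in> S0" using A(2) B(1) by auto
        then show ?case using f[OF v, of b] 1[OF step, of v] inner_commute[of "f v" "f b"] inner_commute[of "A v" "A b"]
            inner_commute[of v b] by (simp add: inner_diff_left inner_diff_right)
      qed
    qed
    moreover obtain w where "A w = f v - A v" using orthogonal_transformation_surj[OF oA] by (metis surjD)
    ultimately have "(f v - A v) \<bullet> (f v - A v) = 0" by metis
    then show ?thesis by simp
  qed
  define J where "J x = (g c - A c) + A x" for x
  show ?thesis
  proof (rule that[of J])
    show "rigid J" unfolding rigid_def J_def using oA by blast
    fix y assume "y \<in> S"
    then have "f (y - c) = A (y - c)" using fA by (auto simp: S0_def)
    then show "J y = g y" by (simp add: J_def f_def linear_diff[OF A(1)] algebra_simps)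
  qed
qed

section \<open>Strictly convex domains\<close>

locale strictly_convex =
  fixes U :: "'a::euclidean_space set"
  assumes sc: "strictly_convex_domain U" and dim: "2 \<le> DIM('a)"
begin

abbreviation "K \<equiv> closure U"
abbreviation "\<Omega> \<equiv> frontier U"
abbreviation "pr \<equiv> closest_point (closure U)"

lemma open_U: "open U" and convex_U: "convex U" and nonempty_U: "U \<noteq> {}" and domain_U: "is_domain U"
  using sc by (auto simp: strictly_convex_domain_def is_domain_def)

lemma closed_K: "closed K" and convex_K: "convex K" and nonempty_K: "K \<noteq> {}"
  using convex_closure[OF convex_U] nonempty_U by auto

lemma chord_subset: "x \<in> K \<Longrightarrow> y \<in> K \<Longrightarrow> x \<noteq> y \<Longrightarrow> open_segment x y \<subseteq> U"
  using sc by (auto simp: strictly_convex_domain_def)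

lemma U_subset_K: "U \<subseteq> K" by (rule closure_subset)

lemma interior_K: "interior K = U"
  using convex_interior_closure[OF convex_U] open_U by (simp add: interior_open)

lemma \<Omega>_eq: "\<Omega> = K - U"
  using open_U by (simp add: frontier_def interior_open)

lemma supporting_normal:
  assumes "c \<in> \<Omega>"
  obtains n where "norm n = 1" "\<And>y. y \<in> U \<Longrightarrow> 0 < n \<bullet> (y - c)" "\<And>y. y \<in> K \<Longrightarrow> 0 \<le> n \<bullet> (y - c)"
proof -
  have ri: "rel_interior U = U" using open_U by (rule rel_interior_open)
  obtain a where a: "a \<noteq> 0" "\<And>y. y \<in> K \<Longrightarrow> a \<bullet> c \<le> a \<bullet> y" "\<And>y. y \<in> U \<Longrightarrow> a \<bullet> c < a \<bullet> y"
    using supporting_hyperplane_relative_frontier[OF convex_U, of c] assms unfolding ri \<Omega>_eq by blast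
  have n: "norm a > 0" using a(1) by simp
  show ?thesis
    by (rule that[of "(1 / norm a) *\<^sub>R a"]) (use a n in \<open>auto simp: inner_diff_right divide_simps\<close>)
qed

text \<open>Strict convexity at work: slices of \<open>U\<close> close to a supporting hyperplane at \<open>c\<close> lie close to
  \<open>c\<close>, hence every point of \<open>U\<close> near \<open>c\<close> lies on a short chord.\<close>
lemma short_chord:
  assumes c: "c \<in> \<Omega>" and \<eta>: "0 < \<eta>"
  obtains \<eta>' where "0 < \<eta>'" "\<eta>' \<le> \<eta>"
    "\<And>x. x \<in> U \<Longrightarrow> dist x c < \<eta>' \<Longrightarrow> \<exists>a b. a \<in> \<Omega> \<and> b \<in> \<Omega> \<and> dist a c < \<eta> \<and> dist b c < \<eta> \<and> x \<in> open_segment a b"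
proof -
  obtain n where n: "norm n = 1" "\<And>y. y \<in> U \<Longrightarrow> 0 < n \<bullet> (y - c)" "\<And>y. y \<in> K \<Longrightarrow> 0 \<le> n \<bullet> (y - c)"
    by (rule supporting_normal[OF c]) blast
  obtain w where w: "w \<noteq> 0" "orthogonal n w" using orthogonal_to_vector_exists[OF dim, of n] by blast
  define v where "v = (1 / norm w) *\<^sub>R w"
  have v: "norm v = 1" "n \<bullet> v = 0" using w by (auto simp: v_def orthogonal_def)
  have cK: "c \<in> K" using c \<Omega>_eq by blast
  \<comment> \<open>The supporting hyperplane meets \<open>K\<close> only in \<open>c\<close>, so points of \<open>K\<close> at distance \<open>\<eta>\<close> are at least
    \<open>\<mu>\<close> above it. A line parallel to the hyperplane and below this level leaves \<open>U\<close> near \<open>c\<close>.\<close>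
  have pos: "0 < n \<bullet> (y - c)" if y: "y \<in> K \<inter> sphere c \<eta>" for y
  proof -
    have "y \<noteq> c" using y \<eta> by auto
    then have "open_segment c y \<subseteq> U" using chord_subset[OF cK] y by auto
    moreover have "midpoint c y \<in> open_segment c y" using \<open>y \<noteq> c\<close> by simp
    ultimately have "0 < n \<bullet> (midpoint c y - c)" using n(2) by blast
    also have "midpoint c y - c = (1/2) *\<^sub>R (y - c)" by (simp add: midpoint_def algebra_simps flip: scaleR_add_left)
    finally show ?thesis by simp
  qed
  have "\<exists>\<mu>>0. \<forall>y\<in>K \<inter> sphere c \<eta>. \<mu> \<le> n \<bullet> (y - c)"
  proof (cases "K \<inter> sphere c \<eta> = {}")
    case True then show ?thesis by (intro exI[of _ 1]) auto
  next
    case False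
    have "compact (K \<inter> sphere c \<eta>)" by (rule closed_Int_compact[OF closed_K compact_sphere])
    moreover have "continuous_on (K \<inter> sphere c \<eta>) (\<lambda>y. n \<bullet> (y - c))" by (intro continuous_intros)
    ultimately obtain y where "y \<in> K \<inter> sphere c \<eta>" "\<forall>z\<in>K \<inter> sphere c \<eta>. n \<bullet> (y - c) \<le> n \<bullet> (z - c)"
      using continuous_attains_inf[of "K \<inter> sphere c \<eta>"] False by blast
    then show ?thesis using pos by blast
  qed
  then obtain \<mu> where \<mu>: "\<mu> > 0" "\<And>y. y \<in> K \<Longrightarrow> dist c y = \<eta> \<Longrightarrow> \<mu> \<le> n \<bullet> (y - c)" by auto
  define \<eta>' where "\<eta>' = min \<mu> \<eta>"
  show ?thesis
  proof (rule that[of \<eta>'])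
    show "0 < \<eta>'" "\<eta>' \<le> \<eta>" using \<mu>(1) \<eta> by (auto simp: \<eta>'_def)
    fix x assume x: "x \<in> U" "dist x c < \<eta>'"
    have nx: "n \<bullet> (x - c) < \<mu>"
    proof -
      have "n \<bullet> (x - c) \<le> norm n * norm (x - c)" by (rule norm_cauchy_schwarz)
      also have "\<dots> < \<mu>" using x(2) n(1) by (simp add: \<eta>'_def dist_norm)
      finally show ?thesis .
    qed
    have xK: "x \<in> K" using x(1) U_subset_K by blast
    have near: "dist y c < \<eta>" if y: "y = x + t *\<^sub>R e" "y \<in> K" "n \<bullet> e = 0" for y t e
    proof (rule ccontr)
      assume far: "\<not> dist y c < \<eta>"
      have "\<exists>s\<ge>0. s \<le> 1 \<and> dist c (x + (s * t) *\<^sub>R e) = \<eta>"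
      proof (rule IVT')
        show "dist c (x + (0 * t) *\<^sub>R e) \<le> \<eta>" using x(2) by (simp add: \<eta>'_def dist_commute)
        show "\<eta> \<le> dist c (x + (1 * t) *\<^sub>R e)" using far y(1) by (simp add: dist_commute)
        show "continuous_on {0..1} (\<lambda>s. dist c (x + (s * t) *\<^sub>R e))" by (intro continuous_intros)
      qed simp
      then obtain s where s: "0 \<le> s" "s \<le> 1" "dist c (x + (s * t) *\<^sub>R e) = \<eta>" by blast
      have "x + (s * t) *\<^sub>R e = (1 - s) *\<^sub>R x + s *\<^sub>R y" by (simp add: y(1) algebra_simps)
      then have "x + (s * t) *\<^sub>R e \<in> K"
        using convexD_alt[OF convex_K xK y(2) s(1,2)] by simp
      from \<mu>(2)[OF this s(3)] have "\<mu> \<le> n \<bullet> (x - c)"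
        using y(3) by (simp add: inner_diff_right inner_add_right)
      then show False using nx by simp
    qed
    have exit: "\<exists>t>0. x + t *\<^sub>R e \<in> \<Omega>" if e: "norm e = 1" "n \<bullet> e = 0" for e
    proof -
      let ?y = "x + (2 * \<eta>) *\<^sub>R e"
      have "norm ((2 * \<eta>) *\<^sub>R e) = 2 * \<eta>" using e \<eta> by simp
      then have "2 * \<eta> \<le> dist ?y c + dist x c"
        using norm_triangle_ineq4[of "?y - c" "x - c"] by (simp add: dist_norm)
      then have "\<eta> \<le> dist ?y c" using x(2) by (simp add: \<eta>'_def)
      then have "?y \<notin> K" using near[OF refl _ e(2), of "2 * \<eta>"] by auto
      then have "?y \<notin> U" using U_subset_K by blast
      then have "closed_segment x ?y \<inter> U \<noteq> {}" "closed_segment x ?y - U \<noteq> {}" using x(1) by auto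
      from connected_Int_frontier[OF connected_segment(1) this]
      obtain z where z: "z \<in> closed_segment x ?y" "z \<in> \<Omega>" by auto
      then obtain s where s: "0 \<le> s" "z = x + s *\<^sub>R ((2 * \<eta>) *\<^sub>R e)"
        by (auto simp: in_segment algebra_simps)
      have "s \<noteq> 0"
      proof
        assume "s = 0"
        then have "z = x" using s(2) by simp
        then show False using z(2) x(1) \<Omega>_eq by blast
      qed
      then show ?thesis using s z(2) \<eta> by (intro exI[of _ "s * (2 * \<eta>)"]) simp
    qed
    obtain t1 where t1: "t1 > 0" "x + t1 *\<^sub>R v \<in> \<Omega>" using exit[of v] v by blast
    obtain t2 where t2: "t2 > 0" "x + t2 *\<^sub>R (- v) \<in> \<Omega>" using exit[of "- v"] v by auto
    have d: "dist (x + t1 *\<^sub>R v) c < \<eta>" "dist (x + t2 *\<^sub>R (- v)) c < \<eta>"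
      using near[OF refl, of t1 v] near[OF refl, of t2 "- v"] v(2) t1(2) t2(2) \<Omega>_eq by auto
    have "x \<in> open_segment (x + t1 *\<^sub>R v) (x + t2 *\<^sub>R (- v))"
    proof -
      have ne: "x + t1 *\<^sub>R v \<noteq> x + t2 *\<^sub>R (- v)"
      proof
        assume "x + t1 *\<^sub>R v = x + t2 *\<^sub>R (- v)"
        then have "(t1 + t2) *\<^sub>R v = 0" by (simp add: algebra_simps)
        then show False using t1(1) t2(1) v(1) by auto
      qed
      define k where "k = t1 / (t1 + t2)"
      have k: "0 < k" "k < 1" "(1 - k) * t1 - k * t2 = 0"
        using t1(1) t2(1) by (auto simp: k_def field_simps)
      have "(1 - k) *\<^sub>R (x + t1 *\<^sub>R v) + k *\<^sub>R (x + t2 *\<^sub>R (- v)) = x + ((1 - k) * t1 - k * t2) *\<^sub>R v"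
        by (simp add: algebra_simps)
      then have "x = (1 - k) *\<^sub>R (x + t1 *\<^sub>R v) + k *\<^sub>R (x + t2 *\<^sub>R (- v))" using k(3) by simp
      then show ?thesis unfolding in_segment using k(1,2) ne by blast
    qed
    then show "\<exists>a b. a \<in> \<Omega> \<and> b \<in> \<Omega> \<and> dist a c < \<eta> \<and> dist b c < \<eta> \<and> x \<in> open_segment a b"
      using t1(2) t2(2) d by blast
  qed
qed

text \<open>Short chords fill an open set, so a piece of the boundary is not contained in a hyperplane. This makes
  the rigid motions below unique.\<close>
lemma affine_hull_boundary:
  assumes c: "c \<in> \<Omega>" and \<eta>: "0 < \<eta>"
  shows "affine hull (\<Omega> \<inter> ball c \<eta>) = UNIV"
proof -
  obtain \<eta>' where \<eta>': "0 < \<eta>'"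
    "\<And>x. x \<in> U \<Longrightarrow> dist x c < \<eta>' \<Longrightarrow> \<exists>a b. a \<in> \<Omega> \<and> b \<in> \<Omega> \<and> dist a c < \<eta> \<and> dist b c < \<eta> \<and> x \<in> open_segment a b"
    by (rule short_chord[OF c \<eta>]) blast
  have "U \<inter> ball c \<eta>' \<subseteq> affine hull (\<Omega> \<inter> ball c \<eta>)"
  proof
    fix x assume "x \<in> U \<inter> ball c \<eta>'"
    then obtain a b where ab: "a \<in> \<Omega> \<inter> ball c \<eta>" "b \<in> \<Omega> \<inter> ball c \<eta>" "x \<in> open_segment a b"
      using \<eta>'(2)[of x] by (auto simp: dist_commute)
    then have "x \<in> convex hull {a, b}" by (auto simp: segment_convex_hull open_segment_def)
    also have "\<dots> \<subseteq> convex hull (\<Omega> \<inter> ball c \<eta>)" using ab by (intro hull_mono) auto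
    also have "\<dots> \<subseteq> affine hull (\<Omega> \<inter> ball c \<eta>)" by (rule convex_hull_subset_affine_hull)
    finally show "x \<in> affine hull (\<Omega> \<inter> ball c \<eta>)" .
  qed
  then have "affine hull (U \<inter> ball c \<eta>') \<subseteq> affine hull (\<Omega> \<inter> ball c \<eta>)"
    by (metis hull_hull hull_mono)
  moreover have "U \<inter> ball c \<eta>' \<noteq> {}"
    using c \<eta>'(1) \<Omega>_eq closure_approachable[of c U] by (fastforce simp: dist_commute)
  ultimately show ?thesis
    using affine_hull_open[of "U \<inter> ball c \<eta>'"] open_U by auto
qed

subsection \<open>The nearest point projection\<close>

lemma pr_K: "pr x \<in> K"
  by (rule closest_point_in_set[OF closed_K nonempty_K])

lemma pr_lipschitz: "dist (pr x) (pr y) \<le> dist x y"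
  by (rule closest_point_lipschitz[OF convex_K closed_K nonempty_K])

lemma pr_self: "x \<in> K \<Longrightarrow> pr x = x"
  by (rule closest_point_self)

lemma pr_dot: "y \<in> K \<Longrightarrow> (x - pr x) \<bullet> (y - pr x) \<le> 0"
  by (rule closest_point_dot[OF convex_K closed_K])

lemma pr_\<Omega>: assumes x: "x \<notin> U" shows "pr x \<in> \<Omega>"
proof (cases "x \<in> K")
  case True then show ?thesis using x pr_self \<Omega>_eq by simp
next
  case False
  have "pr x \<notin> U"
  proof
    assume "pr x \<in> U"
    then obtain r where r: "r > 0" "cball (pr x) r \<subseteq> U" using open_U open_contains_cball by blast
    define d where "d = norm (x - pr x)"
    have d: "d > 0" using False pr_K[of x] by (auto simp: d_def)
    define y where "y = pr x + (r / d) *\<^sub>R (x - pr x)"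
    have "y \<in> cball (pr x) r" using r d by (simp add: y_def dist_norm d_def)
    then have "y \<in> K" using r(2) U_subset_K by blast
    then have "(x - pr x) \<bullet> (y - pr x) \<le> 0" by (rule pr_dot)
    moreover have "(x - pr x) \<bullet> (y - pr x) = (r / d) * d\<^sup>2"
      by (simp add: y_def d_def power2_norm_eq_inner)
    moreover have "0 < (r / d) * d\<^sup>2" using r(1) d by simp
    ultimately show False by linarith
  qed
  then show ?thesis using pr_K \<Omega>_eq by blast
qed

lemma pr_normal:
  assumes c: "c \<in> K" and n: "\<And>y. y \<in> K \<Longrightarrow> 0 \<le> n \<bullet> (y - c)" and s: "0 \<le> s"
  shows "pr (c - s *\<^sub>R n) = c"
proof (rule sym, rule closest_point_unique[OF convex_K closed_K c], intro ballI)
  fix z assume z: "z \<in> K"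
  have "(norm (c - s *\<^sub>R n - z))\<^sup>2 = (norm (z - c))\<^sup>2 + 2 * s * (n \<bullet> (z - c)) + (norm (s *\<^sub>R n))\<^sup>2"
    unfolding power2_norm_eq_inner by (simp add: algebra_simps inner_commute)
  also have "\<dots> \<ge> (norm (s *\<^sub>R n))\<^sup>2" using n[OF z] s by simp
  finally have "norm (s *\<^sub>R n) \<le> norm (c - s *\<^sub>R n - z)"
    by (rule power2_le_imp_le) simp
  then show "dist (c - s *\<^sub>R n) c \<le> dist (c - s *\<^sub>R n) z" by (simp add: dist_norm)
qed

text \<open>The half-space beyond the hyperplane through \<^term>\<open>pr x\<close> orthogonal to \<^term>\<open>x - pr x\<close>.\<close>
definition beyond :: "'a \<Rightarrow> 'a set" where
  "beyond x = {w. 0 < (x - pr x) \<bullet> (w - pr x)}"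

lemma beyond_self: "x \<notin> K \<Longrightarrow> x \<in> beyond x"
  using pr_K[of x] by (auto simp: beyond_def)

lemma beyond_disjoint: "beyond x \<inter> K = {}"
  using pr_dot[of _ x] by (fastforce simp: beyond_def)

lemma convex_beyond: "convex (beyond x)"
proof -
  have "beyond x = {w. (x - pr x) \<bullet> pr x < (x - pr x) \<bullet> w}"
    by (auto simp: beyond_def inner_diff_right)
  then show ?thesis using convex_halfspace_gt[of "(x - pr x) \<bullet> pr x" "x - pr x"] by simp
qed

lemma segment_outside:
  assumes "y \<in> beyond x" "z \<in> beyond x" shows "closed_segment y z \<inter> K = {}"
  using closed_segment_subset[OF assms convex_beyond] beyond_disjoint[of x] by blast

text \<open>A point outside of \<open>K\<close> and within distance \<open>r\<close> of \<open>c\<close> can be joined outside of \<open>K\<close>, by a segment of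
  length comparable to \<open>r\<close>, to the half-space below the supporting hyperplane at \<open>c\<close>, or to one
  fixed point above it. The second alternative takes care of the places where \<open>K\<close> is thin near \<open>c\<close>.\<close>
lemma outside_dichotomy:
  assumes c: "c \<in> \<Omega>" and n: "norm n = 1" and r: "0 < r" and x: "x \<notin> K" "dist x c < r"
  shows "(\<exists>w. n \<bullet> (w - c) < 0 \<and> dist w c < 3 * r \<and> closed_segment x w \<inter> K = {})
    \<or> closed_segment x (c + (2 * r) *\<^sub>R n) \<inter> K = {}"
proof -
  define d where "d = norm (x - pr x)"
  have d: "d > 0" using x(1) pr_K[of x] by (auto simp: d_def)
  define m where "m = (1 / d) *\<^sub>R (x - pr x)"
  have m: "norm m = 1" using d by (simp add: m_def d_def)
  have bey: "w \<in> beyond x" if "0 < m \<bullet> (w - pr x)" for w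
    using that d by (simp add: beyond_def m_def zero_less_divide_iff)
  have cK: "c \<in> K" using c \<Omega>_eq by blast
  have "dist (pr x) c \<le> dist x c" using pr_lipschitz[of x c] pr_self[OF cK] by simp
  then have "m \<bullet> (pr x - c) < r"
    using norm_cauchy_schwarz[of m "pr x - c"] m x(2) by (simp add: dist_norm)
  then have suff: "w \<in> beyond x" if "r \<le> m \<bullet> (w - c)" for w
    using bey[of w] that by (simp add: inner_diff_right)
  note xb = beyond_self[OF x(1)]
  show ?thesis
  proof (cases "m \<bullet> n < 1 / 2")
    case True
    \<comment> \<open>Subtracting half of \<open>n\<close> from \<open>m\<close> leads below the supporting hyperplane at \<open>c\<close> and still to the
      height at least \<open>3 / 4\<close> with respect to \<open>m\<close>.\<close>
    define w where "w = c + (4 * r / 3) *\<^sub>R (m - (1 / 2) *\<^sub>R n)"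
    have mm: "m \<bullet> m = 1" "n \<bullet> n = 1" using m n by (simp_all add: norm_eq_1)
    have "n \<bullet> (w - c) = (4 * r / 3) * (m \<bullet> n - 1 / 2)"
      by (simp add: w_def inner_diff_right mm inner_commute)
    then have 1: "n \<bullet> (w - c) < 0" using mult_pos_neg[of "4 * r / 3" "m \<bullet> n - 1 / 2"] True r by simp
    have "norm (m - (1 / 2) *\<^sub>R n) \<le> norm m + norm ((1 / 2) *\<^sub>R n)" by (rule norm_triangle_ineq4)
    also have "\<dots> = 3 / 2" using m n by simp
    finally have "(4 * r / 3) * norm (m - (1 / 2) *\<^sub>R n) \<le> (4 * r / 3) * (3 / 2)"
      using r by (intro mult_left_mono) auto
    then have 2: "dist w c < 3 * r" using r by (simp add: w_def dist_norm)
    have "m \<bullet> (w - c) = (4 * r / 3) * (1 - (m \<bullet> n) / 2)" by (simp add: w_def inner_diff_right mm)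
    moreover have "(4 * r / 3) * (3 / 4) \<le> (4 * r / 3) * (1 - (m \<bullet> n) / 2)"
      using True r by (intro mult_left_mono) auto
    ultimately have "w \<in> beyond x" by (intro suff) simp
    then show ?thesis using 1 2 segment_outside[OF xb] by blast
  next
    case False
    then have "r * 1 \<le> r * (2 * (m \<bullet> n))" using r by (intro mult_left_mono) auto
    then have "c + (2 * r) *\<^sub>R n \<in> beyond x" by (intro suff) simp
    then show ?thesis using segment_outside[OF xb] by blast
  qed
qed

text \<open>The boundary is a Lipschitz graph near \<open>c\<close>: moving away from an interior point of \<open>U\<close> does not lead
  back to \<open>K\<close>, and leads below the supporting hyperplane after a short time.\<close>
lemma outside_near_boundary:
  assumes c: "c \<in> \<Omega>" and n: "\<And>y. y \<in> U \<Longrightarrow> 0 < n \<bullet> (y - c)" "norm n = 1" and r: "0 < r"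
  obtains \<eta> where "0 < \<eta>" "\<eta> \<le> r" "\<And>x. x \<notin> K \<Longrightarrow> dist x c < \<eta> \<Longrightarrow>
    \<exists>h. n \<bullet> (h - c) < 0 \<and> closed_segment x h \<subseteq> ball c r - K"
proof -
  obtain p where p: "p \<in> U" using nonempty_U by blast
  define w where "w = p - c"
  have nw: "0 < n \<bullet> w" using n(1)[OF p] by (simp add: w_def)
  obtain \<rho> where \<rho>: "\<rho> > 0" "ball p \<rho> \<subseteq> U" using open_U p openE by blast
  have w0: "norm w > 0" using nw by auto
  define s0 where "s0 = r / (2 * norm w)"
  have s0: "s0 > 0" "s0 * norm w = r / 2" using r w0 by (auto simp: s0_def)
  define \<eta> where "\<eta> = min \<rho> (min (r / 2) (s0 * (n \<bullet> w)))"
  have \<eta>: "\<eta> > 0" "\<eta> \<le> \<rho>" "\<eta> \<le> r / 2" "\<eta> \<le> s0 * (n \<bullet> w)"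
    using \<rho>(1) r s0 nw by (auto simp: \<eta>_def)
  show ?thesis
  proof (rule that[OF \<eta>(1)])
    show "\<eta> \<le> r" using \<eta>(3) r by simp
    fix x assume x: "x \<notin> K" "dist x c < \<eta>"
    have out: "x - s *\<^sub>R w \<in> ball c r - K" if s: "0 \<le> s" "s \<le> s0" for s
    proof
      have "dist (x - s *\<^sub>R w) c \<le> dist x c + s * norm w"
        using norm_triangle_ineq4[of "x - c" "s *\<^sub>R w"] s by (simp add: dist_norm algebra_simps)
      also have "\<dots> < r / 2 + r / 2"
        using x(2) \<eta>(3) mult_right_mono[OF s(2), of "norm w"] s0(2) by (intro add_less_le_mono) auto
      finally show "x - s *\<^sub>R w \<in> ball c r" by (simp add: dist_commute)
      show "x - s *\<^sub>R w \<notin> K"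
      proof
        assume a: "x - s *\<^sub>R w \<in> K"
        have "dist p (x + w) = dist x c" by (simp add: w_def dist_norm algebra_simps norm_minus_commute)
        then have "x + w \<in> ball p \<rho>" using x(2) \<eta>(2) by simp
        then have b: "x + w \<in> K" using \<rho>(2) U_subset_K by blast
        have l: "0 \<le> s / (1 + s)" "s / (1 + s) \<le> 1" using s by auto
        have "(1 - s / (1 + s)) *\<^sub>R (x - s *\<^sub>R w) + (s / (1 + s)) *\<^sub>R (x + w)
            = x + (s / (1 + s) - (1 - s / (1 + s)) * s) *\<^sub>R w" by (simp add: algebra_simps)
        also have "s / (1 + s) - (1 - s / (1 + s)) * s = 0" using s by (simp add: field_simps)
        finally have "x \<in> K" using convexD_alt[OF convex_K a b l] by simp
        then show False using x(1) by blast
      qed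
    qed
    have "closed_segment x (x - s0 *\<^sub>R w) \<subseteq> ball c r - K"
    proof
      fix y assume "y \<in> closed_segment x (x - s0 *\<^sub>R w)"
      then obtain a where a: "0 \<le> a" "a \<le> 1" "y = (1 - a) *\<^sub>R x + a *\<^sub>R (x - s0 *\<^sub>R w)"
        by (auto simp: in_segment)
      then have y: "y = x - (a * s0) *\<^sub>R w" by (simp add: algebra_simps)
      show "y \<in> ball c r - K" unfolding y
        by (rule out) (use a s0 in \<open>auto simp: mult_left_le_one_le\<close>)
    qed
    moreover have "n \<bullet> (x - s0 *\<^sub>R w - c) < 0"
    proof -
      have "n \<bullet> (x - c) \<le> dist x c" using norm_cauchy_schwarz[of n "x - c"] n(2) by (simp add: dist_norm)
      then show ?thesis using x(2) \<eta>(4) by (simp add: inner_diff_right)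
    qed
    ultimately show "\<exists>h. n \<bullet> (h - c) < 0 \<and> closed_segment x h \<subseteq> ball c r - K" by blast
  qed
qed

subsection \<open>The boundary is connected\<close>

lemma beyond_meets:
  assumes x: "x \<notin> K" and y: "y \<notin> K" and ne: "sgn (x - pr x) \<noteq> - sgn (y - pr y)"
  shows "beyond x \<inter> beyond y \<noteq> {}"
proof -
  define a where "a = x - pr x"
  define b where "b = y - pr y"
  have ab: "a \<noteq> 0" "b \<noteq> 0" using x y pr_K[of x] pr_K[of y] by (auto simp: a_def b_def)
  define u where "u = sgn a"
  define v where "v = sgn b"
  have uv: "u \<bullet> u = 1" "v \<bullet> v = 1" using ab by (simp_all add: u_def v_def norm_sgn norm_eq_1[symmetric])
  have au: "a = norm a *\<^sub>R u" "b = norm b *\<^sub>R v" using ab by (simp_all add: u_def v_def sgn_div_norm)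
  have "u + v \<noteq> 0" using ne by (auto simp: u_def v_def a_def b_def add_eq_0_iff)
  then have "0 < (u + v) \<bullet> (u + v)" by simp
  then have p: "0 < 1 + u \<bullet> v" using uv by (simp add: inner_add inner_commute)
  define t where "t = (\<bar>u \<bullet> pr x\<bar> + \<bar>v \<bullet> pr y\<bar> + 1) / (1 + u \<bullet> v)"
  have t: "t * (1 + u \<bullet> v) = \<bar>u \<bullet> pr x\<bar> + \<bar>v \<bullet> pr y\<bar> + 1" using p by (simp add: t_def)
  have "u \<bullet> (t *\<^sub>R (u + v)) = t * (1 + u \<bullet> v)" "v \<bullet> (t *\<^sub>R (u + v)) = t * (1 + u \<bullet> v)"
    using uv by (simp_all add: inner_add_right inner_commute)
  then have "0 < u \<bullet> (t *\<^sub>R (u + v) - pr x)" "0 < v \<bullet> (t *\<^sub>R (u + v) - pr y)"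
    using t by (simp_all add: inner_diff_right)
  then have "0 < a \<bullet> (t *\<^sub>R (u + v) - pr x)" "0 < b \<bullet> (t *\<^sub>R (u + v) - pr y)"
    using ab by (subst au, simp)+
  then have "t *\<^sub>R (u + v) \<in> beyond x \<inter> beyond y" by (simp add: beyond_def a_def b_def)
  then show ?thesis by blast
qed

text \<open>If all outer normals were parallel to one line, then the boundary would contain a segment of a
  supporting hyperplane, against strict convexity.\<close>
lemma beyond_third:
  assumes x: "x \<notin> K"
  obtains z where "z \<notin> K" "sgn (z - pr z) \<noteq> sgn (x - pr x)" "sgn (z - pr z) \<noteq> - sgn (x - pr x)"
proof -
  define m where "m = sgn (x - pr x)"
  have ne: "x - pr x \<noteq> 0" using x pr_K[of x] by auto
  have m: "m \<bullet> m = 1" using ne by (simp add: m_def norm_sgn norm_eq_1[symmetric])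
  define p where "p = pr x"
  have pK: "p \<in> K" by (simp add: p_def pr_K)
  have mK: "m \<bullet> (y - p) \<le> 0" if "y \<in> K" for y
    using mult_nonneg_nonpos[OF _ pr_dot[OF that, of x], of "inverse (norm (x - pr x))"]
    by (simp add: m_def p_def sgn_div_norm)
  obtain e where e: "e \<noteq> 0" "m \<bullet> e = 0" using orthogonal_to_vector_exists[OF dim, of m] by (auto simp: orthogonal_def)
  \<comment> \<open>If \<open>m\<close> were the normal at the projection of \<open>z\<close>, then this projection would be \<open>p + e\<close>, in the same
    supporting hyperplane as \<open>p\<close>.\<close>
  define z where "z = p + m + e"
  have zp: "m \<bullet> (z - p) = 1" using m e by (simp add: z_def inner_add_right)
  then have z: "z \<notin> K" using mK by force
  define l where "l = norm (z - pr z)"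
  have l: "l > 0" using z pr_K[of z] by (auto simp: l_def)
  have zl: "z - pr z = l *\<^sub>R sgn (z - pr z)" using l by (simp add: l_def sgn_div_norm)
  have up: "sgn (z - pr z) \<noteq> m"
  proof
    assume s: "sgn (z - pr z) = m"
    then have q: "pr z = p + (1 - l) *\<^sub>R m + e" using zl by (simp add: z_def algebra_simps)
    have "m \<bullet> (pr z - p) \<le> 0" by (rule mK[OF pr_K])
    then have 1: "1 \<le> l" using q m e by (simp add: inner_add_right)
    have "(z - pr z) \<bullet> (p - pr z) \<le> 0" by (rule pr_dot[OF pK])
    moreover have "(z - pr z) \<bullet> (p - pr z) = l * (l - 1)"
    proof -
      have "z - pr z = l *\<^sub>R m" using zl s by simp
      moreover have "p - pr z = (l - 1) *\<^sub>R m - e" using q by (simp add: algebra_simps)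
      ultimately show ?thesis using m e by (simp add: inner_diff_right)
    qed
    ultimately have "l = 1" using 1 l by (simp add: mult_le_0_iff)
    then have q': "pr z = p + e" using q by simp
    then have "open_segment p (pr z) \<subseteq> U" using chord_subset[OF pK pr_K, of z] e by simp
    moreover have "midpoint p (pr z) \<in> open_segment p (pr z)" using q' e by simp
    ultimately have U: "midpoint p (pr z) \<in> U" by blast
    then obtain \<epsilon> where \<epsilon>: "\<epsilon> > 0" "cball (midpoint p (pr z)) \<epsilon> \<subseteq> U" using open_U open_contains_cball by blast
    have "norm m = 1" using m by (simp add: norm_eq_1)
    then have "midpoint p (pr z) + \<epsilon> *\<^sub>R m \<in> U" using \<epsilon> by (intro subsetD[OF \<epsilon>(2)]) (simp add: dist_norm)
    then have neg: "m \<bullet> (midpoint p (pr z) + \<epsilon> *\<^sub>R m - p) \<le> 0" using mK U_subset_K by blast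
    have "midpoint p (pr z) - p = (1 / 2) *\<^sub>R e"
      using q' by (simp add: midpoint_def algebra_simps flip: scaleR_add_left)
    then have eq: "midpoint p (pr z) + \<epsilon> *\<^sub>R m - p = (1 / 2) *\<^sub>R e + \<epsilon> *\<^sub>R m"
      by (simp add: diff_add_eq)
    have "m \<bullet> (midpoint p (pr z) + \<epsilon> *\<^sub>R m - p) = \<epsilon>"
      unfolding eq using m e by (simp add: inner_add_right)
    then show False using neg \<epsilon> by simp
  qed
  moreover have "sgn (z - pr z) \<noteq> - m"
  proof
    assume "sgn (z - pr z) = - m"
    then have eq: "z - p = (pr z - p) - l *\<^sub>R m" using zl by (simp add: algebra_simps)
    have "m \<bullet> (z - p) = m \<bullet> (pr z - p) - l"
      unfolding eq using m by (simp add: inner_diff_right[of m "pr z - p"])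
    then show False using zp mK[OF pr_K[of z]] l by simp
  qed
  ultimately show ?thesis using that[OF z] by (simp add: m_def)
qed

text \<open>The outside of \<open>K\<close> is a union of half-spaces. Two of them meet unless their normals are opposite,
  and in that case a third one meets both.\<close>
lemma connected_outside: "connected (- K)"
proof -
  have step: "connected_component (- K) x y"
    if xy: "x \<notin> K" "y \<notin> K" "sgn (x - pr x) \<noteq> - sgn (y - pr y)" for x y
  proof -
    obtain w where w: "w \<in> beyond x" "w \<in> beyond y" using beyond_meets[OF xy] by blast
    have c: "connected (beyond q)" "beyond q \<subseteq> - K" for q
      using convex_connected[OF convex_beyond] beyond_disjoint[of q] by auto
    have "connected_component (- K) x w" "connected_component (- K) w y"
      using c w beyond_self[OF xy(1)] beyond_self[OF xy(2)] unfolding connected_component_def by blast+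
    then show ?thesis by (rule connected_component_trans)
  qed
  have "connected_component (- K) x y" if xy: "x \<notin> K" "y \<notin> K" for x y
  proof (cases "sgn (x - pr x) = - sgn (y - pr y)")
    case False then show ?thesis using step xy by blast
  next
    case True
    obtain z where z: "z \<notin> K" "sgn (z - pr z) \<noteq> sgn (x - pr x)" "sgn (z - pr z) \<noteq> - sgn (x - pr x)"
      by (rule beyond_third[OF xy(1)]) blast
    have "connected_component (- K) x z" by (rule step[OF xy(1) z(1)]) (use z(3) in auto)
    moreover have "connected_component (- K) z y" by (rule step[OF z(1) xy(2)]) (use z(2) True in auto)
    ultimately show ?thesis by (rule connected_component_trans)
  qed
  then show ?thesis by (auto simp: connected_iff_connected_component)
qed

lemma pr_outside: "pr ` (- K) = \<Omega>"
proof
  show "pr ` (- K) \<subseteq> \<Omega>" using pr_\<Omega> U_subset_K by blast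
  show "\<Omega> \<subseteq> pr ` (- K)"
  proof
    fix c assume c: "c \<in> \<Omega>"
    obtain n where n: "norm n = 1" "\<And>y. y \<in> K \<Longrightarrow> 0 \<le> n \<bullet> (y - c)"
      by (rule supporting_normal[OF c]) blast
    have "pr (c - 1 *\<^sub>R n) = c" using c n(2) \<Omega>_eq by (intro pr_normal) auto
    moreover have "c - n \<notin> K"
    proof
      assume "c - n \<in> K"
      from n(2)[OF this] show False using n(1) by (simp add: norm_eq_1)
    qed
    ultimately show "c \<in> pr ` (- K)" by (metis ComplI image_eqI scaleR_one)
  qed
qed

lemma continuous_pr: "continuous_on S pr"
  by (rule continuous_on_closest_point[OF convex_K closed_K nonempty_K])

lemma connected_\<Omega>: "connected \<Omega>"
  using connected_continuous_image[OF continuous_pr connected_outside] by (simp add: pr_outside)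

end

section \<open>Boundary points with a rigid chart\<close>

context domain
begin

text \<open>An almost minimal curve between points close to \<open>X\<close> and \<open>Y\<close> passes through an almost midpoint.\<close>
lemma approximate_midpoint:
  assumes X: "X \<in> C" and Y: "Y \<in> C" and e: "0 < e"
  obtains x where "x \<in> V" "\<bar>D (emb x) X - D X Y / 2\<bar> < e" "\<bar>D (emb x) Y - D X Y / 2\<bar> < e"
proof -
  define a where "a = e / 5"
  have a: "0 < a" using e by (simp add: a_def)
  obtain p where p: "p \<in> V" "D (emb p) X < a" by (rule emb_dense[OF X a])
  obtain q where q: "q \<in> V" "D (emb q) Y < a" by (rule emb_dense[OF Y a])
  note pC = emb_C[OF p(1)] and qC = emb_C[OF q(1)]
  obtain g where g: "path g" "path_image g \<subseteq> V" "pathstart g = p" "pathfinish g = q"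
    "\<And>t. t \<in> {0..1} \<Longrightarrow> D (emb p) (emb (g t)) + D (emb (g t)) (emb q) < D (emb p) (emb q) + a"
    by (rule near_minimal_path_emb[OF p(1) q(1) a]) blast
  have im: "g ` {0..1} \<subseteq> V" using g(2) by (simp add: path_image_def)
  have "\<exists>t\<ge>0. t \<le> 1 \<and> D (emb (g t)) (emb p) = D (emb p) (emb q) / 2"
  proof (rule IVT')
    show "D (emb (g 0)) (emb p) \<le> D (emb p) (emb q) / 2"
      using g(3) D_refl[OF pC] D_nonneg[OF pC qC] by (simp add: pathstart_def)
    show "D (emb p) (emb q) / 2 \<le> D (emb (g 1)) (emb p)"
      using g(4) D_commute[OF pC qC] D_nonneg[OF pC qC] by (simp add: pathfinish_def)
    show "continuous_on {0..1} (\<lambda>t. D (emb (g t)) (emb p))"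
      by (rule continuous_on_compose2[OF continuous_on_D[OF pC] g(1)[unfolded path_def] im])
  qed simp
  then obtain t where t: "t \<in> {0..1}" "D (emb (g t)) (emb p) = D (emb p) (emb q) / 2" by auto
  have gV: "g t \<in> V" using im t(1) by blast
  note gC = emb_C[OF gV]
  have L: "\<bar>D (emb p) (emb q) - D X Y\<bar> \<le> 2 * a"
    using D_diff_le[OF pC X qC] D_diff_le[OF qC Y X] D_commute[OF X qC] D_commute[OF X Y] p(2) q(2) by linarith
  have gq: "D (emb (g t)) (emb q) < D (emb p) (emb q) / 2 + a" "D (emb p) (emb q) / 2 \<le> D (emb (g t)) (emb q)"
    using g(5)[OF t(1)] t(2) D_commute[OF pC gC] D_triangle[OF pC gC qC] by linarith+
  show ?thesis
  proof (rule that[OF gV])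
    show "\<bar>D (emb (g t)) X - D X Y / 2\<bar> < e"
      using D_diff_le[OF pC X gC] D_commute[OF pC gC] D_commute[OF X gC] L t(2) p(2) a unfolding a_def by linarith
    show "\<bar>D (emb (g t)) Y - D X Y / 2\<bar> < e"
      using D_diff_le[OF qC Y gC] D_commute[OF qC gC] D_commute[OF Y gC] L gq q(2) a unfolding a_def by linarith
  qed
qed

end

locale boundary_isometry = strictly_convex U + domain V
  for U V :: "'a::euclidean_space set" +
  fixes F :: "'a \<Rightarrow> (nat \<Rightarrow> 'a) set"
  assumes bij_F: "bij_betw F (frontier U) (hausdorff_boundary V)"
    and local_isometry: "\<And>y. y \<in> frontier U \<Longrightarrow> \<exists>\<epsilon>>0. \<forall>a\<in>frontier U \<inter> ball y \<epsilon>. \<forall>b\<in>frontier U \<inter> ball y \<epsilon>.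
      relative_dist V (F a) (F b) = dist a b"
begin

lemma F_H: "y \<in> \<Omega> \<Longrightarrow> F y \<in> H"
  using bij_F by (auto simp: bij_betw_def)

lemma F_C: "y \<in> \<Omega> \<Longrightarrow> F y \<in> C"
  using F_H H_C by blast

lemma F_eq_iff: "x \<in> \<Omega> \<Longrightarrow> y \<in> \<Omega> \<Longrightarrow> F x = F y \<longleftrightarrow> x = y"
  by (rule inj_on_eq_iff[OF bij_betw_imp_inj_on[OF bij_F]])

lemma F_surj: assumes "X \<in> H" obtains y where "y \<in> \<Omega>" "F y = X"
proof -
  have "X \<in> F ` \<Omega>" using assms bij_betw_imp_surj_on[OF bij_F] by simp
  then show ?thesis using that by blast
qed

lemma foot_F_notin: "y \<in> \<Omega> \<Longrightarrow> foot (F y) \<notin> V"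
  using F_H H_eq by blast

lemma continuous_on_D_F: assumes Z: "Z \<in> C" shows "continuous_on \<Omega> (\<lambda>y. D (F y) Z)"
proof (rule continuous_on_if_locally_nonexpansive)
  fix y assume y: "y \<in> \<Omega>"
  obtain \<epsilon> where \<epsilon>: "\<epsilon> > 0" "\<And>a b. a \<in> \<Omega> \<inter> ball y \<epsilon> \<Longrightarrow> b \<in> \<Omega> \<inter> ball y \<epsilon> \<Longrightarrow> D (F a) (F b) = dist a b"
    using local_isometry[OF y] by blast
  have "\<bar>D (F z) Z - D (F y) Z\<bar> \<le> dist z y" if z: "z \<in> \<Omega> \<inter> ball y \<epsilon>" for z
    using D_diff_le[OF F_C[of z] F_C[OF y] Z] \<epsilon>(2)[OF z, of y] z y \<epsilon>(1) by simp
  then show "\<exists>r>0. \<forall>z\<in>\<Omega> \<inter> ball y r. \<bar>D (F z) Z - D (F y) Z\<bar> \<le> dist z y" using \<epsilon>(1) by blast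
qed

lemma F_away_from_compact:
  assumes S: "compact S" "S \<subseteq> \<Omega>" and X: "X \<in> C" "X \<notin> F ` S"
  obtains \<delta> where "0 < \<delta>" "\<And>y. y \<in> S \<Longrightarrow> \<delta> \<le> D (F y) X"
proof (cases "S = {}")
  case True then show ?thesis using that[of 1] by simp
next
  case False
  obtain z where z: "z \<in> S" "\<forall>y\<in>S. D (F z) X \<le> D (F y) X"
    using continuous_attains_inf[OF S(1) False continuous_on_subset[OF continuous_on_D_F[OF X(1)] S(2)]] by blast
  then have zC: "F z \<in> C" using S(2) F_C by blast
  have "F z \<noteq> X" using X(2) z(1) by blast
  then have "0 < D (F z) X" using D_nonneg[OF zC X(1)] D_zero[OF zC X(1)] by linarith
  then show ?thesis using that z(2) by blast
qed

text \<open>The inverse of \<open>F\<close> is not assumed to be continuous. At the following points it is, because its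
  values near \<open>F c\<close> stay in a compact set.\<close>
definition good :: "'a \<Rightarrow> bool" where
  "good c \<longleftrightarrow> c \<in> \<Omega> \<and> (\<exists>\<delta>>0. \<exists>B. \<forall>y\<in>\<Omega>. D (F y) (F c) < \<delta> \<longrightarrow> norm y \<le> B)"

lemma good_inverse_continuous:
  assumes c: "good c" and \<epsilon>: "0 < \<epsilon>"
  obtains \<delta> where "0 < \<delta>" "\<And>y. y \<in> \<Omega> \<Longrightarrow> D (F y) (F c) < \<delta> \<Longrightarrow> dist y c < \<epsilon>"
proof -
  obtain \<delta> B where B: "\<delta> > 0" "\<And>y. y \<in> \<Omega> \<Longrightarrow> D (F y) (F c) < \<delta> \<Longrightarrow> norm y \<le> B" and cO: "c \<in> \<Omega>"
    using c unfolding good_def by blast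
  define S where "S = (\<Omega> - ball c \<epsilon>) \<inter> cball 0 B"
  have "compact S" unfolding S_def
    by (intro closed_Int_compact closed_Diff frontier_closed open_ball compact_cball)
  moreover have "S \<subseteq> \<Omega>" by (auto simp: S_def)
  moreover have "F c \<notin> F ` S" using F_eq_iff cO \<epsilon> by (auto simp: S_def)
  ultimately obtain \<delta>' where \<delta>': "0 < \<delta>'" "\<And>y. y \<in> S \<Longrightarrow> \<delta>' \<le> D (F y) (F c)"
    using F_away_from_compact F_C[OF cO] by metis
  show ?thesis
  proof (rule that[of "min \<delta> \<delta>'"])
    show "0 < min \<delta> \<delta>'" using B(1) \<delta>'(1) by simp
    fix y assume y: "y \<in> \<Omega>" "D (F y) (F c) < min \<delta> \<delta>'"
    then have "y \<notin> S" using \<delta>'(2)[of y] by auto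
    then show "dist y c < \<epsilon>" using B(2)[OF y(1)] y by (auto simp: S_def dist_commute)
  qed
qed

lemma between_boundary_points:
  assumes "a \<in> \<Omega>" "b \<in> \<Omega>" "y \<in> \<Omega>" "a \<noteq> b" and d: "dist a y + dist y b = dist a b"
  shows "y = a \<or> y = b"
proof (rule ccontr)
  assume n: "\<not> (y = a \<or> y = b)"
  have "between (a, b) y" using d by (simp add: between)
  then have "y \<in> open_segment a b" using n by (simp add: between_mem_segment open_segment_def)
  then show False using chord_subset[of a b] assms \<Omega>_eq by blast
qed

text \<open>Near a good point, the midpoint between two boundary points exists inside \<open>V\<close>. By strict convexity
  no boundary point of \<open>U\<close> is a midpoint of \<open>a\<close> and \<open>b\<close>, and by compactness the boundary points near \<open>c\<close>
  even keep a positive distance from being midpoints. So almost midpoints inside \<open>V\<close> keep away from the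
  boundary of \<open>V\<close> and have a limit inside \<open>V\<close>.\<close>
lemma midpoint_inside:
  assumes cO: "c \<in> \<Omega>" and \<delta>: "0 < \<delta>" "\<And>y. y \<in> \<Omega> \<Longrightarrow> D (F y) (F c) < \<delta> \<Longrightarrow> dist y c < \<epsilon>"
    and iso: "\<And>a b. a \<in> \<Omega> \<inter> ball c \<epsilon> \<Longrightarrow> b \<in> \<Omega> \<inter> ball c \<epsilon> \<Longrightarrow> D (F a) (F b) = dist a b"
    and a: "a \<in> \<Omega>" "dist a c < \<epsilon>" "dist a c < \<delta> / 6" and b: "b \<in> \<Omega>" "dist b c < \<epsilon>" "dist b c < \<delta> / 6"
    and ab: "a \<noteq> b"
  obtains x where "x \<in> V" "D (emb x) (F a) = dist a b / 2" "D (emb x) (F b) = dist a b / 2"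
proof -
  define L where "L = dist a b"
  have L: "0 < L" "L < \<delta> / 3" using ab dist_triangle2[of a b c] a(3) b(3) by (auto simp: L_def)
  have eps: "0 < \<epsilon>" using a(2) zero_le_dist[of a c] by linarith
  have inb: "a \<in> \<Omega> \<inter> ball c \<epsilon>" "b \<in> \<Omega> \<inter> ball c \<epsilon>" "c \<in> \<Omega> \<inter> ball c \<epsilon>"
    using a b cO eps by (auto simp: dist_commute)
  note aC = F_C[OF a(1)] and bC = F_C[OF b(1)] and cC = F_C[OF cO]
  have Dab: "D (F a) (F b) = L" "D (F a) (F c) = dist a c" using iso inb by (simp_all add: L_def)
  \<comment> \<open>How far the boundary points of \<open>U\<close> are from being midpoints of \<open>a\<close> and \<open>b\<close>.\<close>
  define f where "f y = \<bar>dist y a - L / 2\<bar> + \<bar>dist y b - L / 2\<bar>" for y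
  have fpos: "0 < f y" if y: "y \<in> \<Omega>" for y
  proof (rule ccontr)
    assume "\<not> 0 < f y"
    then have "dist y a = L / 2" "dist y b = L / 2" by (auto simp: f_def)
    then show False using between_boundary_points[of a b y] a(1) b(1) y ab L(1) by (auto simp: L_def dist_commute)
  qed
  have "compact (\<Omega> \<inter> cball c \<epsilon>)" by (rule closed_Int_compact[OF frontier_closed compact_cball])
  moreover have "\<Omega> \<inter> cball c \<epsilon> \<noteq> {}" using cO eps by auto
  moreover have "continuous_on (\<Omega> \<inter> cball c \<epsilon>) f" unfolding f_def by (intro continuous_intros)
  ultimately obtain z where z: "z \<in> \<Omega> \<inter> cball c \<epsilon>" "\<forall>y\<in>\<Omega> \<inter> cball c \<epsilon>. f z \<le> f y"
    using continuous_attains_inf by meson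
  define r where "r = min (f z / 4) (\<delta> / 12)"
  have r: "0 < r" "r \<le> f z / 4" "r \<le> \<delta> / 12" using fpos z(1) \<delta>(1) by (auto simp: r_def)
  define e where "e n = min (inverse (real (Suc n))) r" for n
  have e: "0 < e n" "e n \<le> inverse (real (Suc n))" "e n \<le> r" for n using r(1) by (auto simp: e_def)
  have "\<exists>x. x \<in> V \<and> \<bar>D (emb x) (F a) - L / 2\<bar> < e n \<and> \<bar>D (emb x) (F b) - L / 2\<bar> < e n" for n
    by (rule approximate_midpoint[OF aC bC e(1)[of n]]) (use Dab in auto)
  then obtain x where x: "\<And>n. x n \<in> V" "\<And>n. \<bar>D (emb (x n)) (F a) - L / 2\<bar> < e n"
    "\<And>n. \<bar>D (emb (x n)) (F b) - L / 2\<bar> < e n" by metis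
  have ball: "ball (x n) r \<subseteq> V" for n
  proof (rule ccontr)
    assume no: "\<not> ?thesis"
    have "V \<noteq> UNIV" using foot_F_notin[OF cO] by blast
    then obtain Q s where Q: "Q \<in> H" "s > 0" "ball (x n) s \<subseteq> V" "D (emb (x n)) Q = s"
      using nearest_boundary_point[OF x(1)] by blast
    have sr: "s < r" using no Q(3) subset_ball[of r s "x n"] by (metis linorder_not_le order_trans)
    obtain y where y: "y \<in> \<Omega>" "F y = Q" by (rule F_surj[OF Q(1)])
    note yC = F_C[OF y(1)]
    have xy: "D (emb (x n)) (F y) < r" using sr Q(4) y(2) by simp
    have A: "\<bar>D (F y) (F a) - L / 2\<bar> < 2 * r"
      using D_diff_le[OF emb_C[OF x(1)[of n]] yC aC] x(2)[of n] e(3)[of n] xy by linarith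
    have A': "\<bar>D (F y) (F b) - L / 2\<bar> < 2 * r"
      using D_diff_le[OF emb_C[OF x(1)[of n]] yC bC] x(3)[of n] e(3)[of n] xy by linarith
    have "D (F y) (F c) < \<delta>"
      using D_triangle[OF yC aC cC] A r(3) L a(3) Dab(2) \<delta>(1) by linarith
    then have "dist y c < \<epsilon>" by (rule \<delta>(2)[OF y(1)])
    then have yb: "y \<in> \<Omega> \<inter> ball c \<epsilon>" "y \<in> \<Omega> \<inter> cball c \<epsilon>" using y(1) by (auto simp: dist_commute)
    have "f y < 4 * r" using A A' iso[OF yb(1) inb(1)] iso[OF yb(1) inb(2)] unfolding f_def by linarith
    moreover have "f z \<le> f y" using z(2) yb(2) by blast
    ultimately show False using r(2) by linarith
  qed
  have near_lim: "g \<longlonglongrightarrow> L / 2" if g: "\<And>n. \<bar>g n - L / 2\<bar> < e n" for g :: "nat \<Rightarrow> real"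
  proof -
    have "norm (g n - L / 2) \<le> inverse (real (Suc n))" for n using g[of n] e(2)[of n] by simp
    then have "(\<lambda>n. g n - L / 2) \<longlonglongrightarrow> 0"
      by (intro Lim_null_comparison[OF always_eventually LIMSEQ_inverse_real_of_nat]) blast
    then show ?thesis using LIM_zero_iff by blast
  qed
  note la = near_lim[OF x(2)] and lb = near_lim[OF x(3)]
  have "\<forall>n. x n \<in> cball (foot (F a)) \<delta>"
  proof
    fix n
    have "dist (x n) (foot (F a)) \<le> D (emb (x n)) (F a)"
      using dist_foot_le[OF emb_C[OF x(1)[of n]] aC] x(1)[of n] by simp
    then have "dist (x n) (foot (F a)) \<le> \<delta>" using x(2)[of n] e(3)[of n] r(3) L \<delta>(1) by linarith
    then show "x n \<in> cball (foot (F a)) \<delta>" by (simp add: dist_commute)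
  qed
  then obtain m q where q: "strict_mono (q :: nat \<Rightarrow> nat)" "(x \<circ> q) \<longlonglongrightarrow> m"
    using compact_cball[of "foot (F a)" \<delta>] by (meson compact_def)
  have "\<forall>\<^sub>F n in sequentially. dist ((x \<circ> q) n) m < r" using q(2) r(1) by (rule tendstoD)
  then obtain n where n: "dist (x (q n)) m < r"
    using eventually_happens'[OF sequentially_bot] by fastforce
  then have mV: "m \<in> V" using ball[of "q n"] by auto
  have lim: "(\<lambda>n. D (emb ((x \<circ> q) n)) Z) \<longlonglongrightarrow> D (emb m) Z" if Z: "Z \<in> C" for Z
    by (rule continuous_on_tendsto_compose[OF continuous_on_D[OF Z] q(2) mV]) (simp add: x(1))
  have "D (emb m) (F a) = L / 2"
    using LIMSEQ_unique[OF lim[OF aC]] LIMSEQ_subseq_LIMSEQ[OF la q(1)] by (simp add: comp_def)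
  moreover have "D (emb m) (F b) = L / 2"
    using LIMSEQ_unique[OF lim[OF bC]] LIMSEQ_subseq_LIMSEQ[OF lb q(1)] by (simp add: comp_def)
  ultimately show ?thesis using that[OF mV] by (simp add: L_def)
qed

text \<open>The lemma \<open>straight_connection\<close> applies to the midpoint just found: another boundary point between
  \<open>F a\<close> and \<open>F b\<close> would be \<open>F y\<close> with \<open>y\<close> on the boundary of \<open>U\<close> between \<open>a\<close> and \<open>b\<close>, which
  strict convexity excludes.\<close>
lemma straight_chords:
  assumes c: "good c"
  obtains \<eta> where "0 < \<eta>"
    "\<And>a b. a \<in> \<Omega> \<inter> ball c \<eta> \<Longrightarrow> b \<in> \<Omega> \<inter> ball c \<eta> \<Longrightarrow> dist (foot (F a)) (foot (F b)) = dist a b"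
    "\<And>a b z. a \<in> \<Omega> \<inter> ball c \<eta> \<Longrightarrow> b \<in> \<Omega> \<inter> ball c \<eta> \<Longrightarrow> z \<in> open_segment (foot (F a)) (foot (F b)) \<Longrightarrow>
       z \<in> V \<and> D (emb z) (F a) = dist z (foot (F a))"
proof -
  have cO: "c \<in> \<Omega>" using c by (simp add: good_def)
  obtain \<epsilon> where \<epsilon>: "\<epsilon> > 0" "\<And>a b. a \<in> \<Omega> \<inter> ball c \<epsilon> \<Longrightarrow> b \<in> \<Omega> \<inter> ball c \<epsilon> \<Longrightarrow> D (F a) (F b) = dist a b"
    using local_isometry[OF cO] by blast
  obtain \<delta> where \<delta>: "0 < \<delta>" "\<And>y. y \<in> \<Omega> \<Longrightarrow> D (F y) (F c) < \<delta> \<Longrightarrow> dist y c < \<epsilon>"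
    using good_inverse_continuous[OF c \<epsilon>(1)] by blast
  define \<eta> where "\<eta> = min \<epsilon> (\<delta> / 6)"
  have \<eta>: "0 < \<eta>" using \<epsilon>(1) \<delta>(1) by (simp add: \<eta>_def)
  have main: "dist (foot (F a)) (foot (F b)) = dist a b \<and>
      (\<forall>z\<in>open_segment (foot (F a)) (foot (F b)). z \<in> V \<and> D (emb z) (F a) = dist z (foot (F a)))"
    if ab: "a \<in> \<Omega> \<inter> ball c \<eta>" "b \<in> \<Omega> \<inter> ball c \<eta>" "a \<noteq> b" for a b
  proof -
    have aO: "a \<in> \<Omega>" "dist a c < \<epsilon>" "dist a c < \<delta> / 6" and bO: "b \<in> \<Omega>" "dist b c < \<epsilon>" "dist b c < \<delta> / 6"
      using ab by (auto simp: \<eta>_def dist_commute)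
    have inb: "a \<in> \<Omega> \<inter> ball c \<epsilon>" "b \<in> \<Omega> \<inter> ball c \<epsilon>" "c \<in> \<Omega> \<inter> ball c \<epsilon>"
      using aO bO cO \<epsilon>(1) by (auto simp: dist_commute)
    note aC = F_C[OF aO(1)] and bC = F_C[OF bO(1)] and cC = F_C[OF cO]
    define L where "L = dist a b"
    have L: "0 < L" using ab(3) by (simp add: L_def)
    have Dab: "D (F a) (F b) = L" "D (F a) (F c) = dist a c" using \<epsilon>(2) inb by (simp_all add: L_def)
    obtain x where x: "x \<in> V" "D (emb x) (F a) = L / 2" "D (emb x) (F b) = L / 2"
      using midpoint_inside[OF cO \<delta> \<epsilon>(2) aO bO ab(3)] unfolding L_def by blast
    have L3: "L < \<delta> / 3" using dist_triangle2[of a b c] aO(3) bO(3) by (auto simp: L_def)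
    have free: "Q = F a \<or> Q = F b" if Q: "Q \<in> H" "D (F a) Q + D Q (F b) = D (F a) (F b)" for Q
    proof -
      obtain y where y: "y \<in> \<Omega>" "F y = Q" by (rule F_surj[OF Q(1)])
      note yC = F_C[OF y(1)]
      have "D (F y) (F c) \<le> D (F y) (F a) + D (F a) (F c)" by (rule D_triangle[OF yC aC cC])
      also have "\<dots> < \<delta>"
        using Q(2) D_commute[OF yC aC] D_nonneg[OF yC bC] Dab L3 aO(3) \<delta>(1) y(2) by simp
      finally have "y \<in> \<Omega> \<inter> ball c \<epsilon>" using \<delta>(2)[OF y(1)] y(1) by (simp add: dist_commute)
      then have "D (F a) (F y) = dist a y" "D (F y) (F b) = dist y b" "D (F a) (F b) = dist a b"
        using \<epsilon>(2) inb(1,2) by blast+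
      then have "dist a y + dist y b = dist a b" using Q(2) y(2) by simp
      then have "y = a \<or> y = b" using between_boundary_points aO(1) bO(1) y(1) ab(3) by blast
      then show ?thesis using y(2) by blast
    qed
    obtain u where u: "norm u = 1" "foot (F a) = x - (L / 2) *\<^sub>R u" "foot (F b) = x + (L / 2) *\<^sub>R u"
      "ray_to x (F b) u (L / 2)" "ray_to x (F a) (- u) (L / 2)"
      using straight_connection[OF aC bC x(1) _ _ _ free] Dab(1) L x(2,3) by metis
    have seg: "z \<in> V \<and> D (emb z) (F a) = dist z (foot (F a))" if z: "z \<in> open_segment (foot (F a)) (foot (F b))" for z
    proof -
      obtain t where t: "0 < t" "t < 1" "z = (1 - t) *\<^sub>R foot (F a) + t *\<^sub>R foot (F b)"
        using z by (auto simp: in_segment)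
      define s where "s = t * L - L / 2"
      have "z = x + ((1 - t) * (- (L / 2)) + t * (L / 2)) *\<^sub>R u"
        by (simp add: t(3) u(2,3) algebra_simps)
      moreover have "(1 - t) * (- (L / 2)) + t * (L / 2) = s" by (simp add: s_def field_simps)
      ultimately have zs: "z = x + s *\<^sub>R u" by simp
      have "0 < t * L" "t * L < L" using t L by auto
      then have s: "- (L / 2) < s" "s < L / 2" unfolding s_def by linarith+
      have dz: "dist z (foot (F a)) = L / 2 + s"
      proof -
        have "z - foot (F a) = (L / 2 + s) *\<^sub>R u" by (simp add: zs u(2) algebra_simps)
        then show ?thesis using u(1) s by (simp add: dist_norm)
      qed
      show ?thesis
      proof (cases "0 \<le> s")
        case True
        have zV: "z \<in> V" and zb: "D (emb z) (F b) = L / 2 - s"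
          using u(4) True s x(3) by (auto simp: ray_to_def zs)
        note zC = emb_C[OF zV] and xC = emb_C[OF x(1)]
        have "closed_segment x z \<subseteq> V"
        proof
          fix w assume "w \<in> closed_segment x z"
          then obtain k where k: "0 \<le> k" "k \<le> 1" "w = (1 - k) *\<^sub>R x + k *\<^sub>R z" by (auto simp: in_segment)
          then have "w = x + (k * s) *\<^sub>R u" by (simp add: zs algebra_simps)
          moreover have "0 \<le> k * s" "k * s < L / 2" using k True s mult_left_le_one_le[of s k] by auto
          ultimately show "w \<in> V" using u(4) by (auto simp: ray_to_def)
        qed
        then have "D (emb x) (emb z) = s" using D_emb_segment u(1) True by (simp add: zs dist_norm)
        then have "D (emb z) (F a) = L / 2 + s"
          using D_triangle[OF zC xC aC] D_commute[OF zC xC] x(2) D_triangle[OF aC zC bC] D_commute[OF aC zC] zb Dab(1)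
          by linarith
        then show ?thesis using zV dz by simp
      next
        case False
        then have "z \<in> V \<and> D (emb z) (F a) = L / 2 - (- s)"
          using u(5) s x(2) unfolding ray_to_def zs by (metis (no_types, opaque_lifting) less_le_not_le minus_less_iff neg_0_le_iff_le nle_le scaleR_minus_left scaleR_minus_right minus_minus)
        then show ?thesis using dz by simp
      qed
    qed
    have "foot (F b) - foot (F a) = L *\<^sub>R u" by (simp add: u(2,3) algebra_simps flip: scaleR_add_left)
    then have "dist (foot (F b)) (foot (F a)) = L" using u(1) L by (simp add: dist_norm)
    then have "dist (foot (F a)) (foot (F b)) = dist a b"
      unfolding L_def by (subst dist_commute)
    then show ?thesis using seg by blast
  qed
  show ?thesis
  proof (rule that[OF \<eta>])
    fix a b assume ab: "a \<in> \<Omega> \<inter> ball c \<eta>" "b \<in> \<Omega> \<inter> ball c \<eta>"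
    show "dist (foot (F a)) (foot (F b)) = dist a b" using main[OF ab] by (cases "a = b") auto
    fix z assume "z \<in> open_segment (foot (F a)) (foot (F b))"
    then show "z \<in> V \<and> D (emb z) (F a) = dist z (foot (F a))" using main[OF ab] by (cases "a = b") auto
  qed
qed

text \<open>A chart at \<open>c\<close> describes the completed domain \<open>V\<close> near \<open>F c\<close>: the motion \<open>J\<close> places a piece of
  \<open>U\<close> into \<open>V\<close>, and the last clause says that \<open>F y\<close> is the boundary point that is approached from within
  this piece. Without it, \<open>F y\<close> could lie on another side of the Euclidean boundary.\<close>
definition chart :: "('a \<Rightarrow> 'a) \<Rightarrow> 'a \<Rightarrow> real \<Rightarrow> bool" where
  "chart J c \<eta> \<longleftrightarrow> rigid J \<and> c \<in> \<Omega> \<and> 0 < \<eta> \<and>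
     (\<forall>y\<in>\<Omega> \<inter> ball c \<eta>. foot (F y) = J y) \<and> (\<forall>x\<in>U \<inter> ball c \<eta>. J x \<in> V) \<and>
     (\<forall>y\<in>\<Omega> \<inter> ball c \<eta>. \<forall>x\<in>U \<inter> ball c \<eta>. D (emb (J x)) (F y) = dist x y)"

text \<open>By the previous lemma, \<^term>\<open>\<lambda>y. foot (F y)\<close> preserves distances near \<open>c\<close>, so it extends to a rigid
  motion, and this motion carries short chords into \<open>V\<close>. Such chords cover a piece of \<open>U\<close>.\<close>
lemma good_imp_chart:
  assumes c: "good c"
  obtains J \<eta> where "chart J c \<eta>"
proof -
  have cO: "c \<in> \<Omega>" using c by (simp add: good_def)
  obtain \<eta>0 where \<eta>0: "0 < \<eta>0"
    "\<And>a b. a \<in> \<Omega> \<inter> ball c \<eta>0 \<Longrightarrow> b \<in> \<Omega> \<inter> ball c \<eta>0 \<Longrightarrow> dist (foot (F a)) (foot (F b)) = dist a b"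
    "\<And>a b z. a \<in> \<Omega> \<inter> ball c \<eta>0 \<Longrightarrow> b \<in> \<Omega> \<inter> ball c \<eta>0 \<Longrightarrow> z \<in> open_segment (foot (F a)) (foot (F b)) \<Longrightarrow>
       z \<in> V \<and> D (emb z) (F a) = dist z (foot (F a))"
    using straight_chords[OF c] by blast
  have cS: "c \<in> \<Omega> \<inter> ball c \<eta>0" using cO \<eta>0(1) by simp
  obtain J where J: "rigid J" "\<And>y. y \<in> \<Omega> \<inter> ball c \<eta>0 \<Longrightarrow> J y = foot (F y)"
    using rigid_extension[OF cS affine_hull_boundary[OF cO \<eta>0(1)], of "\<lambda>y. foot (F y)"] \<eta>0(2) by blast
  have seg: "J z \<in> V \<and> D (emb (J z)) (F a) = dist z a"
    if "a \<in> \<Omega> \<inter> ball c \<eta>0" "b \<in> \<Omega> \<inter> ball c \<eta>0" "z \<in> open_segment a b" for a b z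
  proof -
    have "J z \<in> J ` closed_segment a b" using that(3) by (simp add: open_segment_def)
    then have "J z \<in> open_segment (J a) (J b)"
      using that(3) rigid_segment[OF J(1)] rigid_inj_iff[OF J(1)] by (auto simp: open_segment_def)
    moreover have "J a = foot (F a)" "J b = foot (F b)" using J(2) that(1,2) by blast+
    ultimately show ?thesis using \<eta>0(3)[OF that(1,2), of "J z"] rigid_dist[OF J(1), of z a] by simp
  qed
  obtain \<eta> where \<eta>: "0 < \<eta>" "\<eta> \<le> \<eta>0"
    "\<And>x. x \<in> U \<Longrightarrow> dist x c < \<eta> \<Longrightarrow> \<exists>a b. a \<in> \<Omega> \<and> b \<in> \<Omega> \<and> dist a c < \<eta>0 \<and> dist b c < \<eta>0 \<and> x \<in> open_segment a b"
    using short_chord[OF cO \<eta>0(1)] by blast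
  have chord: "\<exists>a b. a \<in> \<Omega> \<inter> ball c \<eta>0 \<and> b \<in> \<Omega> \<inter> ball c \<eta>0 \<and> x \<in> open_segment a b" if "x \<in> U \<inter> ball c \<eta>" for x
    using \<eta>(3)[of x] that by (auto simp: dist_commute)
  have JV: "J x \<in> V" if x: "x \<in> U \<inter> ball c \<eta>" for x
    using chord[OF x] seg by blast
  have dist_F: "D (emb (J x)) (F y) = dist x y" if y: "y \<in> \<Omega> \<inter> ball c \<eta>" and x: "x \<in> U \<inter> ball c \<eta>" for x y
  proof -
    have y0: "y \<in> \<Omega> \<inter> ball c \<eta>0" using y \<eta>(2) by auto
    note yC = F_C[of y] and xC = emb_C[OF JV[OF x]]
    obtain b where b: "b \<in> \<Omega> \<inter> ball c \<eta>0" "b \<noteq> y" using chord[OF x] by (metis ex_in_conv open_segment_idem)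
    have "\<bar>D (emb (J x)) (F y) - dist x y\<bar> \<le> 0 + e" if e: "0 < e" for e
    proof -
      define k where "k = norm (b - y)"
      have k: "k > 0" using b(2) by (simp add: k_def)
      define M where "M = min (e / 2) (\<eta> - dist c y)"
      have M: "0 < M" "M \<le> e / 2" "M \<le> \<eta> - dist c y" using e y by (auto simp: M_def min_def)
      define t where "t = min (1 / 2) (M / (2 * k))"
      have t: "0 < t" "t < 1" using M(1) k by (auto simp: t_def)
      have "t * k \<le> M / (2 * k) * k" using k by (intro mult_right_mono) (auto simp: t_def)
      also have "\<dots> = M / 2" using k by simp
      also have "\<dots> < M" using M(1) by simp
      finally have tk: "t * k < M" .
      define m where "m = y + t *\<^sub>R (b - y)"
      have mo: "m \<in> open_segment y b" unfolding in_segment using b(2) t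
        by (auto simp: m_def algebra_simps intro!: exI[of _ t])
      have dm: "dist m y = t * k" using t by (simp add: m_def dist_norm k_def)
      have mU: "m \<in> U \<inter> ball c \<eta>"
      proof
        show "m \<in> U" using chord_subset[of y b] y0 b mo \<Omega>_eq by blast
        show "m \<in> ball c \<eta>" using dist_triangle[of c m y] dm tk M(3) by (simp add: dist_commute)
      qed
      have 1: "D (emb (J m)) (F y) = dist m y" using seg[OF y0 b(1) mo] by blast
      have "closed_segment x m \<subseteq> U \<inter> ball c \<eta>"
        using x mU by (intro closed_segment_subset convex_Int convex_U convex_ball)
      then have "J ` closed_segment x m \<subseteq> V" using JV by (meson image_subsetI subsetD)
      then have "closed_segment (J x) (J m) \<subseteq> V" by (simp only: rigid_segment[OF J(1)])
      then have 2: "D (emb (J x)) (emb (J m)) = dist x m"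
        using D_emb_segment rigid_dist[OF J(1)] by simp
      have yC': "F y \<in> C" using y by (intro F_C) simp
      note mC = emb_C[OF JV[OF mU]]
      have 3: "\<bar>D (emb (J x)) (F y) - D (emb (J x)) (emb (J m))\<bar> \<le> dist m y"
        using D_triangle[OF xC mC yC'] D_triangle[OF xC yC' mC] D_commute[OF yC' mC] 1 by linarith
      have "\<bar>dist x m - dist x y\<bar> \<le> dist m y"
        using dist_triangle[of x y m] dist_triangle[of x m y] by (simp add: dist_commute)
      then show ?thesis using 2 3 dm tk M(2) by linarith
    qed
    then show ?thesis using field_le_epsilon[of "\<bar>D (emb (J x)) (F y) - dist x y\<bar>" 0] by simp
  qed
  have "chart J c \<eta>" unfolding chart_def
    using J cO \<eta>(1,2) JV dist_F by auto
  then show ?thesis by (rule that)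
qed

lemma chart_shift:
  assumes "chart J c \<eta>" "y \<in> \<Omega>" "dist c y < \<eta>"
  shows "chart J y (\<eta> - dist c y)"
proof -
  have "ball y (\<eta> - dist c y) \<subseteq> ball c \<eta>"
  proof
    fix x assume "x \<in> ball y (\<eta> - dist c y)"
    then show "x \<in> ball c \<eta>" using dist_triangle[of c x y] by simp
  qed
  then show ?thesis using assms unfolding chart_def by (auto simp: subset_iff)
qed

lemma chart_unique:
  assumes "chart J c \<eta>" "chart J' c' \<eta>'" and y: "y \<in> \<Omega>" "dist c y < \<eta>" "dist c' y < \<eta>'"
  shows "J = J'"
proof -
  define s where "s = min (\<eta> - dist c y) (\<eta>' - dist c' y)"
  have s: "0 < s" using y by (simp add: s_def)
  note ch = chart_shift[OF assms(1) y(1,2)] chart_shift[OF assms(2) y(1,3)]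
  show ?thesis
  proof (rule rigid_eqI)
    show "rigid J" "rigid J'" using assms by (auto simp: chart_def)
    show "y \<in> \<Omega> \<inter> ball y s" using y s by simp
    show "affine hull (\<Omega> \<inter> ball y s) = UNIV" by (rule affine_hull_boundary[OF y(1) s])
    show "J z = J' z" if z: "z \<in> \<Omega> \<inter> ball y s" for z
    proof -
      have "z \<in> \<Omega> \<inter> ball y (\<eta> - dist c y)" "z \<in> \<Omega> \<inter> ball y (\<eta>' - dist c' y)"
        using z by (auto simp: s_def)
      then have "foot (F z) = J z" "foot (F z) = J' z" using ch unfolding chart_def by blast+
      then show ?thesis by simp
    qed
  qed
qed

lemma chart_foot: "chart J c \<eta> \<Longrightarrow> foot (F c) = J c"
  by (simp add: chart_def)

end

section \<open>Every boundary point has a rigid chart\<close>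

context boundary_isometry
begin

text \<open>A segment outside of \<open>U\<close> projects to a curve in the boundary of \<open>U\<close> that is not longer, and \<open>F\<close>
  preserves the lengths of such curves.\<close>
lemma D_F_pr_le:
  assumes out: "closed_segment x y \<inter> U = {}"
  shows "D (F (pr x)) (F (pr y)) \<le> dist x y"
proof -
  define h where "h t = pr (x + t *\<^sub>R (y - x))" for t
  have hO: "h t \<in> \<Omega>" if t: "0 \<le> t" "t \<le> 1" for t
  proof -
    have "x + t *\<^sub>R (y - x) \<in> closed_segment x y"
      unfolding in_segment using t by (intro exI[of _ t]) (simp add: algebra_simps)
    then show ?thesis unfolding h_def using out by (intro pr_\<Omega>) auto
  qed
  have hd: "dist (h s) (h t) \<le> \<bar>t - s\<bar> * dist x y" for s t
  proof -
    have "dist (h s) (h t) \<le> dist (x + s *\<^sub>R (y - x)) (x + t *\<^sub>R (y - x))" unfolding h_def by (rule pr_lipschitz)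
    also have "\<dots> = norm ((s - t) *\<^sub>R (y - x))" by (simp add: dist_norm algebra_simps)
    also have "\<dots> = \<bar>t - s\<bar> * dist x y" by (simp add: dist_norm abs_minus_commute norm_minus_commute)
    finally show ?thesis .
  qed
  define P where "P s t \<longleftrightarrow> (0 \<le> s \<and> t \<le> 1 \<longrightarrow> D (F (h s)) (F (h t)) \<le> (t - s) * dist x y)" for s t
  have "P 0 1"
  proof (rule Bolzano)
    fix a b c assume trans: "P a b" "P b c" "a \<le> b" "b \<le> c"
    show "P a c"
      unfolding P_def
    proof
      assume ac: "0 \<le> a \<and> c \<le> 1"
      have O: "h a \<in> \<Omega>" "h b \<in> \<Omega>" "h c \<in> \<Omega>" using hO ac trans(3,4) by auto
      have "D (F (h a)) (F (h c)) \<le> D (F (h a)) (F (h b)) + D (F (h b)) (F (h c))"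
        by (rule D_triangle[OF F_C[OF O(1)] F_C[OF O(2)] F_C[OF O(3)]])
      also have "\<dots> \<le> (b - a) * dist x y + (c - b) * dist x y"
        using trans ac unfolding P_def by (intro add_mono) auto
      also have "\<dots> = (c - a) * dist x y" by (simp add: algebra_simps)
      finally show "D (F (h a)) (F (h c)) \<le> (c - a) * dist x y" .
    qed
  next
    fix t :: real assume local: "0 \<le> t" "t \<le> 1"
    obtain \<epsilon> where \<epsilon>: "\<epsilon> > 0" "\<And>a b. a \<in> \<Omega> \<inter> ball (h t) \<epsilon> \<Longrightarrow> b \<in> \<Omega> \<inter> ball (h t) \<epsilon> \<Longrightarrow> D (F a) (F b) = dist a b"
      using local_isometry[OF hO[OF local]] by blast
    define d where "d = \<epsilon> / (dist x y + 1)"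
    have d: "d > 0" using \<epsilon>(1) by (simp add: d_def add_nonneg_pos)
    have dxy: "d * dist x y < \<epsilon>"
    proof -
      have "dist x y + 1 \<noteq> 0" using zero_le_dist[of x y] by linarith
      then have "d * (dist x y + 1) = \<epsilon>" by (simp add: d_def)
      then show ?thesis using d by (simp add: algebra_simps)
    qed
    have "D (F (h a)) (F (h b)) \<le> (b - a) * dist x y"
      if ab: "a \<le> t" "t \<le> b" "b - a < d" "0 \<le> a" "b \<le> 1" for a b
    proof -
      have "dist (h t) (h s) < \<epsilon>" if "a \<le> s" "s \<le> b" for s
      proof -
        have "\<bar>s - t\<bar> * dist x y \<le> d * dist x y" using that ab by (intro mult_right_mono) auto
        then show ?thesis using hd[of t s] dxy by linarith
      qed
      then have "D (F (h a)) (F (h b)) = dist (h a) (h b)" using \<epsilon>(2) hO ab by simp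
      then show ?thesis using hd[of a b] ab by simp
    qed
    then show "\<exists>d>0. \<forall>a b. a \<le> t \<and> t \<le> b \<and> b - a < d \<longrightarrow> P a b"
      using d unfolding P_def by (intro exI[of _ d]) auto
  qed simp
  then show ?thesis by (simp add: h_def P_def)
qed

text \<open>The outside of \<open>U\<close> near a boundary point \<open>c\<close>: the part that can be reached, within distance \<open>r\<close> of
  \<open>c\<close>, from beyond the supporting hyperplane at \<open>c\<close> with normal \<open>n\<close>.\<close>
definition Ext :: "'a \<Rightarrow> 'a \<Rightarrow> real \<Rightarrow> 'a set" where
  "Ext c n r = connected_component_set (ball c r - K) (c - (r / 2) *\<^sub>R n)"

lemma chart_rigid: "chart J c \<eta> \<Longrightarrow> rigid J"
  by (simp add: chart_def)

text \<open>The bound \<open>13 * r\<close> is the one of the lemma \<open>D_F_pr_Ext\<close> below.\<close>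
definition good_near :: "'a \<Rightarrow> real \<Rightarrow> bool" where
  "good_near c r \<longleftrightarrow> (\<forall>y\<in>\<Omega>. dist y c < r \<and> D (F y) (F c) \<le> 13 * r \<longrightarrow> good y)"

lemma good_nearD: "good_near c r \<Longrightarrow> y \<in> \<Omega> \<Longrightarrow> dist y c < r \<Longrightarrow> D (F y) (F c) \<le> 13 * r \<Longrightarrow> good y"
  by (simp add: good_near_def)

definition supporting :: "'a \<Rightarrow> 'a \<Rightarrow> bool" where
  "supporting c n \<longleftrightarrow> c \<in> \<Omega> \<and> norm n = 1 \<and> (\<forall>y\<in>U. 0 < n \<bullet> (y - c)) \<and> (\<forall>y\<in>K. 0 \<le> n \<bullet> (y - c))"

lemma supportingD:
  assumes "supporting c n"
  shows "c \<in> \<Omega>" "c \<in> K" "norm n = 1" "n \<bullet> n = 1" "\<And>y. y \<in> U \<Longrightarrow> 0 < n \<bullet> (y - c)"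
    "\<And>y. y \<in> K \<Longrightarrow> 0 \<le> n \<bullet> (y - c)"
  using assms \<Omega>_eq by (auto simp: supporting_def norm_eq_1)

context
  fixes c n :: "'a" and r :: real assumes sup: "supporting c n" and r: "0 < r"
begin

lemma Ext_subset: "Ext c n r \<subseteq> ball c r - K"
  unfolding Ext_def by (rule connected_component_subset)

lemma open_Ext: "open (Ext c n r)"
  unfolding Ext_def by (intro open_connected_component open_Diff open_ball closed_K)

lemma connected_Ext: "connected (Ext c n r)"
  unfolding Ext_def by (rule connected_connected_component)

lemma Ext_absorbs:
  assumes "connected S" "S \<subseteq> ball c r - K" "S \<inter> Ext c n r \<noteq> {}"
  shows "S \<subseteq> Ext c n r"
proof -
  obtain x where x: "x \<in> S" "x \<in> Ext c n r" using assms(3) by blast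
  have "S \<subseteq> connected_component_set (ball c r - K) x"
    by (rule connected_component_maximal[OF x(1) assms(1,2)])
  also have "\<dots> = Ext c n r"
    using connected_component_eq x(2) unfolding Ext_def by metis
  finally show ?thesis .
qed

lemma lower_half_in_Ext: "{x. dist x c < r \<and> n \<bullet> (x - c) < 0} \<subseteq> Ext c n r"
proof (rule Ext_absorbs)
  let ?S = "{x. dist x c < r \<and> n \<bullet> (x - c) < 0}"
  have eq: "?S = ball c r \<inter> {x. n \<bullet> x < n \<bullet> c}" by (auto simp: dist_commute inner_diff_right)
  show "connected ?S" unfolding eq by (intro convex_connected convex_Int convex_ball convex_halfspace_lt)
  show sub: "?S \<subseteq> ball c r - K" using supportingD(6)[OF sup] by (force simp: dist_commute)
  have b: "c - (r / 2) *\<^sub>R n \<in> ?S" using r supportingD(3,4)[OF sup] by (simp add: dist_norm)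
  then have "c - (r / 2) *\<^sub>R n \<in> ball c r - K" using sub by blast
  then have "c - (r / 2) *\<^sub>R n \<in> Ext c n r"
    unfolding Ext_def by (simp add: connected_component_refl_eq)
  then show "?S \<inter> Ext c n r \<noteq> {}" using b by blast
qed

lemma outside_near_in_Ext:
  obtains \<eta> where "0 < \<eta>" "\<And>x. x \<notin> K \<Longrightarrow> dist x c < \<eta> \<Longrightarrow> x \<in> Ext c n r"
proof -
  obtain \<eta> where \<eta>: "0 < \<eta>" "\<eta> \<le> r" "\<And>x. x \<notin> K \<Longrightarrow> dist x c < \<eta> \<Longrightarrow>
      \<exists>h. n \<bullet> (h - c) < 0 \<and> closed_segment x h \<subseteq> ball c r - K"
    using outside_near_boundary[OF supportingD(1)[OF sup] supportingD(5)[OF sup] supportingD(3)[OF sup] r] by blast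
  show ?thesis
  proof (rule that[OF \<eta>(1)])
    fix x assume "x \<notin> K" "dist x c < \<eta>"
    then obtain h where h: "n \<bullet> (h - c) < 0" "closed_segment x h \<subseteq> ball c r - K" using \<eta>(3) by blast
    have "h \<in> ball c r" using h(2) ends_in_segment(2)[of h x] by blast
    then have "h \<in> Ext c n r" using h(1) lower_half_in_Ext by (auto simp: dist_commute)
    then have "closed_segment x h \<subseteq> Ext c n r"
      using h(2) by (intro Ext_absorbs connected_segment) auto
    then show "x \<in> Ext c n r" by auto
  qed
qed

lemma pr_Ext: "x \<in> Ext c n r \<Longrightarrow> pr x \<in> \<Omega> \<and> dist (pr x) c < r"
  using Ext_subset pr_\<Omega>[of x] U_subset_K pr_lipschitz[of x c] pr_self[OF supportingD(2)[OF sup]]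
  by (force simp: dist_commute)

text \<open>By the dichotomy for points outside of \<open>K\<close>, the points where this distance is at least \<open>7 * r\<close> can all be
  joined outside of \<open>K\<close> to the same point \<open>w0\<close>, so the values at two of them differ by less than
  \<open>6 * r\<close>. The set of all values is an interval that contains \<open>0\<close>.\<close>
lemma D_F_pr_Ext:
  assumes x: "x \<in> Ext c n r"
  shows "D (F (pr x)) (F c) \<le> 13 * r"
proof (rule ccontr)
  define \<sigma> where "\<sigma> x = D (F (pr x)) (F c)" for x
  assume "\<not> ?thesis"
  then have big: "13 * r < \<sigma> x" by (simp add: \<sigma>_def)
  note cO = supportingD(1)[OF sup]
  note cC = F_C[OF cO]
  have prc: "pr c = c" using pr_self[OF supportingD(2)[OF sup]] .
  have prC: "F (pr y) \<in> C" if "y \<notin> U" for y using F_C pr_\<Omega> that by blast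
  define w0 where "w0 = c + (2 * r) *\<^sub>R n"
  have far: "\<sigma> y < 7 * r \<or> closed_segment y w0 \<inter> K = {} \<and> dist y w0 < 3 * r" if y: "y \<in> Ext c n r" for y
  proof -
    have yK: "y \<notin> K" "dist y c < r" using y Ext_subset by (auto simp: dist_commute)
    have yU: "y \<notin> U" using yK U_subset_K by blast
    consider w where "n \<bullet> (w - c) < 0" "dist w c < 3 * r" "closed_segment y w \<inter> K = {}"
      | "closed_segment y w0 \<inter> K = {}"
      using outside_dichotomy[OF cO supportingD(3)[OF sup] r yK] unfolding w0_def by blast
    then show ?thesis
    proof cases
      case 1
      have wU: "w \<notin> U" using 1(1) supportingD(5)[OF sup, of w] by auto
      have "closed_segment w c \<inter> U = {}"
      proof -
        have "n \<bullet> (z - c) \<le> 0" if z: "z \<in> closed_segment w c" for z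
        proof -
          obtain a where a: "0 \<le> a" "a \<le> 1" "z = (1 - a) *\<^sub>R w + a *\<^sub>R c" using z by (auto simp: in_segment)
          then have "z - c = (1 - a) *\<^sub>R (w - c)" by (simp add: algebra_simps)
          then show ?thesis using a 1(1) by (simp add: mult_nonneg_nonpos)
        qed
        then show ?thesis using supportingD(5)[OF sup] by (meson disjoint_iff not_le)
      qed
      then have "D (F (pr w)) (F c) \<le> dist w c" using D_F_pr_le[of w c] prc by simp
      moreover have "D (F (pr y)) (F (pr w)) \<le> dist y w" using 1(3) U_subset_K by (intro D_F_pr_le) auto
      moreover have "dist y w \<le> dist y c + dist w c" by (rule dist_triangle2)
      ultimately show ?thesis
        using D_triangle[OF prC[OF yU] prC[OF wU] cC] 1(2) yK(2) unfolding \<sigma>_def by linarith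
    next
      case 2
      have "dist y w0 \<le> dist y c + dist w0 c" by (rule dist_triangle2)
      moreover have "dist w0 c = 2 * r" using r supportingD(3)[OF sup] by (simp add: w0_def dist_norm)
      ultimately show ?thesis using 2 yK(2) by simp
    qed
  qed
  have cont: "continuous_on (Ext c n r) \<sigma>"
  proof (rule continuous_on_if_locally_nonexpansive)
    fix y assume y: "y \<in> Ext c n r"
    then obtain \<rho> where \<rho>: "\<rho> > 0" "ball y \<rho> \<subseteq> Ext c n r" using open_Ext openE by blast
    have "\<bar>\<sigma> z - \<sigma> y\<bar> \<le> dist z y" if z: "z \<in> ball y \<rho>" for z
    proof -
      have "closed_segment z y \<subseteq> ball y \<rho>" using z \<rho>(1) by (intro closed_segment_subset convex_ball) auto
      then have s: "closed_segment z y \<inter> U = {}" using \<rho>(2) Ext_subset U_subset_K by blast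
      then have zy: "z \<notin> U" "y \<notin> U" by auto
      show ?thesis
        using D_diff_le[OF prC[OF zy(1)] prC[OF zy(2)] cC] D_F_pr_le[OF s] by (simp add: \<sigma>_def)
    qed
    then show "\<exists>\<rho>>0. \<forall>z\<in>Ext c n r \<inter> ball y \<rho>. \<bar>\<sigma> z - \<sigma> y\<bar> \<le> dist z y" using \<rho>(1) by blast
  qed
  have b: "c - (r / 2) *\<^sub>R n \<in> Ext c n r"
    using lower_half_in_Ext r supportingD(3,4)[OF sup] by (auto simp: dist_norm)
  have "pr (c - (r / 2) *\<^sub>R n) = c"
    using r by (intro pr_normal supportingD(2)[OF sup] supportingD(6)[OF sup]) auto
  then have s0: "\<sigma> (c - (r / 2) *\<^sub>R n) = 0" using D_refl[OF cC] by (simp add: \<sigma>_def)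
  have con: "connected (\<sigma> ` Ext c n r)" by (rule connected_continuous_image[OF cont connected_Ext])
  have "7 * r \<in> \<sigma> ` Ext c n r"
  proof (rule connectedD_interval[OF con])
    show "0 \<in> \<sigma> ` Ext c n r" using imageI[OF b, of \<sigma>] s0 by simp
    show "\<sigma> x \<in> \<sigma> ` Ext c n r" by (rule imageI[OF x])
    show "0 \<le> 7 * r" "7 * r \<le> \<sigma> x" using r big by linarith+
  qed
  then obtain y where y: "y \<in> Ext c n r" "7 * r = \<sigma> y" by (rule imageE)
  have fx: "closed_segment x w0 \<inter> K = {}" "dist x w0 < 3 * r" using far[OF x] big r by auto
  have fy: "closed_segment y w0 \<inter> K = {}" "dist y w0 < 3 * r" using far[OF y(1)] y(2) by auto
  have notU: "x \<notin> U" "y \<notin> U" "w0 \<notin> U" using fx(1) fy(1) U_subset_K by (auto simp: disjoint_iff)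
  have "D (F (pr x)) (F (pr w0)) \<le> dist x w0" "D (F (pr y)) (F (pr w0)) \<le> dist y w0"
    using fx(1) fy(1) U_subset_K by (auto intro!: D_F_pr_le)
  then have "\<bar>\<sigma> x - \<sigma> y\<bar> \<le> dist x w0 + dist y w0"
    unfolding \<sigma>_def
    using D_diff_le[OF prC[OF notU(1)] prC[OF notU(2)] cC] D_triangle[OF prC[OF notU(1)] prC[OF notU(3)] prC[OF notU(2)]]
      D_commute[OF prC[OF notU(2)] prC[OF notU(3)]] by linarith
  then show False using fx(2) fy(2) y(2) big by linarith
qed

context
  fixes J :: "'a \<Rightarrow> 'a" and \<eta>0 :: real
  assumes J: "chart J c \<eta>0"
    and all_good: "good_near c r"
begin

lemma rigid_J: "rigid J"
  by (rule chart_rigid[OF J])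

text \<open>Charts at neighbouring points have the same motion, and \<^term>\<open>Ext c n r\<close> is connected.\<close>
lemma chart_Ext:
  assumes x: "x \<in> Ext c n r"
  shows "\<exists>\<eta>. chart J (pr x) \<eta>"
proof -
  define b where "b = c - (r / 2) *\<^sub>R n"
  have b: "b \<in> Ext c n r"
    using lower_half_in_Ext r supportingD(3,4)[OF sup] by (auto simp: dist_norm b_def)
  have "pr b = c"
    unfolding b_def using r by (intro pr_normal supportingD(2)[OF sup] supportingD(6)[OF sup]) auto
  then have start: "\<exists>\<eta>. chart J (pr b) \<eta>" using J by auto
  show ?thesis
  proof (rule connected_induction_simple[where P = "\<lambda>x. \<exists>\<eta>. chart J (pr x) \<eta>", OF connected_Ext b x start])
    fix a assume a: "a \<in> Ext c n r"
    then have "good (pr a)" using good_nearD[OF all_good] pr_Ext D_F_pr_Ext by blast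
    then obtain J' \<eta> where J': "chart J' (pr a) \<eta>" by (rule good_imp_chart)
    then have \<eta>: "\<eta> > 0" by (simp add: chart_def)
    have near: "pr y \<in> \<Omega> \<and> dist (pr a) (pr y) < \<eta>" if "y \<in> Ext c n r \<inter> ball a \<eta>" for y
      using that pr_Ext pr_lipschitz[of a y] by force
    have step: "\<exists>\<eta>. chart J (pr z) \<eta>" if y: "y \<in> Ext c n r \<inter> ball a \<eta>" and z: "z \<in> Ext c n r \<inter> ball a \<eta>"
      and ch: "\<exists>\<eta>. chart J (pr y) \<eta>" for y z
    proof -
      obtain \<eta>2 where c2: "chart J (pr y) \<eta>2" using ch by blast
      then have "0 < \<eta>2" by (simp add: chart_def)
      then have "J = J'" using chart_unique[OF c2 J', of "pr y"] near[OF y] by simp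
      then show ?thesis using chart_shift[OF J'] near[OF z] by blast
    qed
    show "\<exists>T. openin (top_of_set (Ext c n r)) T \<and> a \<in> T \<and>
        (\<forall>x\<in>T. \<forall>y\<in>T. (\<exists>\<eta>. chart J (pr x) \<eta>) \<longrightarrow> (\<exists>\<eta>. chart J (pr y) \<eta>))"
    proof (intro exI[of _ "Ext c n r \<inter> ball a \<eta>"] conjI ballI impI)
      show "openin (top_of_set (Ext c n r)) (Ext c n r \<inter> ball a \<eta>)" by (simp add: openin_open_Int)
    qed (use a \<eta> in simp, rule step)
  qed
qed

text \<open>The frontier of a component of the open set \<^term>\<open>ball c r - K\<close> can meet the ball only in \<open>K\<close>, that is in
  the boundary of \<open>U\<close>. The properties of such a point follow from those of the projections of nearby
  points.\<close>
lemma frontier_Ext: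
  assumes y: "y \<in> frontier (Ext c n r)" "dist y c < r"
  shows "y \<in> \<Omega>" "D (F y) (F c) \<le> 13 * r" "\<exists>\<eta>. chart J y \<eta>"
proof -
  have yE: "y \<notin> Ext c n r" "y \<in> closure (Ext c n r)"
    using y(1) open_Ext by (auto simp: frontier_def interior_open)
  have yK: "y \<in> K"
  proof (rule ccontr)
    assume "y \<notin> K"
    then have "y \<in> ball c r - K" using y(2) by (simp add: dist_commute)
    then obtain \<rho> where \<rho>: "\<rho> > 0" "ball y \<rho> \<subseteq> ball c r - K"
      using openE[OF open_Diff[OF open_ball closed_K]] by metis
    have "ball y \<rho> \<inter> Ext c n r \<noteq> {}"
      using yE(2) \<rho>(1) closure_approachable[of y "Ext c n r"] by (force simp: dist_commute)
    then have "ball y \<rho> \<subseteq> Ext c n r" using \<rho>(2) by (intro Ext_absorbs) auto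
    moreover have "y \<in> ball y \<rho>" using \<rho>(1) by simp
    ultimately show False using yE(1) by blast
  qed
  have "U \<inter> Ext c n r = {}" using Ext_subset U_subset_K by blast
  then have "y \<notin> U" using open_Int_closure_eq_empty[OF open_U] yE(2) by blast
  then show yO: "y \<in> \<Omega>" using yK \<Omega>_eq by blast
  obtain x where x: "\<And>i. x i \<in> Ext c n r" "x \<longlonglongrightarrow> y" using yE(2) closure_sequential by blast
  have prO: "pr (x i) \<in> \<Omega>" for i using pr_Ext[OF x(1)] by blast
  have "(\<lambda>i. pr (x i)) \<longlonglongrightarrow> pr y"
    by (rule continuous_on_tendsto_compose[OF continuous_pr[of UNIV] x(2)]) auto
  then have lim: "(\<lambda>i. pr (x i)) \<longlonglongrightarrow> y" using pr_self[OF yK] by simp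
  have "(\<lambda>i. D (F (pr (x i))) (F c)) \<longlonglongrightarrow> D (F y) (F c)"
    by (rule continuous_on_tendsto_compose[OF continuous_on_D_F[OF F_C[OF supportingD(1)[OF sup]]] lim yO])
      (simp add: prO)
  then show le: "D (F y) (F c) \<le> 13 * r" by (rule LIMSEQ_le_const2) (use D_F_pr_Ext x(1) in blast)
  obtain J' \<eta> where J': "chart J' y \<eta>" using good_imp_chart[OF good_nearD[OF all_good yO y(2) le]] by blast
  then have \<eta>: "\<eta> > 0" by (simp add: chart_def)
  obtain i where i: "dist (pr (x i)) y < \<eta>"
    using tendstoD[OF lim \<eta>] eventually_happens'[OF sequentially_bot] by blast
  obtain \<eta>2 where c2: "chart J (pr (x i)) \<eta>2" using chart_Ext[OF x(1)] by blast
  then have "0 < \<eta>2" by (simp add: chart_def)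
  then have "J = J'" using chart_unique[OF c2 J' prO[of i]] i by (simp add: dist_commute)
  then show "\<exists>\<eta>. chart J y \<eta>" using J' by blast
qed

text \<open>The image of the frontier of \<^term>\<open>Ext c n r\<close> is a wall: it belongs to the boundary of \<open>V\<close>, so no
  curve inside \<open>V\<close> crosses it, and short curves that start on its inner side stay there.\<close>
lemma wall:
  assumes v: "v \<in> V" and d: "D (emb v) (F c) < r"
  shows "v \<notin> J ` Ext c n r"
proof
  assume vE: "v \<in> J ` Ext c n r"
  note cO = supportingD(1)[OF sup]
  note cC = F_C[OF cO]
  define e where "e = (r - D (emb v) (F c)) / 4"
  have e: "0 < e" "D (emb v) (F c) + 4 * e = r" using d by (simp_all add: e_def field_simps)
  have \<eta>0: "0 < \<eta>0" using J by (simp add: chart_def)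
  obtain u where u: "u \<in> U" "dist u c < min \<eta>0 e"
    using supportingD(2)[OF sup] closure_approachable[of c U] \<eta>0 e(1) by (metis min_less_iff_conj)
  have JuV: "J u \<in> V" and Jud: "D (emb (J u)) (F c) = dist u c"
    using J u cO \<eta>0 by (auto simp: chart_def dist_commute)
  obtain g where g: "path g" "path_image g \<subseteq> V" "pathstart g = J u" "pathfinish g = v"
    "\<And>t. t \<in> {0..1} \<Longrightarrow> D (emb (J u)) (emb (g t)) + D (emb (g t)) (emb v) < D (emb (J u)) (emb v) + e"
    by (rule near_minimal_path_emb[OF JuV v e(1)]) blast
  have close: "dist (inv J z) c < r" if z: "z \<in> path_image g" for z
  proof -
    obtain t where t: "t \<in> {0..1}" "z = g t" using z by (auto simp: path_image_def)
    have zV: "z \<in> V" using g(2) z by blast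
    note C3 = emb_C[OF JuV] emb_C[OF zV] emb_C[OF v]
    have "dist z (J c) \<le> D (emb z) (F c)"
      using dist_foot_le[OF C3(2) cC] foot_emb[OF zV] chart_foot[OF J] by simp
    also have "\<dots> \<le> D (emb z) (emb (J u)) + D (emb (J u)) (F c)" by (rule D_triangle[OF C3(2,1) cC])
    also have "\<dots> < D (emb v) (F c) + 4 * e"
    proof -
      have "D (emb (J u)) (emb z) + D (emb z) (emb v) < D (emb (J u)) (emb v) + e"
        using g(5)[OF t(1)] t(2) by simp
      moreover have "dist u c < e" using u(2) by simp
      ultimately show ?thesis
        using D_commute[OF C3(1,2)] D_nonneg[OF C3(2,3)] D_triangle[OF C3(1) cC C3(3)]
          D_commute[OF cC C3(3)] Jud e(1) by linarith
    qed
    finally have "dist z (J c) < r" using e(2) by simp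
    then show ?thesis
      using rigid_inv_dist[OF rigid_J, of z "J c"] inv_f_f[OF bij_is_inj[OF rigid_bij[OF rigid_J]]] by simp
  qed
  define S where "S = inv J ` path_image g"
  have "connected S" unfolding S_def
    by (intro connected_continuous_image rigid_inv_continuous[OF rigid_J] connected_path_image g(1))
  moreover have "S \<inter> Ext c n r \<noteq> {}"
    using vE rigid_in_image[OF rigid_J] g(4) unfolding S_def by (metis IntI empty_iff image_eqI pathfinish_in_path_image)
  moreover have "S - Ext c n r \<noteq> {}"
  proof -
    have "u \<in> S" unfolding S_def
      using g(3) inv_f_f[OF bij_is_inj[OF rigid_bij[OF rigid_J]], of u] by (metis image_eqI pathstart_in_path_image)
    then show ?thesis using u(1) Ext_subset U_subset_K by blast
  qed
  ultimately obtain y where y: "y \<in> S" "y \<in> frontier (Ext c n r)" using connected_Int_frontier by blast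
  obtain z where z: "z \<in> path_image g" "y = inv J z" using y(1) by (auto simp: S_def)
  have Jy: "J y = z" using z(2) rigid_bij[OF rigid_J] by (simp add: bij_is_surj surj_f_inv_f)
  have yc: "dist y c < r" using close[OF z(1)] z(2) by simp
  obtain \<eta> where ch: "chart J y \<eta>" using frontier_Ext(3)[OF y(2) yc] by blast
  have "foot (F y) = z" using chart_foot[OF ch] Jy by simp
  then show False using foot_F_notin[OF frontier_Ext(1)[OF y(2) yc]] g(2) z(1) by blast
qed

lemma open_image_Ext: "open (J ` Ext c n r)"
proof -
  have "J ` Ext c n r = inv J -` Ext c n r" using rigid_in_image[OF rigid_J] by blast
  then show ?thesis
    using open_vimage[OF open_Ext rigid_inv_continuous[OF rigid_J]] by simp
qed

lemma wall_completion:
  assumes X: "X \<in> C" and d: "D X (F c) < r"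
  shows "foot X \<notin> J ` Ext c n r"
proof
  assume "foot X \<in> J ` Ext c n r"
  then obtain \<rho> where \<rho>: "\<rho> > 0" "ball (foot X) \<rho> \<subseteq> J ` Ext c n r" using open_image_Ext openE by blast
  define e where "e = min \<rho> (r - D X (F c))"
  have e: "e > 0" using \<rho>(1) d by (simp add: e_def)
  obtain v where v: "v \<in> V" "D (emb v) X < e" by (rule emb_dense[OF X e])
  have "dist v (foot X) < \<rho>" using dist_foot_le[OF emb_C[OF v(1)] X] foot_emb[OF v(1)] v(2) by (simp add: e_def)
  then have "v \<in> J ` Ext c n r" using \<rho>(2) by (auto simp: dist_commute)
  moreover have "D (emb v) (F c) < r"
    using D_triangle[OF emb_C[OF v(1)] X F_C[OF supportingD(1)[OF sup]]] v(2) by (simp add: e_def)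
  ultimately show False using wall[OF v(1)] by blast
qed

lemma lower_half_image:
  assumes "dist z (J c) < r" "(J (c + n) - J c) \<bullet> (z - J c) < 0"
  shows "z \<in> J ` Ext c n r"
proof -
  obtain A where A: "orthogonal_transformation A" "linear A" "\<And>x y. J x = J y + A (x - y)"
    using rigidE[OF rigid_J] by blast
  obtain x where x: "z = J x" using rigid_bij[OF rigid_J] by (metis bij_pointE)
  have "J (c + n) - J c = A n" "z - J c = A (x - c)" using A(3)[of "c + n" c] A(3)[of x c] x by simp_all
  then have "n \<bullet> (x - c) < 0" using assms(2) A(1) by (simp add: orthogonal_transformation_def)
  moreover have "dist x c < r" using assms(1) rigid_dist[OF rigid_J] x by simp
  ultimately show ?thesis using lower_half_in_Ext x by blast
qed

end

end

text \<open>A wall cannot enter the region behind another wall whose base point is close to its own in the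
  completion of \<open>V\<close>. If the normals are almost the same, this forces the base point of the first wall onto
  the second one, with \<open>V\<close> on the same side, so that one point of \<open>H\<close> would have two preimages under \<open>F\<close>.\<close>
lemma no_two_walls:
  assumes sup: "supporting c1 n1" "supporting c2 n2" and r: "0 < r" and s: "s = r / 20"
    and ch: "chart J1 c1 \<eta>1" "chart J2 c2 \<eta>2"
    and good1: "good_near c1 r" and good2: "good_near c2 r"
    and near: "D (F c1) (F c2) < s / 8" and far: "s \<le> dist c1 c2"
    and normals: "1 / 2 < (J1 (c1 + n1) - J1 c1) \<bullet> (J2 (c2 + n2) - J2 c2)"
  shows False
proof -
  have s0: "0 < s" "s \<le> r" using r s by simp_all
  have good2': "good_near c2 s" using good2 s0(2) by (fastforce simp: good_near_def)
  define N1 where "N1 = J1 (c1 + n1) - J1 c1"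
  define N2 where "N2 = J2 (c2 + n2) - J2 c2"
  define p1 where "p1 = J1 c1"
  define p2 where "p2 = J2 c2"
  note r1 = chart_rigid[OF ch(1)] and r2 = chart_rigid[OF ch(2)]
  have n12: "norm N1 = 1" "norm N2 = 1"
    using rigid_dist[OF r1, of "c1 + n1" c1] rigid_dist[OF r2, of "c2 + n2" c2]
      supportingD(3)[OF sup(1)] supportingD(3)[OF sup(2)] by (simp_all add: N1_def N2_def dist_norm)
  have nn: "N1 \<bullet> N1 = 1" "N2 \<bullet> N2 = 1" using n12 by (simp_all add: norm_eq_1)
  note cO = supportingD(1)[OF sup(1)] supportingD(1)[OF sup(2)]
  note cC = F_C[OF cO(1)] F_C[OF cO(2)]
  have foots: "foot (F c1) = p1" "foot (F c2) = p2" using chart_foot[OF ch(1)] chart_foot[OF ch(2)] by (simp_all add: p1_def p2_def)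
  have p12: "dist p1 p2 < s / 8" using dist_foot_le[OF cC] near foots by simp
  define E1 where "E1 = Ext c1 n1 r"
  define E2 where "E2 = Ext c2 n2 s"
  note wall1 = wall_completion[OF sup(1) r ch(1) good1, folded E1_def]
  note wall2 = wall_completion[OF sup(2) s0(1) ch(2) good2', folded E2_def]
  note fr2 = frontier_Ext[OF sup(2) s0(1) ch(2) good2', folded E2_def]
  note low1 = lower_half_image[OF sup(1) r ch(1) good1, folded E1_def N1_def p1_def]
  note low2 = lower_half_image[OF sup(2) s0(1) ch(2) good2', folded E2_def N2_def p2_def]
  \<comment> \<open>A piece of the half-space below the first wall. The second wall cannot enter it, and its points below
    \<open>p2\<close> are behind the second wall, so all of it is behind the second wall.\<close>
  define Q where "Q = ball p1 r \<inter> ball p2 s \<inter> {z. N1 \<bullet> z < N1 \<bullet> p1}"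
  have Q1: "Q \<subseteq> J1 ` E1"
    by (auto simp: Q_def dist_commute inner_diff_right intro!: low1)
  have inv2: "inv J2 (J2 x) = x" "J2 (inv J2 x) = x" for x
    using rigid_bij[OF r2] by (simp_all add: bij_is_inj bij_is_surj surj_f_inv_f)
  have inv1: "inv J1 (J1 x) = x" "J1 (inv J1 x) = x" for x
    using rigid_bij[OF r1] by (simp_all add: bij_is_inj bij_is_surj surj_f_inv_f)
  have d2: "dist (inv J2 z) c2 = dist z p2" for z using rigid_inv_dist[OF r2, of z p2] inv2 by (simp add: p2_def)
  have d1: "dist (inv J1 z) c1 = dist z p1" for z using rigid_inv_dist[OF r1, of z p1] inv1 by (simp add: p1_def)
  have Q2: "inv J2 ` Q \<subseteq> E2"
  proof (rule ccontr)
    assume "\<not> ?thesis"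
    then have out: "inv J2 ` Q - E2 \<noteq> {}" by blast
    define z0 where "z0 = p2 - (s / 2) *\<^sub>R N2"
    have dz0: "dist z0 p2 = s / 2" using s0 n12 by (simp add: z0_def dist_norm)
    have z02: "z0 \<in> J2 ` E2"
    proof (rule low2)
      show "dist z0 p2 < s" using dz0 s0 by simp
      show "N2 \<bullet> (z0 - p2) < 0" using nn s0 by (simp add: z0_def)
    qed
    have "z0 \<in> Q"
    proof -
      have "dist p1 z0 \<le> dist p1 p2 + dist p2 z0" by (rule dist_triangle)
      moreover have dz: "dist p2 z0 = s / 2" using dz0 by (simp add: dist_commute)
      ultimately have 1: "dist p1 z0 < r" using p12 s r by simp
      have "N1 \<bullet> (p2 - p1) \<le> norm N1 * norm (p2 - p1)" by (rule norm_cauchy_schwarz)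
      then have "N1 \<bullet> (p2 - p1) < s / 8" using n12 p12 by (simp add: dist_norm norm_minus_commute)
      moreover have "(s / 2) * (1 / 2) < (s / 2) * (N1 \<bullet> N2)"
        using normals s0 unfolding N1_def N2_def by (intro mult_strict_left_mono) auto
      moreover have "N1 \<bullet> z0 = N1 \<bullet> p2 - (s / 2) * (N1 \<bullet> N2)" by (simp add: z0_def inner_diff_right)
      ultimately have "N1 \<bullet> z0 < N1 \<bullet> p1" using s0 inner_diff_right[of N1 p2 p1] by linarith
      then show ?thesis using 1 dz s0 by (simp add: Q_def)
    qed
    then have "inv J2 ` Q \<inter> E2 \<noteq> {}" using z02 rigid_in_image[OF r2] by blast
    moreover have "connected (inv J2 ` Q)" unfolding Q_def
      by (intro connected_continuous_image rigid_inv_continuous[OF r2] convex_connected convex_Int convex_ball convex_halfspace_lt)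
    ultimately obtain z where z: "z \<in> Q" "inv J2 z \<in> frontier E2"
      using connected_Int_frontier[OF _ _ out] by blast
    define y where "y = inv J2 z"
    have yc: "dist y c2 < s" using z(1) d2 by (simp add: y_def Q_def dist_commute)
    note y = fr2[OF z(2)[folded y_def] yc]
    obtain \<eta> where "chart J2 y \<eta>" using y(3) by blast
    then have fy: "foot (F y) = z" using chart_foot inv2 by (simp add: y_def)
    note yC = F_C[OF y(1)]
    have "D (F y) (F c1) < r"
      using D_triangle[OF yC cC(2,1)] D_commute[OF cC] y(2) near s r by linarith
    then have "z \<notin> J1 ` E1" using wall1[OF yC] fy by simp
    then show False using Q1 z(1) by blast
  qed
  \<comment> \<open>Since \<open>p1\<close> is in the closure of this piece but not behind the second wall, it is on that wall.\<close>
  define c' where "c' = inv J2 p1"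
  have c'c2: "dist c' c2 < s" using d2 p12 s0 by (simp add: c'_def)
  have "c' \<in> closure E2"
    unfolding closure_approachable
  proof (intro allI impI)
    fix e :: real assume e: "0 < e"
    define t where "t = min (e / 2) (s / 2)"
    have t: "0 < t" "t < e" "t \<le> s / 2" using e s0 by (auto simp: t_def)
    define z where "z = p1 - t *\<^sub>R N1"
    have dz: "dist z p1 = t" using t n12 by (simp add: z_def dist_norm)
    have "dist p2 z \<le> dist p1 p2 + dist z p1" using dist_triangle3[of p2 z p1] by (simp add: dist_commute)
    moreover have "N1 \<bullet> z < N1 \<bullet> p1" using t nn by (simp add: z_def inner_diff_right)
    ultimately have "z \<in> Q" using dz t p12 s0 by (simp add: Q_def dist_commute)
    then have "inv J2 z \<in> E2" using Q2 by blast
    moreover have "dist (inv J2 z) c' < e" using rigid_inv_dist[OF r2, of z p1] dz t by (simp add: c'_def)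
    ultimately show "\<exists>y\<in>E2. dist y c' < e" by blast
  qed
  moreover have "c' \<notin> E2"
  proof
    assume "c' \<in> E2"
    then have "p1 \<in> J2 ` E2" using rigid_in_image[OF r2] by (simp add: c'_def)
    moreover have "D (F c1) (F c2) < s" using near s0 by simp
    ultimately show False using wall2[OF cC(1)] foots by simp
  qed
  ultimately have "c' \<in> frontier E2"
    using open_Ext[OF sup(2) s0(1)] by (simp add: frontier_def interior_open E2_def)
  note c' = fr2[OF this c'c2]
  note c'C = F_C[OF c'(1)]
  obtain \<eta>' where ch': "chart J2 c' \<eta>'" using c'(3) by blast
  obtain \<eta>3 where \<eta>3: "0 < \<eta>3" "\<And>x. x \<notin> K \<Longrightarrow> dist x c1 < \<eta>3 \<Longrightarrow> x \<in> E1"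
    using outside_near_in_Ext[OF sup(1) r] unfolding E1_def by blast
  have \<eta>pos: "0 < \<eta>1" "0 < \<eta>'" using ch(1) ch' by (simp_all add: chart_def)
  \<comment> \<open>Both collars at \<open>p1\<close> have a common point: that of the second wall does not meet the region behind the
    first wall, hence it is inside the first copy of \<open>U\<close>.\<close>
  have "D (F c1) (F c') \<le> 0 + e" if e: "0 < e" for e
  proof -
    define \<epsilon> where "\<epsilon> = min (min (e / 2) (r / 8)) (min \<eta>1 (min \<eta>' \<eta>3))"
    have \<epsilon>: "0 < \<epsilon>" "\<epsilon> \<le> e / 2" "\<epsilon> \<le> r / 8" "\<epsilon> \<le> \<eta>1" "\<epsilon> \<le> \<eta>'" "\<epsilon> \<le> \<eta>3"
      using e r \<eta>pos \<eta>3(1) unfolding \<epsilon>_def by auto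
    define W where "W = U \<inter> ball c' \<epsilon>"
    have W: "J2 x \<in> V" "D (emb (J2 x)) (F c') < \<epsilon>" if x: "x \<in> W" for x
    proof -
      have x': "x \<in> U \<inter> ball c' \<eta>'" using x \<epsilon> by (simp add: W_def)
      have c'in: "c' \<in> \<Omega> \<inter> ball c' \<eta>'" using c'(1) \<eta>pos by simp
      have "J2 x \<in> V \<and> D (emb (J2 x)) (F c') = dist x c'" using ch' x' c'in unfolding chart_def by blast
      then show "J2 x \<in> V" "D (emb (J2 x)) (F c') < \<epsilon>" using x by (simp_all add: W_def dist_commute)
    qed
    define W' where "W' = inv J1 ` J2 ` W"
    have dW: "dist (inv J1 (J2 x)) c1 < \<epsilon>" if x: "x \<in> W" for x
    proof -
      have "dist (J2 x) p1 = dist x c'" using rigid_dist[OF r2, of x c'] inv2 by (simp add: c'_def)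
      then show ?thesis using x d1 by (simp add: W_def dist_commute)
    qed
    have "W' \<subseteq> K"
    proof
      fix y assume "y \<in> W'"
      then obtain x where x: "x \<in> W" "y = inv J1 (J2 x)" by (auto simp: W'_def)
      note xC = emb_C[OF W(1)[OF x(1)]]
      have "D (emb (J2 x)) (F c1) < r"
        using D_triangle[OF xC c'C cC(1)] D_triangle[OF c'C cC(2) cC(1)] D_commute[OF cC] W(2)[OF x(1)] c'(2) near \<epsilon>(3) s r
        by linarith
      then have "J2 x \<notin> J1 ` E1" using wall1[OF xC] foot_emb[OF W(1)[OF x(1)]] by simp
      then have "y \<notin> E1" using rigid_in_image[OF r1] x(2) by blast
      then show "y \<in> K" using \<eta>3(2)[of y] dW[OF x(1)] x(2) \<epsilon>(6) by fastforce
    qed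
    moreover have "open W'"
    proof -
      have "W' = (\<lambda>y. inv J2 (J1 y)) -` W"
      proof (intro set_eqI iffI)
        fix y assume "y \<in> W'" then show "y \<in> (\<lambda>y. inv J2 (J1 y)) -` W" using inv1 inv2 by (auto simp: W'_def)
      next
        fix y assume "y \<in> (\<lambda>y. inv J2 (J1 y)) -` W"
        then have "inv J1 (J2 (inv J2 (J1 y))) \<in> W'" by (auto simp: W'_def)
        then show "y \<in> W'" using inv1 inv2 by simp
      qed
      moreover have "continuous_on UNIV (\<lambda>y. inv J2 (J1 y))"
        by (rule continuous_on_compose2[OF rigid_inv_continuous[OF r2, of UNIV] rigid_continuous[OF r1]]) simp
      moreover have "open W" using open_U by (auto simp: W_def)
      ultimately show ?thesis by (simp add: open_vimage)
    qed
    ultimately have W'U: "W' \<subseteq> U" using interior_maximal[of W' K] interior_K by simp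
    have "c' \<in> K" using c'(1) \<Omega>_eq by blast
    then obtain x where x: "x \<in> W"
      using closure_approachable[of c' U] \<epsilon>(1) by (auto simp: W_def dist_commute)
    define y where "y = inv J1 (J2 x)"
    have y: "y \<in> U" "dist y c1 < \<epsilon>" using W'U x dW by (auto simp: W'_def y_def)
    have "D (emb (J1 y)) (F c1) = dist y c1"
    proof -
      have "y \<in> U \<inter> ball c1 \<eta>1" using y \<epsilon>(4) by (simp add: dist_commute)
      moreover have "c1 \<in> \<Omega> \<inter> ball c1 \<eta>1" using cO \<eta>pos by simp
      ultimately show ?thesis using ch(1) unfolding chart_def by blast
    qed
    then have "D (emb (J2 x)) (F c1) < \<epsilon>" using y(2) inv1 by (simp add: y_def)
    then show ?thesis
      using D_triangle[OF cC(1) emb_C[OF W(1)[OF x]] c'C] D_commute[OF cC(1) emb_C[OF W(1)[OF x]]] W(2)[OF x] \<epsilon>(2)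
      by linarith
  qed
  then have "D (F c1) (F c') \<le> 0" by (rule field_le_epsilon)
  then have "F c1 = F c'" using D_nonneg[OF cC(1) c'C] D_zero[OF cC(1) c'C] by linarith
  then have "c1 = c'" using F_eq_iff cO(1) c'(1) by blast
  then show False using c'c2 far by simp
qed

text \<open>A Baire category argument: the images of the bad points are covered by the countably many compact
  sets \<^term>\<open>F ` (\<Omega> \<inter> cball 0 k)\<close>. If each of them could be avoided near every image of a bad point, then
  nested balls would have a common point in \<open>H\<close> that is not in the image of \<open>F\<close>.\<close>
lemma bad_point_locally_bounded:
  assumes "z0 \<in> \<Omega>" "\<not> good z0"
  obtains z \<delta> B where "z \<in> \<Omega>" "\<not> good z" "0 < \<delta>"
    "\<And>y. y \<in> \<Omega> \<Longrightarrow> \<not> good y \<Longrightarrow> D (F y) (F z) < \<delta> \<Longrightarrow> norm y \<le> B"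
proof (rule ccontr)
  note obt = that
  assume no: "\<not> thesis"
  have no': "\<exists>y. y \<in> \<Omega> \<and> \<not> good y \<and> D (F y) (F z) < \<delta> \<and> B < norm y"
    if z: "z \<in> \<Omega>" "\<not> good z" "0 < \<delta>" for z \<delta> B
  proof (rule ccontr)
    assume n: "\<not> ?thesis"
    have thesis by (rule obt[OF z, of B]) (use n in force)
    then show False using no by contradiction
  qed
  have away: "\<exists>\<delta>>0. \<forall>w\<in>\<Omega>. norm w \<le> B \<longrightarrow> \<delta> \<le> D (F w) (F y)" if y: "y \<in> \<Omega>" "B < norm y" for y B
  proof -
    have "compact (\<Omega> \<inter> cball 0 B)" by (rule closed_Int_compact[OF frontier_closed compact_cball])
    moreover have "F y \<notin> F ` (\<Omega> \<inter> cball 0 B)" using F_eq_iff y by auto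
    ultimately obtain \<delta> where "0 < \<delta>" "\<And>w. w \<in> \<Omega> \<inter> cball 0 B \<Longrightarrow> \<delta> \<le> D (F w) (F y)"
      using F_away_from_compact[of "\<Omega> \<inter> cball 0 B" "F y"] F_C[OF y(1)] by blast
    then show ?thesis by auto
  qed
  \<comment> \<open>Nested balls with bad centres. The \<open>k\<close>-th ball avoids the images of all points of norm at most \<open>k\<close>,
    so no boundary point of \<open>V\<close> is left for the limit.\<close>
  define P where "P k p \<longleftrightarrow> fst p \<in> \<Omega> \<and> \<not> good (fst p) \<and> 0 < snd p \<and> snd p \<le> inverse (real (Suc k)) \<and>
      (k > 0 \<longrightarrow> (\<forall>w\<in>\<Omega>. norm w \<le> real k \<longrightarrow> 2 * snd p \<le> D (F w) (F (fst p))))" for k and p :: "'a \<times> real"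
  have "\<exists>f. \<forall>k. P k (f k) \<and> (D (F (fst (f (Suc k)))) (F (fst (f k))) < snd (f k) / 2 \<and> snd (f (Suc k)) \<le> snd (f k) / 2)"
  proof (rule dependent_nat_choice)
    show "\<exists>p. P 0 p" using assms by (intro exI[of _ "(z0, 1)"]) (simp add: P_def)
    fix p k assume p: "P k p"
    obtain y where y: "y \<in> \<Omega>" "\<not> good y" "D (F y) (F (fst p)) < snd p / 2" "real (Suc k) < norm y"
      using no'[of "fst p" "snd p / 2" "real (Suc k)"] p by (auto simp: P_def)
    obtain \<delta> where \<delta>: "\<delta> > 0" "\<forall>w\<in>\<Omega>. norm w \<le> real (Suc k) \<longrightarrow> \<delta> \<le> D (F w) (F y)" using away[OF y(1,4)] by blast
    define d where "d = min (\<delta> / 2) (min (snd p / 2) (inverse (real (Suc (Suc k)))))"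
    have d: "0 < d" "2 * d \<le> \<delta>" "d \<le> snd p / 2" "d \<le> inverse (real (Suc (Suc k)))"
      using \<delta>(1) p by (auto simp: d_def P_def)
    have "P (Suc k) (y, d)" using y(1,2) d \<delta>(2) by (fastforce simp: P_def)
    then show "\<exists>q. P (Suc k) q \<and> (D (F (fst q)) (F (fst p)) < snd p / 2 \<and> snd q \<le> snd p / 2)"
      using y(3) d(3) by (intro exI[of _ "(y, d)"]) simp
  qed
  then obtain f where f: "\<And>k. P k (f k)" "\<And>k. D (F (fst (f (Suc k)))) (F (fst (f k))) < snd (f k) / 2"
    "\<And>k. snd (f (Suc k)) \<le> snd (f k) / 2" by blast
  define z where "z k = fst (f k)" for k
  define d where "d k = snd (f k)" for k
  have zO: "z k \<in> \<Omega>" and d0: "0 < d k" and dk: "d k \<le> inverse (real (Suc k))"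
    and bound: "k > 0 \<Longrightarrow> w \<in> \<Omega> \<Longrightarrow> norm w \<le> real k \<Longrightarrow> 2 * d k \<le> D (F w) (F (z k))" for k w
    using f(1)[of k] by (auto simp: P_def z_def d_def)
  have zC: "F (z k) \<in> C" for k using F_C[OF zO] .
  have st: "D (F (z (Suc k))) (F (z k)) < d k / 2" "d (Suc k) \<le> d k / 2" for k using f(2,3) by (simp_all add: z_def d_def)
  have nest: "D (F (z (k + m))) (F (z k)) \<le> d k - d (k + m)" for k m
  proof (induction m)
    case 0 then show ?case using D_refl[OF zC] by simp
  next
    case (Suc m)
    have "D (F (z (k + Suc m))) (F (z k)) \<le> D (F (z (Suc (k + m)))) (F (z (k + m))) + D (F (z (k + m))) (F (z k))"
      using D_triangle[OF zC zC zC] by simp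
    then show ?case using Suc.IH st[of "k + m"] by simp
  qed
  have nest': "D (F (z m)) (F (z k)) < d k" if "k \<le> m" for k m
    using nest[of k "m - k"] d0[of m] that by simp
  obtain X where X: "X \<in> C" "(\<lambda>k. D (F (z k)) X) \<longlonglongrightarrow> 0"
  proof (rule D_complete[OF zC])
    fix e :: real assume e: "0 < e"
    obtain N where N: "inverse (real (Suc N)) < e / 2" using reals_Archimedean[of "e / 2"] e by auto
    have "D (F (z m)) (F (z k)) < e" if "N \<le> m" "N \<le> k" for m k
      using D_triangle[OF zC[of m] zC[of N] zC[of k]] D_commute[OF zC[of N] zC[of k]] nest'[OF that(1)] nest'[OF that(2)] dk[of N] N by linarith
    then show "\<exists>N. \<forall>m\<ge>N. \<forall>k\<ge>N. D (F (z m)) (F (z k)) < e" by blast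
  qed blast
  have "foot X \<notin> V"
  proof
    assume "foot X \<in> V"
    then obtain \<rho> where \<rho>: "\<rho> > 0" "ball (foot X) \<rho> \<subseteq> V" using open_V openE by blast
    obtain k where "D (F (z k)) X < \<rho>"
      using order_tendstoD(2)[OF X(2) \<rho>(1)] eventually_happens'[OF sequentially_bot] by blast
    then have "foot (F (z k)) \<in> V" using dist_foot_le[OF zC[of k] X(1)] \<rho>(2) by (auto simp: dist_commute)
    then show False using foot_F_notin zO by blast
  qed
  then have "X \<in> H" using X(1) by (simp add: H_eq)
  then obtain w where w: "w \<in> \<Omega>" "F w = X" by (rule F_surj)
  obtain k where k: "norm w \<le> real k" "k > 0" using real_arch_simple[of "max 1 (norm w)"] by force
  have "2 * d k \<le> D (F w) (F (z k))" by (rule bound[OF k(2) w(1) k(1)])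
  moreover have "D (F w) (F (z k)) \<le> d k"
  proof (rule LIMSEQ_le_const)
    show "(\<lambda>m. D (F (z m)) X + d k) \<longlonglongrightarrow> d k" using tendsto_add[OF X(2) tendsto_const[of "d k"]] by simp
    have "D (F w) (F (z k)) \<le> D (F (z m)) X + d k" if "k \<le> m" for m
      using D_triangle[OF X(1) zC[of m] zC[of k]] D_commute[OF X(1) zC[of m]] nest'[OF that] unfolding w(2) by linarith
    then show "\<exists>N. \<forall>m\<ge>N. D (F w) (F (z k)) \<le> D (F (z m)) X + d k" by blast
  qed
  ultimately show False using d0[of k] by linarith
qed

text \<open>At a bad point provided by the previous lemma, a sequence of boundary points tends to infinity while its
  images converge. They carry walls of the same size, and compactness of the unit sphere provides two of
  them with almost the same normal.\<close>
lemma all_points_good: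
  assumes "z0 \<in> \<Omega>"
  shows "good z0"
proof (rule ccontr)
  assume "\<not> good z0"
  obtain z \<delta> B where z: "z \<in> \<Omega>" "\<not> good z" and \<delta>: "0 < \<delta>"
    and B: "\<And>y. y \<in> \<Omega> \<Longrightarrow> \<not> good y \<Longrightarrow> D (F y) (F z) < \<delta> \<Longrightarrow> norm y \<le> B"
    using bad_point_locally_bounded[OF assms \<open>\<not> good z0\<close>] by blast
  note zC = F_C[OF z(1)]
  define r where "r = \<delta> / 40"
  define s where "s = r / 20"
  have rs: "0 < r" "0 < s" using \<delta> by (simp_all add: r_def s_def)
  have "\<exists>y. y \<in> \<Omega> \<and> D (F y) (F z) < s / 16 \<and> max B 0 + r + real k < norm y" for k
    using z rs unfolding good_def by (meson divide_pos_pos not_le zero_less_numeral)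
  then obtain c where c: "\<And>k. c k \<in> \<Omega>" "\<And>k. D (F (c k)) (F z) < s / 16" "\<And>k. max B 0 + r + real k < norm (c k)"
    by metis
  have cC: "F (c k) \<in> C" for k using F_C[OF c(1)] .
  have gd: "good y" if y: "y \<in> \<Omega>" "dist y (c k) < r" "D (F y) (F (c k)) \<le> 13 * r" for y k
  proof (rule ccontr)
    assume ng: "\<not> good y"
    have "D (F y) (F z) < \<delta>"
      using D_triangle[OF F_C[OF y(1)] cC zC, of k] y(3) c(2)[of k] \<delta> by (simp add: r_def s_def)
    then have "norm y \<le> B" using B[OF y(1) ng] by blast
    moreover have "norm (c k) \<le> norm y + dist y (c k)" using norm_triangle_ineq4[of y "y - c k"] by (simp add: dist_norm)
    ultimately show False using c(3)[of k] y(2) by linarith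
  qed
  have gn: "good_near (c k) r" for k using gd[of _ k] by (simp add: good_near_def)
  have "good (c k)" for k by (rule gd[OF c(1)[of k], of k]) (use D_refl[OF cC[of k]] rs in simp_all)
  then have "\<exists>J \<eta>. chart J (c k) \<eta>" for k using good_imp_chart by blast
  then obtain J \<eta> where J: "\<And>k. chart (J k) (c k) (\<eta> k)" by metis
  have "\<exists>n. supporting (c k) n" for k
    using supporting_normal[OF c(1)[of k]] c(1)[of k] unfolding supporting_def by metis
  then obtain n where n: "\<And>k. supporting (c k) (n k)" by metis
  \<comment> \<open>The normals of the walls.\<close>
  define N where "N k = J k (c k + n k) - J k (c k)" for k
  have N: "norm (N k) = 1" for k
    using rigid_dist[of "J k" "c k + n k" "c k"] J[of k] supportingD(3)[OF n[of k]]
    by (simp add: N_def dist_norm chart_def)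
  then have "\<forall>k. N k \<in> cball 0 1" by simp
  then obtain l q where q: "strict_mono (q :: nat \<Rightarrow> nat)" "(N \<circ> q) \<longlonglongrightarrow> l"
    using compact_cball[of 0 1] by (meson compact_def)
  obtain k0 where k0: "\<And>m k. k0 \<le> m \<Longrightarrow> k0 \<le> k \<Longrightarrow> dist (N (q m)) (N (q k)) < 1"
    using metric_CauchyD[OF LIMSEQ_imp_Cauchy[OF q(2)], of 1] by auto
  \<comment> \<open>Two members of the sequence with almost equal normals and with centres far apart in \<open>\<Omega>\<close>.\<close>
  obtain m where m: "norm (c (q k0)) + s \<le> real m" "k0 \<le> m"
  proof -
    obtain m where "norm (c (q k0)) + s \<le> real m" using real_arch_simple by blast
    then show thesis using that[of "max m k0"] by simp
  qed
  show False
  proof (rule no_two_walls[OF n n rs(1) s_def J J gn gn])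
    show "D (F (c (q k0))) (F (c (q m))) < s / 8"
      using D_triangle[OF cC[of "q k0"] zC cC[of "q m"]] D_commute[OF cC[of "q m"] zC] c(2)[of "q k0"] c(2)[of "q m"] by linarith
    have "real m \<le> real (q m)" using seq_suble[OF q(1)] by simp
    then have "norm (c (q k0)) + s \<le> norm (c (q m))" using m(1) c(3)[of "q m"] rs by linarith
    then show "s \<le> dist (c (q k0)) (c (q m))" using norm_triangle_ineq2[of "c (q m)" "c (q k0)"] by (simp add: dist_norm norm_minus_commute)
    have "dist (N (q k0)) (N (q m)) < 1" using k0 m(2) by simp
    then have "(norm (N (q k0) - N (q m)))\<^sup>2 < 1\<^sup>2" unfolding dist_norm by (intro power_strict_mono) auto
    then show "1 / 2 < (J (q k0) (c (q k0) + n (q k0)) - J (q k0) (c (q k0))) \<bullet>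
        (J (q m) (c (q m) + n (q m)) - J (q m) (c (q m)))"
      using N[of "q k0"] N[of "q m"] by (simp add: dot_norm_neg flip: N_def)
  qed
qed

section \<open>The charts fit together\<close>

text \<open>All points are good and \<open>\<Omega>\<close> is connected, so the motions of all charts agree.\<close>
lemma global_chart:
  assumes "\<Omega> \<noteq> {}"
  obtains J where "rigid J" "\<And>y. y \<in> \<Omega> \<Longrightarrow> \<exists>\<eta>. chart J y \<eta>"
proof -
  obtain c where c: "c \<in> \<Omega>" using assms by blast
  obtain J \<eta> where J: "chart J c \<eta>" using good_imp_chart[OF all_points_good[OF c]] by blast
  have "\<exists>\<eta>. chart J y \<eta>" if y: "y \<in> \<Omega>" for y
  proof (rule connected_induction_simple[where P = "\<lambda>y. \<exists>\<eta>. chart J y \<eta>", OF connected_\<Omega> c y])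
    show "\<exists>\<eta>. chart J c \<eta>" using J by blast
    fix a assume a: "a \<in> \<Omega>"
    obtain J' \<eta>' where J': "chart J' a \<eta>'" using good_imp_chart[OF all_points_good[OF a]] by blast
    have \<eta>': "0 < \<eta>'" using J' by (simp add: chart_def)
    have step: "\<exists>\<eta>. chart J z \<eta>" if x: "x \<in> \<Omega> \<inter> ball a \<eta>'" and z: "z \<in> \<Omega> \<inter> ball a \<eta>'" and ch: "\<exists>\<eta>. chart J x \<eta>" for x z
    proof -
      obtain \<eta>2 where c2: "chart J x \<eta>2" using ch by blast
      then have "0 < \<eta>2" by (simp add: chart_def)
      then have "J = J'" using chart_unique[OF c2 J', of x] x by simp
      then show ?thesis using chart_shift[OF J', of z] z by auto
    qed
    show "\<exists>T. openin (top_of_set \<Omega>) T \<and> a \<in> T \<and>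
        (\<forall>x\<in>T. \<forall>y\<in>T. (\<exists>\<eta>. chart J x \<eta>) \<longrightarrow> (\<exists>\<eta>. chart J y \<eta>))"
    proof (intro exI[of _ "\<Omega> \<inter> ball a \<eta>'"] conjI ballI impI)
      show "openin (top_of_set \<Omega>) (\<Omega> \<inter> ball a \<eta>')" by (simp add: openin_open_Int)
    qed (use a \<eta>' in simp, rule step)
  qed
  then show ?thesis using that[of J] J by (simp add: chart_def)
qed

text \<open>The set \<open>V\<close> meets \<open>J ` U\<close> but not its boundary \<open>J ` \<Omega>\<close>, so it is contained in \<open>J ` U\<close>. Conversely, the
  first point where a segment in \<open>J ` U\<close> leaves \<open>V\<close> would be the foot of some \<open>F y\<close>, that is \<open>J y\<close>
  with \<open>y\<close> in \<open>\<Omega>\<close>. The whole space is the case without boundary points.\<close>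
lemma exists_rigid_image:
  obtains J where "rigid J" "J ` U = V"
proof (cases "\<Omega> = {}")
  case True
  then have "U = UNIV" using frontier_eq_empty[of U] nonempty_U by simp
  moreover have "V = UNIV"
  proof (rule ccontr)
    assume V: "V \<noteq> UNIV"
    obtain x where x: "x \<in> V" using nonempty_V by blast
    obtain X where "X \<in> H" using nearest_boundary_point[OF x V] by blast
    then show False using F_surj True by blast
  qed
  moreover have "rigid (\<lambda>x. 0 + x)" unfolding rigid_def using orthogonal_transformation_id by blast
  ultimately show ?thesis using that[of "\<lambda>x. 0 + x"] by simp
next
  case False
  obtain J where J: "rigid J" "\<And>y. y \<in> \<Omega> \<Longrightarrow> \<exists>\<eta>. chart J y \<eta>" using global_chart[OF False] by blast
  have foot: "foot (F y) = J y" if "y \<in> \<Omega>" for y using J(2)[OF that] chart_foot by blast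
  have J\<Omega>: "J y \<notin> V" if "y \<in> \<Omega>" for y using foot_F_notin[OF that] foot[OF that] by simp
  obtain c \<eta> where c: "c \<in> \<Omega>" "chart J c \<eta>" using False J(2) by blast
  have "0 < \<eta>" "c \<in> K" using c \<Omega>_eq by (auto simp: chart_def)
  then obtain u where u: "u \<in> U" "dist u c < \<eta>" using closure_approachable[of c U] by blast
  have JuV: "J u \<in> V" using c(2) u by (auto simp: chart_def dist_commute)
  have inv: "inv J (J x) = x" "J (inv J x) = x" for x
    using rigid_bij[OF J(1)] by (simp_all add: bij_is_inj bij_is_surj surj_f_inv_f)
  have "inv J ` V \<subseteq> U"
  proof (rule ccontr)
    assume "\<not> ?thesis"
    then have "inv J ` V - U \<noteq> {}" by blast
    moreover have "u \<in> inv J ` V" using JuV inv by (metis image_eqI)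
    moreover have "connected (inv J ` V)"
      by (rule connected_continuous_image[OF rigid_inv_continuous[OF J(1)] connected_V])
    ultimately have "inv J ` V \<inter> \<Omega> \<noteq> {}" using u(1) by (intro connected_Int_frontier) auto
    then obtain v where v: "v \<in> V" "inv J v \<in> \<Omega>" by blast
    then show False using J\<Omega>[OF v(2)] inv by simp
  qed
  then have VU: "V \<subseteq> J ` U" using rigid_in_image[OF J(1)] by blast
  have "J x \<in> V" if x: "x \<in> U" for x
  proof (rule ccontr)
    assume no: "J x \<notin> V"
    obtain X where X: "X \<in> H" "foot X \<in> closed_segment (J u) (J x)" by (rule first_exit[OF JuV no])
    obtain y where y: "y \<in> \<Omega>" "F y = X" by (rule F_surj[OF X(1)])
    have "J y \<in> J ` closed_segment u x" using X(2) foot[OF y(1)] y(2) rigid_segment[OF J(1)] by simp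
    then have "y \<in> closed_segment u x" using rigid_in_image'[OF J(1)] by blast
    then have "y \<in> U" using closed_segment_subset[OF u(1) x convex_U] by blast
    then show False using y(1) \<Omega>_eq by blast
  qed
  then have "J ` U = V" using VU by blast
  then show ?thesis using that J(1) by blast
qed

end

section \<open>Unique determination\<close>

context strictly_convex
begin

interpretation U: domain U
  by unfold_locales (rule domain_U)

lemma intrinsic_dist_U: "x \<in> U \<Longrightarrow> y \<in> U \<Longrightarrow> intrinsic_dist U x y = dist x y"
  using convex_U by (intro intrinsic_dist_segment) (simp add: convex_contains_segment)

lemma relative_dist_U:
  assumes X: "X \<in> U.C" and Y: "Y \<in> U.C"
  shows "relative_dist U X Y = dist (foot X) (foot Y)"
proof -
  obtain s t where st: "s \<in> X" "t \<in> Y"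
    using U.I.cpoints_nonempty[OF X] U.I.cpoints_nonempty[OF Y] by blast
  have "intrinsic_dist U (s k) (t k) = dist (s k) (t k)" for k
    using intrinsic_dist_U U.I.cpoints_in_M[OF X st(1)] U.I.cpoints_in_M[OF Y st(2)] by blast
  then have "(\<lambda>k. dist (s k) (t k)) \<longlonglongrightarrow> relative_dist U X Y"
    using U.I.cdist_tendsto[OF X Y st] by (simp add: relative_dist_def)
  moreover have "(\<lambda>k. dist (s k) (t k)) \<longlonglongrightarrow> dist (foot X) (foot Y)"
    by (rule tendsto_dist[OF U.rep_tendsto_foot[OF X st(1)] U.rep_tendsto_foot[OF Y st(2)]])
  ultimately show ?thesis by (rule LIMSEQ_unique)
qed

text \<open>For a convex domain the Hausdorff boundary is the boundary with the Euclidean distance.\<close>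
lemma bij_foot: "bij_betw foot (hausdorff_boundary U) \<Omega>"
proof (rule bij_betw_imageI)
  show "inj_on foot (hausdorff_boundary U)"
  proof (rule inj_onI)
    fix X Y assume XY: "X \<in> hausdorff_boundary U" "Y \<in> hausdorff_boundary U" "foot X = foot Y"
    then show "X = Y" using relative_dist_U U.D_zero U.H_C by simp
  qed
  show "foot ` hausdorff_boundary U = \<Omega>"
  proof (intro equalityI subsetI)
    fix y assume "y \<in> foot ` hausdorff_boundary U"
    then show "y \<in> \<Omega>" using U.foot_closure U.H_eq \<Omega>_eq by auto
  next
    fix y assume y: "y \<in> \<Omega>"
    then have "y \<in> K" using \<Omega>_eq by blast
    then obtain s where s: "\<And>k. s k \<in> U" "s \<longlonglongrightarrow> y" using closure_sequential by blast
    have "U.I.MCauchy s"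
      unfolding U.I.MCauchy_def
    proof (intro conjI allI impI)
      show "range s \<subseteq> U" using s by blast
      fix e :: real assume "0 < e"
      then obtain N where "\<forall>m\<ge>N. \<forall>k\<ge>N. dist (s m) (s k) < e"
        using metric_CauchyD[OF LIMSEQ_imp_Cauchy[OF s(2)]] by blast
      then show "\<exists>N. \<forall>m k. N \<le> m \<longrightarrow> N \<le> k \<longrightarrow> intrinsic_dist U (s m) (s k) < e"
        using intrinsic_dist_U s(1) by auto
    qed
    then obtain X where X: "X \<in> U.C" "s \<in> X" by (rule U.I.MCauchy_class)
    have "foot X = y" using LIMSEQ_unique[OF U.rep_tendsto_foot[OF X] s(2)] .
    then show "y \<in> foot ` hausdorff_boundary U" using X(1) y \<Omega>_eq by (auto simp: U.H_eq intro!: image_eqI[of _ _ X])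
  qed
qed

lemma isometric_if_boundaries_locally_isometric:
  assumes V: "is_domain V" and iso: "locally_isometric_boundaries U V"
  shows "euclidean_isometric U V"
proof -
  obtain f where f: "bij_betw f (hausdorff_boundary U) (hausdorff_boundary V)"
    and loc: "\<And>y. y \<in> hausdorff_boundary U \<Longrightarrow> \<exists>\<epsilon>>0.
       \<forall>a\<in>{z\<in>hausdorff_boundary U. relative_dist U z y < \<epsilon>}.
       \<forall>b\<in>{z\<in>hausdorff_boundary U. relative_dist U z y < \<epsilon>}.
         relative_dist U a b = relative_dist V (f a) (f b)"
    using iso unfolding locally_isometric_boundaries_def by blast
  define g where "g = inv_into (hausdorff_boundary U) foot"
  have g: "bij_betw g \<Omega> (hausdorff_boundary U)" unfolding g_def by (rule bij_betw_inv_into[OF bij_foot])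
  have gH: "g y \<in> hausdorff_boundary U" if "y \<in> \<Omega>" for y using g that by (auto simp: bij_betw_def)
  have fg: "foot (g y) = y" if "y \<in> \<Omega>" for y
    unfolding g_def using that bij_foot by (simp add: bij_betw_inv_into_right)
  have dg: "relative_dist U (g x) (g y) = dist x y" if "x \<in> \<Omega>" "y \<in> \<Omega>" for x y
    using relative_dist_U[OF U.H_C[OF gH[OF that(1)]] U.H_C[OF gH[OF that(2)]]] fg that by simp
  interpret boundary_isometry U V "f \<circ> g"
  proof unfold_locales
    show "is_domain V" by (rule V)
    show "bij_betw (f \<circ> g) \<Omega> (hausdorff_boundary V)" by (rule bij_betw_trans[OF g f])
    fix y assume y: "y \<in> \<Omega>"
    obtain \<epsilon> where \<epsilon>: "\<epsilon> > 0" "\<forall>a\<in>{z\<in>hausdorff_boundary U. relative_dist U z (g y) < \<epsilon>}.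
       \<forall>b\<in>{z\<in>hausdorff_boundary U. relative_dist U z (g y) < \<epsilon>}.
         relative_dist U a b = relative_dist V (f a) (f b)"
      using loc[OF gH[OF y]] by blast
    have "relative_dist V ((f \<circ> g) a) ((f \<circ> g) b) = dist a b" if ab: "a \<in> \<Omega> \<inter> ball y \<epsilon>" "b \<in> \<Omega> \<inter> ball y \<epsilon>" for a b
    proof -
      have "g a \<in> {z\<in>hausdorff_boundary U. relative_dist U z (g y) < \<epsilon>}"
        "g b \<in> {z\<in>hausdorff_boundary U. relative_dist U z (g y) < \<epsilon>}"
        using ab gH dg y by (auto simp: dist_commute)
      then have "relative_dist U (g a) (g b) = relative_dist V (f (g a)) (f (g b))" using \<epsilon>(2) by blast
      then show ?thesis using dg ab by simp
    qed
    then show "\<exists>\<epsilon>>0. \<forall>a\<in>\<Omega> \<inter> ball y \<epsilon>. \<forall>b\<in>\<Omega> \<inter> ball y \<epsilon>. relative_dist V ((f \<circ> g) a) ((f \<circ> g) b) = dist a b"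
      using \<epsilon>(1) by blast
  qed
  obtain J where "rigid J" "J ` U = V" by (rule exists_rigid_image)
  then show ?thesis unfolding euclidean_isometric_def using rigid_dist by blast
qed

end

theorem theorem4p3:
  fixes U :: "(real ^ 'n) set"
  assumes "CARD('n) \<ge> 2"
    and "strictly_convex_domain U"
  shows "uniquely_determined_in {V :: (real ^ 'n) set. is_domain V} U"
proof -
  interpret strictly_convex U
    by unfold_locales (use assms in simp_all)
  show ?thesis
    unfolding uniquely_determined_in_def
    using domain_U isometric_if_boundaries_locally_isometric by blast
qed

end
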